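(* Let $q\in\mathbb{C}\setminus\{0\}$ be not a root of unity. Let $\mathcal{S}$ be the set of all $U_q(\mathfrak{sl}_2)$-module algebra structures on the quantum plane $\mathbb{C}_q[x,y]$ such that $$(\mathsf{e}(x))_0=0,\quad(\mathsf{e}(y))_0=0,\quad(\mathsf{f}(x))_0=0,\quad(\mathsf{f}(y))_0\ne 0,$$ $$(\mathsf{e}(x))_1=(\mathsf{e}(y))_1=(\mathsf{f}(x))_1=(\mathsf{f}(y))_1=0 .$$ Then $\mathcal{S}$ consists of exactly the three-parameter family, indexed by $(d_0,s,t)$ with $d_0\in\mathbb{C}\setminus\{0\}$, $s,t\in\mathbb{C}$, of structures given by $$\mathsf{k}(x)=qx,\quad \mathsf{k}(y)=q^2y,\quad \mathsf{e}(x)=-qd_0^{-1}xy+sx^3,\quad \mathsf{e}(y)=-qd_0^{-1}y^2+tx^4,$$ $$\mathsf{f}(x)=0,\quad \mathsf{f}(y)=d_0$$ (each such triple gives a well-defined structure). The domain $\{(d_0,s,t)\mid s\ne 0,\ t\ne 0\}$ splits into the disjoint subsets $\{(d_0,s,t)\mid s\ne 0,\ t\ne 0,\ \varphi=\mathrm{const}\}$, where $\varphi=\dfrac{t}{d_0s^2}$, and this uncountable family of subsets is in one-to-one correspondence with isomorphism classes of $U_q(\mathfrak{sl}_2)$-module algebra structures. Aside from those, there are exactly three more isomorphism classes in $\mathcal{S}$, labelled by the subsets $$\{(d_0,s,t)\mid s\ne 0,\ t=0\},\quad\{(d_0,s,t)\mid s=0,\ t\ne 0\},\quad\{(d_0,s,t)\mid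 s=0,\ t=0\}.$$
   Context: The quantum plane $\mathbb{C}_q[x,y]$ is the unital associative $\mathbb{C}$-algebra with generators $x,y$ and the single relation $yx=qxy$; the monomials $x^my^n$ ($m,n\ge 0$) form a basis. Its $i$-th homogeneous component is the linear span of the $x^my^n$ with $m+n=i$; for a polynomial $p$, $(p)_i$ denotes the projection of $p$ to the $i$-th homogeneous component (parallel to the other components). $U_q(\mathfrak{sl}_2)$ is the unital associative $\mathbb{C}$-algebra with generators $\mathsf{k},\mathsf{k}^{-1},\mathsf{e},\mathsf{f}$ and relations $\mathsf{k}^{-1}\mathsf{k}=\mathsf{k}\mathsf{k}^{-1}=\mathbf{1}$, $\mathsf{k}\mathsf{e}=q^2\mathsf{e}\mathsf{k}$, $\mathsf{k}\mathsf{f}=q^{-2}\mathsf{f}\mathsf{k}$, $\mathsf{e}\mathsf{f}-\mathsf{f}\mathsf{e}=\frac{\mathsf{k}-\mathsf{k}^{-1}}{q-q^{-1}}$, with Hopf algebra structure $\Delta(\mathsf{k})=\mathsf{k}\otimes\mathsf{k}$, $\Delta(\mathsf{e})=\mathbf{1}\otimes\mathsf{e}+\mathsf{e}\otimes\mathsf{k}$, $\Delta(\mathsf{f})=\mathsf{f}\otimes\mathbf{1}+\mathsf{k}^{-1}\otimes\mathsf{f}$, $\varepsilon(\mathsf{k})=1$, $\varepsilon(\mathsf{e})=\varepsilon(\mathsf{f})=0$, $S(\mathsf{k})=\mathsf{k}^{-1}$, $S(\mathsf{e})=-\mathsf{e}\mathsf{k}^{-1}$, $S(\mathsf{f})=-\mathsf{k}\mathsf{f}$.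 For a Hopf algebra $H$ and a unital algebra $A$, a structure of $H$-module algebra on $A$ is an algebra homomorphism $\pi:H\to\operatorname{End}_{\mathbb{C}}A$ such that $\pi(h)(ab)=\sum_i\pi(h_i')(a)\,\pi(h_i'')(b)$ (where $\Delta(h)=\sum_i h_i'\otimes h_i''$) and $\pi(h)(\mathbf{1})=\varepsilon(h)\mathbf{1}$ for all $h\in H$, $a,b\in A$. One writes $h(a)$ for $\pi(h)(a)$. A structure on $\mathbb{C}_q[x,y]$ is uniquely determined by the values of $\mathsf{k},\mathsf{e},\mathsf{f}$ on $x,y$. Structures $\pi_1,\pi_2$ are isomorphic if there is an algebra automorphism $\Psi$ of $A$ with $\Psi\pi_1(h)\Psi^{-1}=\pi_2(h)$ for all $h\in H$. In all parameter subsets, $d_0$ ranges over $\mathbb{C}\setminus\{0\}$ and $s,t$ over $\mathbb{C}$. The correspondence between subsets and isomorphism classes means that two structures of the family are isomorphic if and only if their parameter triples lie in the same one of the listed subsets. *)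

theory Defs
  imports Complex_Main "HOL-Algebra.QuotRing" "HOL-Algebra.Module"
    "HOL-Library.Disjoint_Sets" "HOL-Library.Countable_Set"
begin

section \<open>Unital associative complex algebras\<close>

text \<open>
  A (not necessarily commutative) complex algebra is carried by the record type
  \<^type>\<open>module\<close>, which extends a ring by a scalar multiplication; the scalars are the
  HOL type of complex numbers.
\<close>

definition alg_hom ::
  "(complex, 'a, 'm) module_scheme \<Rightarrow> (complex, 'b, 'n) module_scheme \<Rightarrow> ('a \<Rightarrow> 'b) set" where
  "alg_hom A B = {h \<in> ring_hom A B. \<forall>c. \<forall>a\<in>carrier A. h (c \<odot>\<^bsub>A\<^esub> a) = c \<odot>\<^bsub>B\<^esub> h a}"

definition lin_span :: "(complex, 'a, 'm) module_scheme \<Rightarrow> 'a set \<Rightarrow> 'a set" where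
  "lin_span A V = {\<Oplus>\<^bsub>A\<^esub> v\<in>T. c v \<odot>\<^bsub>A\<^esub> v | T c. finite T \<and> T \<subseteq> V}"

definition complex_algebra :: "(complex, complex) module" where
  "complex_algebra =
    \<lparr>carrier = UNIV, mult = (*), one = 1, zero = 0, add = (+), smult = (*)\<rparr>"

definition opposite_algebra ::
  "(complex, 'a, 'm) module_scheme \<Rightarrow> (complex, 'a, 'm) module_scheme" where
  "opposite_algebra A = A\<lparr>mult := (\<lambda>a b. b \<otimes>\<^bsub>A\<^esub> a)\<rparr>"

text \<open>The algebra of linear endomorphisms; the product is composition.\<close>

definition lin_end :: "(complex, 'a, 'm) module_scheme \<Rightarrow> (complex, 'a \<Rightarrow> 'a) module" where
  "lin_end A =
    \<lparr>carrier = {T \<in> carrier A \<rightarrow>\<^sub>E carrier A.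
        (\<forall>a\<in>carrier A. \<forall>b\<in>carrier A. T (a \<oplus>\<^bsub>A\<^esub> b) = T a \<oplus>\<^bsub>A\<^esub> T b) \<and>
        (\<forall>c. \<forall>a\<in>carrier A. T (c \<odot>\<^bsub>A\<^esub> a) = c \<odot>\<^bsub>A\<^esub> T a)},
     mult = compose (carrier A),
     one = (\<lambda>a\<in>carrier A. a),
     zero = (\<lambda>a\<in>carrier A. \<zero>\<^bsub>A\<^esub>),
     add = (\<lambda>S T. \<lambda>a\<in>carrier A. S a \<oplus>\<^bsub>A\<^esub> T a),
     smult = (\<lambda>c T. \<lambda>a\<in>carrier A. c \<odot>\<^bsub>A\<^esub> T a)\<rparr>"

text \<open>
  The quotient ring of the library, with the induced scalar multiplication on cosets
  (written in the style of \<^const>\<open>rcoset_mult\<close>).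
\<close>

definition quot_algebra ::
  "(complex, 'a, 'm) module_scheme \<Rightarrow> 'a set \<Rightarrow> (complex, 'a set) module" where
  "quot_algebra A I = ring.extend (A Quot I)
     (module.fields (\<lambda>c X. \<Union>a\<in>X. I +>\<^bsub>A\<^esub> (c \<odot>\<^bsub>A\<^esub> a)))"


section \<open>Monoid algebras, presentations and tensor products\<close>

text \<open>Finitely supported functions on a monoid, with convolution as product.\<close>

definition monoid_algebra :: "('a, 'm) monoid_scheme \<Rightarrow> (complex, 'a \<Rightarrow> complex) module" where
  "monoid_algebra M =
    \<lparr>carrier = {f. finite {a. f a \<noteq> 0} \<and> {a. f a \<noteq> 0} \<subseteq> carrier M},
     mult = (\<lambda>f g c. \<Sum>(a, b)\<in>{(a, b). f a \<noteq> 0 \<and> g b \<noteq> 0 \<and> a \<otimes>\<^bsub>M\<^esub> b = c}. f a * g b),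
     one = (\<lambda>c. if c = \<one>\<^bsub>M\<^esub> then 1 else 0),
     zero = (\<lambda>c. 0),
     add = (\<lambda>f g c. f c + g c),
     smult = (\<lambda>z f c. z * f c)\<rparr>"

definition single :: "'a \<Rightarrow> 'a \<Rightarrow> complex" where
  "single a = (\<lambda>b. if b = a then 1 else 0)"

definition free_algebra :: "(complex, 'g list \<Rightarrow> complex) module" where
  "free_algebra = monoid_algebra \<lparr>carrier = UNIV, mult = (@), one = []\<rparr>"

text \<open>A relation is given as the pair of its two sides.\<close>

definition relation_ideal ::
  "(('g list \<Rightarrow> complex) \<times> ('g list \<Rightarrow> complex)) set \<Rightarrow> ('g list \<Rightarrow> complex) set" where
  "relation_ideal R = Idl\<^bsub>free_algebra\<^esub> {l \<ominus>\<^bsub>free_algebra\<^esub> r | l r. (l, r) \<in> R}"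

definition presented_algebra ::
  "(('g list \<Rightarrow> complex) \<times> ('g list \<Rightarrow> complex)) set \<Rightarrow> (complex, ('g list \<Rightarrow> complex) set) module" where
  "presented_algebra R = quot_algebra free_algebra (relation_ideal R)"

definition presented_gen ::
  "(('g list \<Rightarrow> complex) \<times> ('g list \<Rightarrow> complex)) set \<Rightarrow> 'g \<Rightarrow> ('g list \<Rightarrow> complex) set" where
  "presented_gen R g = relation_ideal R +>\<^bsub>free_algebra\<^esub> single [g]"

text \<open>
  The algebra homomorphism from a presented algebra to \<open>B\<close> that sends each generator
  \<open>g\<close> to \<open>\<phi> g\<close>: if \<open>\<phi>\<close> satisfies the defining relations then \<open>free_eval B \<phi>\<close> is constant
  on every coset.
\<close>

definition free_eval ::
  "(complex, 'b, 'n) module_scheme \<Rightarrow> ('g \<Rightarrow> 'b) \<Rightarrow> ('g list \<Rightarrow> complex) \<Rightarrow> 'b" where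
  "free_eval B \<phi> f =
    (\<Oplus>\<^bsub>B\<^esub> w\<in>{w. f w \<noteq> 0}. f w \<odot>\<^bsub>B\<^esub> foldr (\<lambda>g b. \<phi> g \<otimes>\<^bsub>B\<^esub> b) w \<one>\<^bsub>B\<^esub>)"

definition presented_lift ::
  "(complex, 'b, 'n) module_scheme \<Rightarrow> ('g \<Rightarrow> 'b) \<Rightarrow> ('g list \<Rightarrow> complex) set \<Rightarrow> 'b" where
  "presented_lift B \<phi> X = the_elem (free_eval B \<phi> ` X)"

text \<open>
  The tensor product of algebras is the monoid algebra of the product of the two
  multiplicative monoids modulo the bilinearity relations.  The linear span of these relations is
  already a two-sided ideal, so the underlying vector space is the usual tensor product, with
  product \<open>(a \<otimes> b)(a' \<otimes> b') = aa' \<otimes> bb'\<close>.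
\<close>

definition tensor_ideal ::
  "(complex, 'a, 'm) module_scheme \<Rightarrow> (complex, 'b, 'n) module_scheme \<Rightarrow> ('a \<times> 'b \<Rightarrow> complex) set" where
  "tensor_ideal A B = (let F = monoid_algebra (A \<times>\<times> B) in
     Idl\<^bsub>F\<^esub>
      ({single (a \<oplus>\<^bsub>A\<^esub> a', b) \<ominus>\<^bsub>F\<^esub> (single (a, b) \<oplus>\<^bsub>F\<^esub> single (a', b)) | a a' b.
          a \<in> carrier A \<and> a' \<in> carrier A \<and> b \<in> carrier B} \<union>
       {single (a, b \<oplus>\<^bsub>B\<^esub> b') \<ominus>\<^bsub>F\<^esub> (single (a, b) \<oplus>\<^bsub>F\<^esub> single (a, b')) | a b b'.
          a \<in> carrier A \<and> b \<in> carrier B \<and> b' \<in> carrier B} \<union>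
       {single (c \<odot>\<^bsub>A\<^esub> a, b) \<ominus>\<^bsub>F\<^esub> c \<odot>\<^bsub>F\<^esub> single (a, b) | c a b.
          a \<in> carrier A \<and> b \<in> carrier B} \<union>
       {single (a, c \<odot>\<^bsub>B\<^esub> b) \<ominus>\<^bsub>F\<^esub> c \<odot>\<^bsub>F\<^esub> single (a, b) | c a b.
          a \<in> carrier A \<and> b \<in> carrier B}))"

definition tensor_algebra ::
  "(complex, 'a, 'm) module_scheme \<Rightarrow> (complex, 'b, 'n) module_scheme \<Rightarrow>
    (complex, ('a \<times> 'b \<Rightarrow> complex) set) module" where
  "tensor_algebra A B = quot_algebra (monoid_algebra (A \<times>\<times> B)) (tensor_ideal A B)"

definition pure_tensor ::
  "(complex, 'a, 'm) module_scheme \<Rightarrow> (complex, 'b, 'n) module_scheme \<Rightarrow> 'a \<Rightarrow> 'b \<Rightarrow>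
    ('a \<times> 'b \<Rightarrow> complex) set" where
  "pure_tensor A B a b = tensor_ideal A B +>\<^bsub>monoid_algebra (A \<times>\<times> B)\<^esub> single (a, b)"


section \<open>Module algebras over a Hopf algebra\<close>

record 'h hopf_algebra = "(complex, 'h) module" +
  comult :: "'h \<Rightarrow> ('h \<times> 'h \<Rightarrow> complex) set"
  counit :: "'h \<Rightarrow> complex"
  antipode :: "'h \<Rightarrow> 'h"

text \<open>
  The comultiplication takes values in \<^term>\<open>tensor_algebra H H\<close>.  The compatibility with the
  product of \<open>A\<close> is required for every way of writing \<open>\<Delta>(h)\<close> as a finite sum
  \<open>\<Sum>\<^sub>i h'\<^sub>i \<otimes> h''\<^sub>i\<close>; as \<open>\<pi>\<close> is linear, it does not depend on the choice.
  Structures are functions on the carrier of \<open>H\<close>, hence the restriction to \<^const>\<open>extensional\<close>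
  ones, which makes HOL equality the equality of structures.
\<close>

definition module_algebra_structures ::
  "('h, 'm) hopf_algebra_scheme \<Rightarrow> (complex, 'a, 'n) module_scheme \<Rightarrow> ('h \<Rightarrow> 'a \<Rightarrow> 'a) set" where
  "module_algebra_structures H A =
    {\<pi> \<in> alg_hom H (lin_end A) \<inter> extensional (carrier H).
      (\<forall>h\<in>carrier H. \<forall>a\<in>carrier A. \<forall>b\<in>carrier A. \<forall>(n::nat) h1 h2.
         (\<forall>i<n. h1 i \<in> carrier H \<and> h2 i \<in> carrier H) \<longrightarrow>
         comult H h = (\<Oplus>\<^bsub>tensor_algebra H H\<^esub> i\<in>{..<n}. pure_tensor H H (h1 i) (h2 i)) \<longrightarrow>
         \<pi> h (a \<otimes>\<^bsub>A\<^esub> b) = (\<Oplus>\<^bsub>A\<^esub> i\<in>{..<n}. \<pi> (h1 i) a \<otimes>\<^bsub>A\<^esub> \<pi> (h2 i) b)) \<and>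
      (\<forall>h\<in>carrier H. \<pi> h \<one>\<^bsub>A\<^esub> = counit H h \<odot>\<^bsub>A\<^esub> \<one>\<^bsub>A\<^esub>)}"

definition isomorphic_structures ::
  "('h, 'm) hopf_algebra_scheme \<Rightarrow> (complex, 'a, 'n) module_scheme \<Rightarrow>
    ('h \<Rightarrow> 'a \<Rightarrow> 'a) \<Rightarrow> ('h \<Rightarrow> 'a \<Rightarrow> 'a) \<Rightarrow> bool" where
  "isomorphic_structures H A \<pi>1 \<pi>2 \<longleftrightarrow>
    (\<exists>\<Psi>\<in>alg_hom A A. bij_betw \<Psi> (carrier A) (carrier A) \<and>
      (\<forall>h\<in>carrier H. \<forall>a\<in>carrier A. \<Psi> (\<pi>1 h (inv_into (carrier A) \<Psi> a)) = \<pi>2 h a))"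

definition structure_iso_rel ::
  "('h, 'm) hopf_algebra_scheme \<Rightarrow> (complex, 'a, 'n) module_scheme \<Rightarrow>
    (('h \<Rightarrow> 'a \<Rightarrow> 'a) \<times> ('h \<Rightarrow> 'a \<Rightarrow> 'a)) set" where
  "structure_iso_rel H A =
    {(\<pi>1, \<pi>2). \<pi>1 \<in> module_algebra_structures H A \<and> \<pi>2 \<in> module_algebra_structures H A \<and>
      isomorphic_structures H A \<pi>1 \<pi>2}"


section \<open>The Hopf algebra \<open>U\<^sub>q(sl\<^sub>2)\<close>\<close>

datatype uq_gen = GK | GKinv | GE | GF

type_synonym uq = "(uq_gen list \<Rightarrow> complex) set"

definition uq_relations ::
  "complex \<Rightarrow> ((uq_gen list \<Rightarrow> complex) \<times> (uq_gen list \<Rightarrow> complex)) set" where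
  "uq_relations q = (let F = free_algebra; k = single [GK]; k' = single [GKinv];
                         e = single [GE]; f = single [GF] in
     {(k' \<otimes>\<^bsub>F\<^esub> k, \<one>\<^bsub>F\<^esub>),
      (k \<otimes>\<^bsub>F\<^esub> k', \<one>\<^bsub>F\<^esub>),
      (k \<otimes>\<^bsub>F\<^esub> e, q\<^sup>2 \<odot>\<^bsub>F\<^esub> (e \<otimes>\<^bsub>F\<^esub> k)),
      (k \<otimes>\<^bsub>F\<^esub> f, inverse (q\<^sup>2) \<odot>\<^bsub>F\<^esub> (f \<otimes>\<^bsub>F\<^esub> k)),
      (e \<otimes>\<^bsub>F\<^esub> f \<ominus>\<^bsub>F\<^esub> f \<otimes>\<^bsub>F\<^esub> e, (1 / (q - inverse q)) \<odot>\<^bsub>F\<^esub> (k \<ominus>\<^bsub>F\<^esub> k'))})"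

definition uq_algebra :: "complex \<Rightarrow> (complex, uq) module" where
  "uq_algebra q = presented_algebra (uq_relations q)"

definition uq_k :: "complex \<Rightarrow> uq" where "uq_k q = presented_gen (uq_relations q) GK"
definition uq_kinv :: "complex \<Rightarrow> uq" where "uq_kinv q = presented_gen (uq_relations q) GKinv"
definition uq_e :: "complex \<Rightarrow> uq" where "uq_e q = presented_gen (uq_relations q) GE"
definition uq_f :: "complex \<Rightarrow> uq" where "uq_f q = presented_gen (uq_relations q) GF"

definition uq_comult :: "complex \<Rightarrow> uq \<Rightarrow> (uq \<times> uq \<Rightarrow> complex) set" where
  "uq_comult q = (let U = uq_algebra q; UU = tensor_algebra U U; t = pure_tensor U U in
     presented_lift UU
       (case_uq_gen
         (t (uq_k q) (uq_k q))
         (t (uq_kinv q) (uq_kinv q))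
         (t \<one>\<^bsub>U\<^esub> (uq_e q) \<oplus>\<^bsub>UU\<^esub> t (uq_e q) (uq_k q))
         (t (uq_f q) \<one>\<^bsub>U\<^esub> \<oplus>\<^bsub>UU\<^esub> t (uq_kinv q) (uq_f q))))"

definition uq_counit :: "uq \<Rightarrow> complex" where
  "uq_counit = presented_lift complex_algebra (case_uq_gen 1 1 0 0)"

text \<open>The antipode is an anti-homomorphism, i.e. a homomorphism to the opposite algebra.\<close>

definition uq_antipode :: "complex \<Rightarrow> uq \<Rightarrow> uq" where
  "uq_antipode q = (let U = uq_algebra q in
     presented_lift (opposite_algebra U)
       (case_uq_gen (uq_kinv q) (uq_k q)
         (\<ominus>\<^bsub>U\<^esub> (uq_e q \<otimes>\<^bsub>U\<^esub> uq_kinv q))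
         (\<ominus>\<^bsub>U\<^esub> (uq_k q \<otimes>\<^bsub>U\<^esub> uq_f q))))"

definition Uq :: "complex \<Rightarrow> uq hopf_algebra" where
  "Uq q = module.extend (uq_algebra q)
     (hopf_algebra.fields (uq_comult q) uq_counit (uq_antipode q))"


section \<open>The quantum plane\<close>

datatype qp_gen = GX | GY

type_synonym qp = "(qp_gen list \<Rightarrow> complex) set"

definition qp_relations ::
  "complex \<Rightarrow> ((qp_gen list \<Rightarrow> complex) \<times> (qp_gen list \<Rightarrow> complex)) set" where
  "qp_relations q = (let F = free_algebra; x = single [GX]; y = single [GY] in
     {(y \<otimes>\<^bsub>F\<^esub> x, q \<odot>\<^bsub>F\<^esub> (x \<otimes>\<^bsub>F\<^esub> y))})"

definition qplane :: "complex \<Rightarrow> (complex, qp) module" where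
  "qplane q = presented_algebra (qp_relations q)"

definition qp_x :: "complex \<Rightarrow> qp" where "qp_x q = presented_gen (qp_relations q) GX"
definition qp_y :: "complex \<Rightarrow> qp" where "qp_y q = presented_gen (qp_relations q) GY"

definition qp_monom :: "complex \<Rightarrow> nat \<Rightarrow> nat \<Rightarrow> qp" where
  "qp_monom q m n = qp_x q [^]\<^bsub>qplane q\<^esub> m \<otimes>\<^bsub>qplane q\<^esub> qp_y q [^]\<^bsub>qplane q\<^esub> n"

definition qp_component :: "complex \<Rightarrow> nat \<Rightarrow> qp set" where
  "qp_component q i = lin_span (qplane q) {qp_monom q m n | m n. m + n = i}"

text \<open>
  Projection to the \<open>i\<close>-th homogeneous component parallel to all the others; the description
  is unique because the monomials form a basis.
\<close>

definition qp_proj :: "complex \<Rightarrow> nat \<Rightarrow> qp \<Rightarrow> qp" where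
  "qp_proj q i p = (THE r. r \<in> qp_component q i \<and>
     (\<exists>s\<in>lin_span (qplane q) {qp_monom q m n | m n. m + n \<noteq> i}. p = r \<oplus>\<^bsub>qplane q\<^esub> s))"


section \<open>The series of structures\<close>

definition uq_structures :: "complex \<Rightarrow> (uq \<Rightarrow> qp \<Rightarrow> qp) set" where
  "uq_structures q = module_algebra_structures (Uq q) (qplane q)"

definition series :: "complex \<Rightarrow> (uq \<Rightarrow> qp \<Rightarrow> qp) set" where
  "series q = {\<pi> \<in> uq_structures q.
     qp_proj q 0 (\<pi> (uq_e q) (qp_x q)) = \<zero>\<^bsub>qplane q\<^esub> \<and>
     qp_proj q 0 (\<pi> (uq_e q) (qp_y q)) = \<zero>\<^bsub>qplane q\<^esub> \<and>
     qp_proj q 0 (\<pi> (uq_f q) (qp_x q)) = \<zero>\<^bsub>qplane q\<^esub> \<and>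
     qp_proj q 0 (\<pi> (uq_f q) (qp_y q)) \<noteq> \<zero>\<^bsub>qplane q\<^esub> \<and>
     qp_proj q 1 (\<pi> (uq_e q) (qp_x q)) = \<zero>\<^bsub>qplane q\<^esub> \<and>
     qp_proj q 1 (\<pi> (uq_e q) (qp_y q)) = \<zero>\<^bsub>qplane q\<^esub> \<and>
     qp_proj q 1 (\<pi> (uq_f q) (qp_x q)) = \<zero>\<^bsub>qplane q\<^esub> \<and>
     qp_proj q 1 (\<pi> (uq_f q) (qp_y q)) = \<zero>\<^bsub>qplane q\<^esub>}"

type_synonym param = "complex \<times> complex \<times> complex"

definition params :: "param set" where
  "params = {(d0, s, t). d0 \<noteq> 0}"

definition given_by :: "complex \<Rightarrow> (uq \<Rightarrow> qp \<Rightarrow> qp) \<Rightarrow> param \<Rightarrow> bool" where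
  "given_by q \<pi> = (\<lambda>(d0, s, t). let A = qplane q; x = qp_x q; y = qp_y q in
     \<pi> (uq_k q) x = q \<odot>\<^bsub>A\<^esub> x \<and>
     \<pi> (uq_k q) y = q\<^sup>2 \<odot>\<^bsub>A\<^esub> y \<and>
     \<pi> (uq_e q) x = (- q * inverse d0) \<odot>\<^bsub>A\<^esub> (x \<otimes>\<^bsub>A\<^esub> y) \<oplus>\<^bsub>A\<^esub> s \<odot>\<^bsub>A\<^esub> (x [^]\<^bsub>A\<^esub> (3::nat)) \<and>
     \<pi> (uq_e q) y = (- q * inverse d0) \<odot>\<^bsub>A\<^esub> (y [^]\<^bsub>A\<^esub> (2::nat)) \<oplus>\<^bsub>A\<^esub> t \<odot>\<^bsub>A\<^esub> (x [^]\<^bsub>A\<^esub> (4::nat)) \<and>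
     \<pi> (uq_f q) x = \<zero>\<^bsub>A\<^esub> \<and>
     \<pi> (uq_f q) y = d0 \<odot>\<^bsub>A\<^esub> \<one>\<^bsub>A\<^esub>)"

text \<open>The constant \<open>\<phi>\<close> ranges over the values actually taken, so that no subset is empty.\<close>

definition phi_subsets :: "param set set" where
  "phi_subsets = {{(d0, s, t). d0 \<noteq> 0 \<and> s \<noteq> 0 \<and> t \<noteq> 0 \<and> t / (d0 * s\<^sup>2) = \<phi>} | \<phi>. \<phi> \<noteq> 0}"

definition special_subsets :: "param set set" where
  "special_subsets =
    {{(d0, s, t). d0 \<noteq> 0 \<and> s \<noteq> 0 \<and> t = 0},
     {(d0, s, t). d0 \<noteq> 0 \<and> s = 0 \<and> t \<noteq> 0},
     {(d0, s, t). d0 \<noteq> 0 \<and> s = 0 \<and> t = 0}}"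

definition structures_of :: "complex \<Rightarrow> param set \<Rightarrow> (uq \<Rightarrow> qp \<Rightarrow> qp) set" where
  "structures_of q C = {\<pi> \<in> uq_structures q. \<exists>p\<in>C. given_by q \<pi> p}"

definition iso_rel :: "complex \<Rightarrow> ((uq \<Rightarrow> qp \<Rightarrow> qp) \<times> (uq \<Rightarrow> qp \<Rightarrow> qp)) set" where
  "iso_rel q = structure_iso_rel (Uq q) (qplane q)"

end

theory Submission
  imports Defs "HOL-Library.Poly_Mapping" "HOL-Analysis.Continuum_Not_Denumerable"
begin

text \<open>
  A module algebra structure on the quantum plane is the same thing as an automorphism \<open>K\<close> with
  inverse \<open>K'\<close> and two skew derivations \<open>E\<close>, \<open>F\<close>, the actions of the generators, that satisfy the
  defining relations (\<open>structure_qstruct\<close>, \<open>qstruct_structure\<close>, \<open>structure_eqI\<close>).  From the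
  generators to all of the Hopf algebra one passes by the universal property of the presentation.
  The Leibniz rule for an arbitrary element \<open>h\<close> then says that the action on a product \<open>ab\<close> is the
  value at \<open>\<Delta>(h)\<close> of the linear map \<open>u \<otimes> v \<mapsto> u(a) v(b)\<close>, and this statement is inherited by
  products \<open>gh\<close> because it is a rule about \<open>E\<close>, \<open>F\<close>, \<open>K\<close> and \<open>K'\<close> for each generator \<open>g\<close>.

  Existence.  After inverting \<open>y\<close>, the operators of the family become inner: there are
  \<open>w = b y + c x\<^sup>2 + d x\<^sup>4 y\<^sup>-\<^sup>1\<close> and \<open>v = a y\<^sup>-\<^sup>1\<close> with \<open>E(p) = w K(p) - p w\<close> and
  \<open>F(p) = v p - K'(p) v\<close>.  Such formulas satisfy the twisted Leibniz rules automatically, and the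
  commutator relation amounts to one scalar identity between \<open>a\<close> and \<open>b\<close>.  Written out on the
  monomials they preserve the span of the \<open>x\<^sup>m y\<^sup>n\<close> with \<open>n \<ge> 0\<close>, which yields explicit coefficients
  (\<open>fam_E\<close>, \<open>fam_F\<close>, \<open>family_qstruct\<close>).

  Completeness.  When \<open>q\<close> is not a root of unity, every automorphism of the quantum plane rescales
  \<open>x\<close> and \<open>y\<close> (\<open>aut_diagonal\<close>): the leading exponents of the images of \<open>x\<close> and \<open>y\<close> have determinant
  one and generate the monoid of all exponents.  Hence \<open>K\<close> is diagonal.  As \<open>f(y)\<close> has a nonzero
  constant term, the relation between \<open>k\<close> and \<open>f\<close> forces the eigenvalue of \<open>y\<close> to be \<open>q\<^sup>2\<close>, and
  \<open>f(yx) = q f(xy)\<close> forces that of \<open>x\<close> to be \<open>q\<close>.  Then \<open>e\<close> and \<open>f\<close> shift weights by fixed amounts,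
  so their values on \<open>x\<close> and \<open>y\<close> lie in spaces of dimension at most three, and the remaining
  coefficients come from \<open>yx = qxy\<close> and from the commutator of \<open>e\<close> and \<open>f\<close>
  (\<open>qstruct_classify\<close>).

  Isomorphism.  An isomorphism is again diagonal, say \<open>x \<mapsto> \<alpha>x\<close> and \<open>y \<mapsto> \<beta>y\<close>, and it transforms
  the parameters \<open>(d\<^sub>0, s, t)\<close> into \<open>(d\<^sub>0/\<beta>, s\<alpha>\<^sup>2, t\<alpha>\<^sup>4/\<beta>)\<close>.  The orbits of this action of the torus are
  the subsets in the theorem (\<open>param_orbits\<close>).
\<close>

section \<open>Complex algebras\<close>

hide_const (open) Poly_Mapping.single
hide_fact (open) Poly_Mapping.single_def

text \<open>
  A unital associative algebra over the complex numbers.  The scalars form a HOL type, so that only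
  the vectors are relativised to a carrier.
\<close>

locale calg = ring A for A :: "(complex, 'a, 'm) module_scheme" (structure) +
  assumes smult_closed [simp, intro]: "a \<in> carrier A \<Longrightarrow> c \<odot> a \<in> carrier A"
    and smult_add_left: "a \<in> carrier A \<Longrightarrow> (c + d) \<odot> a = c \<odot> a \<oplus> d \<odot> a"
    and smult_add_right: "a \<in> carrier A \<Longrightarrow> b \<in> carrier A \<Longrightarrow> c \<odot> (a \<oplus> b) = c \<odot> a \<oplus> c \<odot> b"
    and smult_smult: "a \<in> carrier A \<Longrightarrow> c \<odot> (d \<odot> a) = (c * d) \<odot> a"
    and smult_1 [simp]: "a \<in> carrier A \<Longrightarrow> 1 \<odot> a = a"
    and smult_mult_left: "a \<in> carrier A \<Longrightarrow> b \<in> carrier A \<Longrightarrow> (c \<odot> a) \<otimes> b = c \<odot> (a \<otimes> b)"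
    and smult_mult_right: "a \<in> carrier A \<Longrightarrow> b \<in> carrier A \<Longrightarrow> a \<otimes> (c \<odot> b) = c \<odot> (a \<otimes> b)"
begin

lemma smult_zero_left [simp]: "a \<in> carrier A \<Longrightarrow> 0 \<odot> a = \<zero>"
  by (metis add.l_cancel_one' add_0 smult_add_left smult_closed)

lemma smult_zero_right [simp]: "c \<odot> \<zero> = \<zero>"
  by (metis mult_zero_right smult_smult smult_zero_left zero_closed)

lemma smult_minus_one: "a \<in> carrier A \<Longrightarrow> (- 1) \<odot> a = \<ominus> a"
  by (metis add.inv_equality add.left_inverse smult_add_left smult_closed smult_1 smult_zero_left)

lemma minus_eq_smult: "a \<in> carrier A \<Longrightarrow> b \<in> carrier A \<Longrightarrow> a \<ominus> b = a \<oplus> (- 1) \<odot> b"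
  by (simp add: a_minus_def smult_minus_one)

lemma smult_finsum:
  assumes "\<And>i. i \<in> I \<Longrightarrow> g i \<in> carrier A"
  shows "c \<odot> (\<Oplus>i\<in>I. g i) = (\<Oplus>i\<in>I. c \<odot> g i)"
  using assms
proof (induction I rule: infinite_finite_induct)
  case (insert i I)
  then show ?case by (simp add: Pi_def smult_add_right)
qed (simp_all)

lemma finsum_eqI_zero_outside:
  assumes "finite T" "S \<subseteq> T" "\<And>i. i \<in> T \<Longrightarrow> g i \<in> carrier A" "\<And>i. i \<in> T - S \<Longrightarrow> g i = \<zero>"
  shows "(\<Oplus>i\<in>S. g i) = (\<Oplus>i\<in>T. g i)"
  by (rule add.finprod_mono_neutral_cong_left) (use assms in auto)

end

lemma alg_homD:
  assumes "h \<in> alg_hom A B"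
  shows "a \<in> carrier A \<Longrightarrow> h a \<in> carrier B"
    and "a \<in> carrier A \<Longrightarrow> b \<in> carrier A \<Longrightarrow> h (a \<otimes>\<^bsub>A\<^esub> b) = h a \<otimes>\<^bsub>B\<^esub> h b"
    and "a \<in> carrier A \<Longrightarrow> b \<in> carrier A \<Longrightarrow> h (a \<oplus>\<^bsub>A\<^esub> b) = h a \<oplus>\<^bsub>B\<^esub> h b"
    and "a \<in> carrier A \<Longrightarrow> h (c \<odot>\<^bsub>A\<^esub> a) = c \<odot>\<^bsub>B\<^esub> h a"
    and "h \<one>\<^bsub>A\<^esub> = \<one>\<^bsub>B\<^esub>"
  using assms by (auto simp: alg_hom_def ring_hom_def Pi_def)

lemma alg_homI:
  assumes "\<And>a. a \<in> carrier A \<Longrightarrow> h a \<in> carrier B"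
    and "\<And>a b. a \<in> carrier A \<Longrightarrow> b \<in> carrier A \<Longrightarrow> h (a \<otimes>\<^bsub>A\<^esub> b) = h a \<otimes>\<^bsub>B\<^esub> h b"
    and "\<And>a b. a \<in> carrier A \<Longrightarrow> b \<in> carrier A \<Longrightarrow> h (a \<oplus>\<^bsub>A\<^esub> b) = h a \<oplus>\<^bsub>B\<^esub> h b"
    and "\<And>c a. a \<in> carrier A \<Longrightarrow> h (c \<odot>\<^bsub>A\<^esub> a) = c \<odot>\<^bsub>B\<^esub> h a"
    and "h \<one>\<^bsub>A\<^esub> = \<one>\<^bsub>B\<^esub>"
  shows "h \<in> alg_hom A B"
  using assms by (auto simp: alg_hom_def ring_hom_def Pi_def)

section \<open>Monoid algebras\<close>

context monoid
begin

abbreviation (input) "MA \<equiv> monoid_algebra G"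

lemma MA_carrier: "f \<in> carrier MA \<longleftrightarrow> finite {a. f a \<noteq> 0} \<and> {a. f a \<noteq> 0} \<subseteq> carrier G"
  by (simp add: monoid_algebra_def)

lemma MA_simps:
  "f \<oplus>\<^bsub>MA\<^esub> g = (\<lambda>c. f c + g c)" "c \<odot>\<^bsub>MA\<^esub> f = (\<lambda>a. c * f a)" "\<zero>\<^bsub>MA\<^esub> = (\<lambda>c. 0)"
  "\<one>\<^bsub>MA\<^esub> = single \<one>"
  by (auto simp: monoid_algebra_def single_def)

lemma MA_single: "a \<in> carrier G \<Longrightarrow> single a \<in> carrier MA"
  by (simp add: MA_carrier single_def)

lemma MA_add: "f \<in> carrier MA \<Longrightarrow> g \<in> carrier MA \<Longrightarrow> (\<lambda>c. f c + g c) \<in> carrier MA"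
  unfolding MA_carrier
  by (auto intro: finite_subset[of _ "{a. f a \<noteq> 0} \<union> {a. g a \<noteq> 0}"] simp: subset_iff)
    (metis add_0)

lemma MA_smult: "f \<in> carrier MA \<Longrightarrow> (\<lambda>a. c * f a) \<in> carrier MA"
  unfolding MA_carrier by (auto intro: finite_subset[of _ "{a. f a \<noteq> 0}"])

lemma MA_mult_eq:
  assumes "finite S" "finite T" "{a. f a \<noteq> 0} \<subseteq> S" "{a. g a \<noteq> 0} \<subseteq> T"
  shows "(f \<otimes>\<^bsub>MA\<^esub> g) c = (\<Sum>a\<in>S. \<Sum>b\<in>T. if a \<otimes> b = c then f a * g b else 0)"
proof -
  have "(f \<otimes>\<^bsub>MA\<^esub> g) c = (\<Sum>(a, b)\<in>{(a, b). f a \<noteq> 0 \<and> g b \<noteq> 0 \<and> a \<otimes> b = c}. f a * g b)"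
    by (simp add: monoid_algebra_def)
  also have "\<dots> = (\<Sum>(a, b)\<in>S \<times> T. if a \<otimes> b = c then f a * g b else 0)"
    by (rule sum.mono_neutral_cong_left) (use assms in \<open>auto split: if_splits\<close>)
  finally show ?thesis by (simp add: sum.cartesian_product)
qed

text \<open>
  Summed against a function on the monoid, a convolution becomes a double sum over the supports.
  Applied twice, this turns both bracketings of a triple product into the same triple sum.
\<close>

lemma MA_mult_pairing:
  assumes "f \<in> carrier MA" "g \<in> carrier MA"
    "finite S" "finite T" "finite U" "{a. f a \<noteq> 0} \<subseteq> S" "{a. g a \<noteq> 0} \<subseteq> T"
    "(\<lambda>(a, b). a \<otimes> b) ` (S \<times> T) \<subseteq> U"
  shows "(\<Sum>c\<in>U. (f \<otimes>\<^bsub>MA\<^esub> g) c * \<phi> c) = (\<Sum>a\<in>S. \<Sum>b\<in>T. f a * g b * \<phi> (a \<otimes> b))"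
proof -
  have "(\<Sum>c\<in>U. (f \<otimes>\<^bsub>MA\<^esub> g) c * \<phi> c) =
      (\<Sum>c\<in>U. \<Sum>a\<in>S. \<Sum>b\<in>T. if a \<otimes> b = c then f a * g b * \<phi> c else 0)"
    by (auto simp: MA_mult_eq[OF assms(3,4,6,7)] sum_distrib_right intro!: sum.cong)
  also have "\<dots> = (\<Sum>a\<in>S. \<Sum>b\<in>T. \<Sum>c\<in>U. if a \<otimes> b = c then f a * g b * \<phi> c else 0)"
    by (subst sum.swap, rule sum.cong[OF refl], subst sum.swap, rule refl)
  also have "\<dots> = (\<Sum>a\<in>S. \<Sum>b\<in>T. f a * g b * \<phi> (a \<otimes> b))"
    using assms by (intro sum.cong refl) (auto simp: sum.delta')
  finally show ?thesis .
qed

lemma MA_mult_support: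
  "{c. (f \<otimes>\<^bsub>MA\<^esub> g) c \<noteq> 0} \<subseteq> (\<lambda>(a, b). a \<otimes> b) ` ({a. f a \<noteq> 0} \<times> {a. g a \<noteq> 0})"
proof
  fix c assume "c \<in> {c. (f \<otimes>\<^bsub>MA\<^esub> g) c \<noteq> 0}"
  then have "{(a, b). f a \<noteq> 0 \<and> g b \<noteq> 0 \<and> a \<otimes> b = c} \<noteq> {}"
    by (auto simp: monoid_algebra_def simp del: Collect_empty_eq)
  then show "c \<in> (\<lambda>(a, b). a \<otimes> b) ` ({a. f a \<noteq> 0} \<times> {a. g a \<noteq> 0})" by force
qed

lemma MA_mult:
  assumes "f \<in> carrier MA" "g \<in> carrier MA"
  shows "f \<otimes>\<^bsub>MA\<^esub> g \<in> carrier MA"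
proof -
  let ?S = "(\<lambda>(a, b). a \<otimes> b) ` ({a. f a \<noteq> 0} \<times> {a. g a \<noteq> 0})"
  have "finite ?S" "?S \<subseteq> carrier G" using assms by (auto simp: MA_carrier)
  then show ?thesis
    unfolding MA_carrier using MA_mult_support[of f g] by (meson finite_subset subset_trans)
qed

lemma MA_mult_assoc:
  assumes f: "f \<in> carrier MA" and g: "g \<in> carrier MA" and h: "h \<in> carrier MA"
  shows "(f \<otimes>\<^bsub>MA\<^esub> g) \<otimes>\<^bsub>MA\<^esub> h = f \<otimes>\<^bsub>MA\<^esub> (g \<otimes>\<^bsub>MA\<^esub> h)"
proof
  fix d
  define S where "S = {a. f a \<noteq> 0}"
  define T where "T = {a. g a \<noteq> 0}"
  define W where "W = {a. h a \<noteq> 0}"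
  define ST where "ST = (\<lambda>(a, b). a \<otimes> b) ` (S \<times> T)"
  define TW where "TW = (\<lambda>(a, b). a \<otimes> b) ` (T \<times> W)"
  have fin: "finite S" "finite T" "finite W" "finite ST" "finite TW"
    using f g h by (simp_all add: S_def T_def W_def ST_def TW_def MA_carrier)
  have sub: "S \<subseteq> carrier G" "T \<subseteq> carrier G" "W \<subseteq> carrier G"
    using f g h by (simp_all add: S_def T_def W_def MA_carrier)
  have "((f \<otimes>\<^bsub>MA\<^esub> g) \<otimes>\<^bsub>MA\<^esub> h) d =
      (\<Sum>c\<in>ST. \<Sum>e\<in>W. if c \<otimes> e = d then (f \<otimes>\<^bsub>MA\<^esub> g) c * h e else 0)"
    using MA_mult_support[of f g] fin by (intro MA_mult_eq) (auto simp: ST_def S_def T_def W_def)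
  also have "\<dots> = (\<Sum>e\<in>W. \<Sum>c\<in>ST. (f \<otimes>\<^bsub>MA\<^esub> g) c * (if c \<otimes> e = d then h e else 0))"
    by (subst sum.swap) (auto intro!: sum.cong)
  also have "\<dots> = (\<Sum>e\<in>W. \<Sum>a\<in>S. \<Sum>b\<in>T. f a * g b * (if (a \<otimes> b) \<otimes> e = d then h e else 0))"
    using fin f g by (intro sum.cong refl MA_mult_pairing) (auto simp: S_def T_def ST_def)
  also have "\<dots> = (\<Sum>a\<in>S. \<Sum>e\<in>W. \<Sum>b\<in>T. f a * g b * (if (a \<otimes> b) \<otimes> e = d then h e else 0))"
    by (rule sum.swap)
  also have "\<dots> = (\<Sum>a\<in>S. \<Sum>b\<in>T. \<Sum>e\<in>W. f a * g b * (if (a \<otimes> b) \<otimes> e = d then h e else 0))"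
    by (rule sum.cong[OF refl], rule sum.swap)
  also have "\<dots> = (\<Sum>a\<in>S. \<Sum>b\<in>T. \<Sum>e\<in>W. g b * h e * (if a \<otimes> (b \<otimes> e) = d then f a else 0))"
    using sub by (intro sum.cong refl) (auto simp: m_assoc subset_iff)
  also have "\<dots> = (\<Sum>a\<in>S. \<Sum>c\<in>TW. (g \<otimes>\<^bsub>MA\<^esub> h) c * (if a \<otimes> c = d then f a else 0))"
    using fin g h by (intro sum.cong refl MA_mult_pairing[symmetric]) (auto simp: W_def T_def TW_def)
  also have "\<dots> = (\<Sum>a\<in>S. \<Sum>c\<in>TW. if a \<otimes> c = d then f a * (g \<otimes>\<^bsub>MA\<^esub> h) c else 0)"
    by (auto intro!: sum.cong)
  also have "\<dots> = (f \<otimes>\<^bsub>MA\<^esub> (g \<otimes>\<^bsub>MA\<^esub> h)) d"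
    using MA_mult_support[of g h] fin by (intro MA_mult_eq[symmetric]) (auto simp: TW_def S_def T_def W_def)
  finally show "((f \<otimes>\<^bsub>MA\<^esub> g) \<otimes>\<^bsub>MA\<^esub> h) d = (f \<otimes>\<^bsub>MA\<^esub> (g \<otimes>\<^bsub>MA\<^esub> h)) d" .
qed

lemma MA_one_left: "f \<in> carrier MA \<Longrightarrow> single \<one> \<otimes>\<^bsub>MA\<^esub> f = f"
proof
  fix c assume f: "f \<in> carrier MA"
  have "(single \<one> \<otimes>\<^bsub>MA\<^esub> f) c = (\<Sum>a\<in>{\<one>}. \<Sum>b\<in>{a. f a \<noteq> 0}. if a \<otimes> b = c then single \<one> a * f b else 0)"
    using f by (intro MA_mult_eq) (auto simp: MA_carrier single_def split: if_splits)
  also have "\<dots> = (\<Sum>b\<in>{a. f a \<noteq> 0}. if b = c then f b else 0)"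
    using f by (auto simp: single_def MA_carrier subset_iff intro!: sum.cong)
  also have "\<dots> = f c" using f by (auto simp: MA_carrier)
  finally show "(single \<one> \<otimes>\<^bsub>MA\<^esub> f) c = f c" .
qed

lemma MA_one_right: "f \<in> carrier MA \<Longrightarrow> f \<otimes>\<^bsub>MA\<^esub> single \<one> = f"
proof
  fix c assume f: "f \<in> carrier MA"
  have "(f \<otimes>\<^bsub>MA\<^esub> single \<one>) c = (\<Sum>b\<in>{a. f a \<noteq> 0}. \<Sum>a\<in>{\<one>}. if b \<otimes> a = c then f b * single \<one> a else 0)"
    using f by (intro MA_mult_eq) (auto simp: MA_carrier single_def split: if_splits)
  also have "\<dots> = (\<Sum>b\<in>{a. f a \<noteq> 0}. if b = c then f b else 0)"
    using f by (auto simp: single_def MA_carrier subset_iff intro!: sum.cong)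
  also have "\<dots> = f c" using f by (auto simp: MA_carrier)
  finally show "(f \<otimes>\<^bsub>MA\<^esub> single \<one>) c = f c" .
qed

lemma MA_mult_single:
  assumes "a \<in> carrier G" "b \<in> carrier G"
  shows "single a \<otimes>\<^bsub>MA\<^esub> single b = single (a \<otimes> b)"
proof
  fix c
  have "(single a \<otimes>\<^bsub>MA\<^esub> single b) c = (\<Sum>a'\<in>{a}. \<Sum>b'\<in>{b}. if a' \<otimes> b' = c then single a a' * single b b' else 0)"
    by (intro MA_mult_eq) (auto simp: single_def split: if_splits)
  then show "(single a \<otimes>\<^bsub>MA\<^esub> single b) c = single (a \<otimes> b) c" by (auto simp: single_def)
qed

lemma MA_mult_linear:
  assumes f: "f \<in> carrier MA" and g: "g \<in> carrier MA" and h: "h \<in> carrier MA"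
  shows "f \<otimes>\<^bsub>MA\<^esub> (\<lambda>a. c * g a + d * h a) = (\<lambda>a. c * (f \<otimes>\<^bsub>MA\<^esub> g) a + d * (f \<otimes>\<^bsub>MA\<^esub> h) a)"
    and "(\<lambda>a. c * g a + d * h a) \<otimes>\<^bsub>MA\<^esub> f = (\<lambda>a. c * (g \<otimes>\<^bsub>MA\<^esub> f) a + d * (h \<otimes>\<^bsub>MA\<^esub> f) a)"
proof -
  define S where "S = {a. f a \<noteq> 0}"
  define T where "T = {a. g a \<noteq> 0} \<union> {a. h a \<noteq> 0}"
  have fin: "finite S" "finite T" using f g h by (auto simp: S_def T_def MA_carrier)
  have sup: "{a. f a \<noteq> 0} \<subseteq> S" "{a. g a \<noteq> 0} \<subseteq> T" "{a. h a \<noteq> 0} \<subseteq> T"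
     "{a. c * g a + d * h a \<noteq> 0} \<subseteq> T" by (auto simp: S_def T_def)
  note eqs = MA_mult_eq[OF fin sup(1,2)] MA_mult_eq[OF fin sup(1,3)] MA_mult_eq[OF fin sup(1,4)]
    MA_mult_eq[OF fin(2,1) sup(2,1)] MA_mult_eq[OF fin(2,1) sup(3,1)] MA_mult_eq[OF fin(2,1) sup(4,1)]
  show "f \<otimes>\<^bsub>MA\<^esub> (\<lambda>a. c * g a + d * h a) = (\<lambda>a. c * (f \<otimes>\<^bsub>MA\<^esub> g) a + d * (f \<otimes>\<^bsub>MA\<^esub> h) a)"
    unfolding eqs sum_distrib_left sum.distrib[symmetric]
    by (intro ext sum.cong refl) (simp add: algebra_simps)
  show "(\<lambda>a. c * g a + d * h a) \<otimes>\<^bsub>MA\<^esub> f = (\<lambda>a. c * (g \<otimes>\<^bsub>MA\<^esub> f) a + d * (h \<otimes>\<^bsub>MA\<^esub> f) a)"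
    unfolding eqs sum_distrib_left sum.distrib[symmetric]
    by (intro ext sum.cong refl) (simp add: algebra_simps)
qed

lemma monoid_algebra_calg: "calg MA"
proof (intro calg.intro calg_axioms.intro ringI)
  show "abelian_group MA"
  proof (rule abelian_groupI)
    fix f assume "f \<in> carrier MA"
    then show "\<exists>g\<in>carrier MA. g \<oplus>\<^bsub>MA\<^esub> f = \<zero>\<^bsub>MA\<^esub>"
      by (intro bexI[of _ "\<lambda>a. (- 1) * f a"] MA_smult) (auto simp: MA_simps)
  qed (auto simp: MA_simps MA_add algebra_simps, auto simp: MA_carrier)
  show "monoid MA"
    by (rule monoidI)
      (auto simp: MA_simps MA_mult MA_single MA_mult_assoc MA_one_left MA_one_right)
qed (use MA_mult_linear[where c=1 and d=1] MA_mult_linear[where d=0]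
     in \<open>auto simp: MA_simps MA_smult algebra_simps\<close>)

text \<open>
  Removing one point from the support at a time shows that a property stable under the addition of
  multiples of basis elements holds on the whole algebra; linear identities are thereby checked on
  the basis.
\<close>

lemma MA_induct [consumes 1, case_names zero add_single]:
  assumes f: "f \<in> carrier MA"
    and z: "P \<zero>\<^bsub>MA\<^esub>"
    and s: "\<And>f c a. f \<in> carrier MA \<Longrightarrow> a \<in> carrier G \<Longrightarrow> P f \<Longrightarrow> P (f \<oplus>\<^bsub>MA\<^esub> c \<odot>\<^bsub>MA\<^esub> single a)"
  shows "P f"
proof -
  have "finite S \<Longrightarrow> \<forall>f\<in>carrier MA. {a. f a \<noteq> 0} = S \<longrightarrow> P f" for S
  proof (induction S rule: finite_induct)
    case empty
    then show ?case using z by (auto simp: MA_simps fun_eq_iff[symmetric])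
  next
    case (insert a S)
    show ?case
    proof (intro ballI impI)
      fix f assume f: "f \<in> carrier MA" and S: "{a. f a \<noteq> 0} = insert a S"
      have eq: "{b. (f(a := 0)) b \<noteq> 0} = S" using S insert.hyps by auto
      have "f(a := 0) \<in> carrier MA" unfolding MA_carrier eq using f S insert.hyps
        by (auto simp: MA_carrier)
      moreover have "P (f(a := 0))" using insert.IH calculation eq by blast
      moreover have "a \<in> carrier G" using f S by (auto simp: MA_carrier)
      ultimately have "P (f(a := 0) \<oplus>\<^bsub>MA\<^esub> f a \<odot>\<^bsub>MA\<^esub> single a)" by (intro s)
      also have "f(a := 0) \<oplus>\<^bsub>MA\<^esub> f a \<odot>\<^bsub>MA\<^esub> single a = f" by (auto simp: MA_simps single_def)
      finally show "P f" .
    qed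
  qed
  then show ?thesis using f by (auto simp: MA_carrier)
qed

end

definition lin_ext :: "(complex, 'b, 'n) module_scheme \<Rightarrow> ('a \<Rightarrow> 'b) \<Rightarrow> ('a \<Rightarrow> complex) \<Rightarrow> 'b" where
  "lin_ext B \<psi> f = (\<Oplus>\<^bsub>B\<^esub> a\<in>{a. f a \<noteq> 0}. f a \<odot>\<^bsub>B\<^esub> \<psi> a)"

locale monoid_to_calg = M: monoid M + B: calg B
  for M :: "('a, 'k) monoid_scheme" and B :: "(complex, 'b, 'n) module_scheme" (structure) +
  fixes \<psi> :: "'a \<Rightarrow> 'b"
  assumes \<psi> [simp, intro]: "a \<in> carrier M \<Longrightarrow> \<psi> a \<in> carrier B"
begin

sublocale MA: calg "monoid_algebra M" by (rule M.monoid_algebra_calg)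

lemma lin_ext_superset:
  assumes "f \<in> carrier (monoid_algebra M)" "finite S" "{a. f a \<noteq> 0} \<subseteq> S" "S \<subseteq> carrier M"
  shows "lin_ext B \<psi> f = (\<Oplus>a\<in>S. f a \<odot> \<psi> a)"
  unfolding lin_ext_def
  by (rule B.finsum_eqI_zero_outside) (use assms \<psi> in auto)

lemma lin_ext_closed: "f \<in> carrier (monoid_algebra M) \<Longrightarrow> lin_ext B \<psi> f \<in> carrier B"
  unfolding lin_ext_def using \<psi> by (auto simp: M.MA_carrier intro!: B.finsum_closed)

lemma lin_ext_add:
  assumes "f \<in> carrier (monoid_algebra M)" "g \<in> carrier (monoid_algebra M)"
  shows "lin_ext B \<psi> (f \<oplus>\<^bsub>monoid_algebra M\<^esub> g) = lin_ext B \<psi> f \<oplus> lin_ext B \<psi> g"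
proof -
  let ?S = "{a. f a \<noteq> 0} \<union> {a. g a \<noteq> 0}"
  have S: "finite ?S" "?S \<subseteq> carrier M" using assms by (auto simp: M.MA_carrier)
  have "lin_ext B \<psi> (f \<oplus>\<^bsub>monoid_algebra M\<^esub> g) = (\<Oplus>a\<in>?S. (f \<oplus>\<^bsub>monoid_algebra M\<^esub> g) a \<odot> \<psi> a)"
    using S assms by (intro lin_ext_superset MA.a_closed) (auto simp: M.MA_simps)
  also have "\<dots> = (\<Oplus>a\<in>?S. f a \<odot> \<psi> a \<oplus> g a \<odot> \<psi> a)"
    using S \<psi> by (intro B.finsum_cong') (auto simp: M.MA_simps B.smult_add_left)
  also have "\<dots> = (\<Oplus>a\<in>?S. f a \<odot> \<psi> a) \<oplus> (\<Oplus>a\<in>?S. g a \<odot> \<psi> a)"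
    using S \<psi> by (intro B.finsum_addf) auto
  also have "\<dots> = lin_ext B \<psi> f \<oplus> lin_ext B \<psi> g"
    using assms S by (simp add: lin_ext_superset[of f ?S] lin_ext_superset[of g ?S])
  finally show ?thesis .
qed

lemma lin_ext_smult:
  assumes "f \<in> carrier (monoid_algebra M)"
  shows "lin_ext B \<psi> (c \<odot>\<^bsub>monoid_algebra M\<^esub> f) = c \<odot> lin_ext B \<psi> f"
proof -
  let ?S = "{a. f a \<noteq> 0}"
  have S: "finite ?S" "?S \<subseteq> carrier M" using assms by (auto simp: M.MA_carrier)
  have "lin_ext B \<psi> (c \<odot>\<^bsub>monoid_algebra M\<^esub> f) = (\<Oplus>a\<in>?S. (c \<odot>\<^bsub>monoid_algebra M\<^esub> f) a \<odot> \<psi> a)"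
    using S assms by (intro lin_ext_superset MA.smult_closed) (auto simp: M.MA_simps)
  also have "\<dots> = (\<Oplus>a\<in>?S. c \<odot> (f a \<odot> \<psi> a))"
    using S \<psi> by (intro B.finsum_cong') (auto simp: M.MA_simps B.smult_smult)
  also have "\<dots> = c \<odot> lin_ext B \<psi> f"
    unfolding lin_ext_def using S \<psi> by (intro B.smult_finsum[symmetric]) auto
  finally show ?thesis .
qed

lemma lin_ext_single: "a \<in> carrier M \<Longrightarrow> lin_ext B \<psi> (single a) = \<psi> a"
  using \<psi>[of a] lin_ext_superset[of "single a" "{a}"] M.MA_single[of a] by (simp add: single_def)

lemma lin_ext_zero: "lin_ext B \<psi> \<zero>\<^bsub>monoid_algebra M\<^esub> = \<zero>"
  by (simp add: lin_ext_def M.MA_simps)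

text \<open>
  By linearity in both factors, only products of basis elements matter.
\<close>

lemma lin_ext_mult:
  assumes hom: "\<And>a b. a \<in> carrier M \<Longrightarrow> b \<in> carrier M \<Longrightarrow> \<psi> (a \<otimes>\<^bsub>M\<^esub> b) = \<psi> a \<otimes> \<psi> b"
    and f: "f \<in> carrier (monoid_algebra M)" and g: "g \<in> carrier (monoid_algebra M)"
  shows "lin_ext B \<psi> (f \<otimes>\<^bsub>monoid_algebra M\<^esub> g) = lin_ext B \<psi> f \<otimes> lin_ext B \<psi> g"
proof -
  note s = M.MA_single
  have 1: "lin_ext B \<psi> (single a \<otimes>\<^bsub>monoid_algebra M\<^esub> g) = \<psi> a \<otimes> lin_ext B \<psi> g"
    if a: "a \<in> carrier M" for a
    using g
  proof (induction g rule: M.MA_induct)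
    case zero
    then show ?case using a \<psi> s by (simp add: lin_ext_zero)
  next
    case (add_single g c b)
    then show ?case using a \<psi> s hom lin_ext_closed
      by (simp add: lin_ext_add lin_ext_smult lin_ext_single MA.r_distr MA.smult_mult_right
          M.MA_mult_single B.r_distr B.smult_mult_right)
  qed
  show ?thesis
    using f
  proof (induction f rule: M.MA_induct)
    case zero
    then show ?case using g lin_ext_closed by (simp add: lin_ext_zero)
  next
    case (add_single f c b)
    then show ?case using g \<psi> s 1 lin_ext_closed
      by (simp add: lin_ext_add lin_ext_smult lin_ext_single MA.l_distr MA.smult_mult_left
          B.l_distr B.smult_mult_left)
  qed
qed

end

section \<open>Quotients\<close>

locale calg_ideal = calg A + I: ideal I A
  for A :: "(complex, 'a, 'm) module_scheme" (structure) and I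
begin

abbreviation (input) "QA \<equiv> quot_algebra A I"

lemma QA_eq_iff: "a \<in> carrier A \<Longrightarrow> b \<in> carrier A \<Longrightarrow> I +> a = I +> b \<longleftrightarrow> a \<ominus> b \<in> I"
  using quotient_eq_iff_same_a_r_cos[OF I.ideal_axioms] by blast

lemma QA_fields:
  "carrier QA = (\<lambda>a. I +> a) ` carrier A" "\<one>\<^bsub>QA\<^esub> = I +> \<one>" "\<zero>\<^bsub>QA\<^esub> = I +> \<zero>"
  "monoid.mult QA = rcoset_mult A I" "ring.add QA = set_add A"
  using I.a_subset a_rcos_zero[OF I.ideal_axioms I.zero_closed]
  by (auto simp: quot_algebra_def ring.defs module.defs FactRing_simps)

lemma QA_mult: "a \<in> carrier A \<Longrightarrow> b \<in> carrier A \<Longrightarrow> (I +> a) \<otimes>\<^bsub>QA\<^esub> (I +> b) = I +> (a \<otimes> b)"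
  by (simp add: QA_fields I.rcoset_mult_add)

lemma QA_add: "a \<in> carrier A \<Longrightarrow> b \<in> carrier A \<Longrightarrow> (I +> a) \<oplus>\<^bsub>QA\<^esub> (I +> b) = I +> (a \<oplus> b)"
  by (simp add: QA_fields I.a_rcos_sum)

text \<open>
  Ideals of the underlying ring are subspaces, since \<open>c a = (c 1) a\<close>; hence the scalar
  multiplication descends to cosets.
\<close>

lemma ideal_smult: "a \<in> I \<Longrightarrow> c \<odot> a \<in> I"
  using I.I_l_closed[of a "c \<odot> \<one>"] I.Icarr[of a] by (simp add: smult_mult_left)

lemma QA_smult: "a \<in> carrier A \<Longrightarrow> c \<odot>\<^bsub>QA\<^esub> (I +> a) = I +> (c \<odot> a)"
proof -
  assume a: "a \<in> carrier A"
  have eq: "I +> (c \<odot> b) = I +> (c \<odot> a)" if "b \<in> I +> a" for b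
  proof -
    from that obtain i where i: "i \<in> I" "b = i \<oplus> a" by (auto simp: a_r_coset_def')
    then have ic: "i \<in> carrier A" using I.Icarr by blast
    have "c \<odot> b \<ominus> c \<odot> a = c \<odot> i"
      using a i ic by (simp add: smult_add_right a_minus_def a_assoc r_neg)
    then show ?thesis using ideal_smult[OF i(1)] a ic i by (subst QA_eq_iff) auto
  qed
  have "c \<odot>\<^bsub>QA\<^esub> (I +> a) = (\<Union>b\<in>I +> a. I +> (c \<odot> b))"
    by (simp add: quot_algebra_def ring.defs module.defs)
  also have "\<dots> = (\<Union>b\<in>I +> a. I +> (c \<odot> a))" using eq by simp
  also have "\<dots> = I +> (c \<odot> a)" using I.a_rcos_self[OF a] by auto
  finally show ?thesis .
qed

lemma QA_cases:
  assumes "X \<in> carrier QA"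
  obtains a where "a \<in> carrier A" "X = I +> a"
  using assms by (auto simp: QA_fields)

lemma QA_closed: "a \<in> carrier A \<Longrightarrow> I +> a \<in> carrier QA"
  by (simp add: QA_fields)

lemma quot_algebra_ring: "ring QA"
proof (rule ringI)
  show "abelian_group QA"
  proof (rule abelian_groupI)
    show "\<zero>\<^bsub>QA\<^esub> \<in> carrier QA" by (simp add: QA_fields)
  next
    fix X assume "X \<in> carrier QA"
    then obtain a where a: "a \<in> carrier A" "X = I +> a" by (rule QA_cases)
    then have "(I +> \<ominus> a) \<oplus>\<^bsub>QA\<^esub> X = \<zero>\<^bsub>QA\<^esub>" by (simp add: QA_add QA_fields(3) l_neg)
    then show "\<exists>Y\<in>carrier QA. Y \<oplus>\<^bsub>QA\<^esub> X = \<zero>\<^bsub>QA\<^esub>"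
      using a by (blast intro: QA_closed)
    show "\<zero>\<^bsub>QA\<^esub> \<oplus>\<^bsub>QA\<^esub> X = X" using a by (simp add: QA_add QA_fields(3))
  next
    fix X Y assume "X \<in> carrier QA" "Y \<in> carrier QA"
    then show "X \<oplus>\<^bsub>QA\<^esub> Y \<in> carrier QA" "X \<oplus>\<^bsub>QA\<^esub> Y = Y \<oplus>\<^bsub>QA\<^esub> X"
      by (elim QA_cases, simp add: QA_add QA_closed a_comm)+
  next
    fix X Y Z assume "X \<in> carrier QA" "Y \<in> carrier QA" "Z \<in> carrier QA"
    then show "X \<oplus>\<^bsub>QA\<^esub> Y \<oplus>\<^bsub>QA\<^esub> Z = X \<oplus>\<^bsub>QA\<^esub> (Y \<oplus>\<^bsub>QA\<^esub> Z)"
      by (elim QA_cases) (simp add: QA_add a_assoc)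
  qed
  show "monoid QA"
  proof (rule monoidI)
    fix X Y assume "X \<in> carrier QA" "Y \<in> carrier QA"
    then show "X \<otimes>\<^bsub>QA\<^esub> Y \<in> carrier QA" by (elim QA_cases) (simp add: QA_mult QA_closed)
  next
    fix X Y Z assume "X \<in> carrier QA" "Y \<in> carrier QA" "Z \<in> carrier QA"
    then show "X \<otimes>\<^bsub>QA\<^esub> Y \<otimes>\<^bsub>QA\<^esub> Z = X \<otimes>\<^bsub>QA\<^esub> (Y \<otimes>\<^bsub>QA\<^esub> Z)"
      by (elim QA_cases) (simp add: QA_mult m_assoc)
  next
    fix X assume "X \<in> carrier QA"
    then show "\<one>\<^bsub>QA\<^esub> \<otimes>\<^bsub>QA\<^esub> X = X" "X \<otimes>\<^bsub>QA\<^esub> \<one>\<^bsub>QA\<^esub> = X"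
      by (elim QA_cases, simp add: QA_mult QA_fields(2))+
  qed (simp add: QA_fields)
next
  fix X Y Z assume "X \<in> carrier QA" "Y \<in> carrier QA" "Z \<in> carrier QA"
  then show "(X \<oplus>\<^bsub>QA\<^esub> Y) \<otimes>\<^bsub>QA\<^esub> Z = X \<otimes>\<^bsub>QA\<^esub> Z \<oplus>\<^bsub>QA\<^esub> Y \<otimes>\<^bsub>QA\<^esub> Z"
    "Z \<otimes>\<^bsub>QA\<^esub> (X \<oplus>\<^bsub>QA\<^esub> Y) = Z \<otimes>\<^bsub>QA\<^esub> X \<oplus>\<^bsub>QA\<^esub> Z \<otimes>\<^bsub>QA\<^esub> Y"
    by (elim QA_cases, simp add: QA_mult QA_add l_distr r_distr)+
qed

lemma quot_algebra_calg: "calg QA"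
proof (intro calg.intro calg_axioms.intro quot_algebra_ring)
  fix X c d assume "X \<in> carrier QA"
  then obtain a where a: "a \<in> carrier A" "X = I +> a" by (rule QA_cases)
  show "c \<odot>\<^bsub>QA\<^esub> X \<in> carrier QA" "1 \<odot>\<^bsub>QA\<^esub> X = X"
    "(c + d) \<odot>\<^bsub>QA\<^esub> X = c \<odot>\<^bsub>QA\<^esub> X \<oplus>\<^bsub>QA\<^esub> d \<odot>\<^bsub>QA\<^esub> X"
    "c \<odot>\<^bsub>QA\<^esub> (d \<odot>\<^bsub>QA\<^esub> X) = (c * d) \<odot>\<^bsub>QA\<^esub> X"
    using a by (simp_all add: QA_smult QA_add QA_closed smult_add_left smult_smult)
next
  fix X Y c assume "X \<in> carrier QA" "Y \<in> carrier QA"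
  then show "c \<odot>\<^bsub>QA\<^esub> (X \<oplus>\<^bsub>QA\<^esub> Y) = c \<odot>\<^bsub>QA\<^esub> X \<oplus>\<^bsub>QA\<^esub> c \<odot>\<^bsub>QA\<^esub> Y"
    "c \<odot>\<^bsub>QA\<^esub> X \<otimes>\<^bsub>QA\<^esub> Y = c \<odot>\<^bsub>QA\<^esub> (X \<otimes>\<^bsub>QA\<^esub> Y)"
    "X \<otimes>\<^bsub>QA\<^esub> (c \<odot>\<^bsub>QA\<^esub> Y) = c \<odot>\<^bsub>QA\<^esub> (X \<otimes>\<^bsub>QA\<^esub> Y)"
    by (elim QA_cases, simp add: QA_smult QA_add QA_mult smult_add_right smult_mult_left smult_mult_right)+
qed

lemma quot_proj_alg_hom: "(\<lambda>a. I +> a) \<in> alg_hom A QA"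
  by (rule alg_homI) (simp_all add: QA_closed QA_fields(2) QA_smult QA_add QA_mult)

text \<open>
  A map out of a quotient is given in the form \<open>the_elem (F ` X)\<close>.  It is the expected one because
  an additive map that kills the ideal is constant on cosets.
\<close>

lemma the_elem_coset:
  assumes cl: "\<And>a. a \<in> carrier A \<Longrightarrow> F a \<in> carrier B"
    and add: "\<And>a b. a \<in> carrier A \<Longrightarrow> b \<in> carrier A \<Longrightarrow> F (a \<oplus> b) = F a \<oplus>\<^bsub>B\<^esub> F b"
    and van: "\<And>a. a \<in> I \<Longrightarrow> F a = \<zero>\<^bsub>B\<^esub>" and B: "abelian_group B" and a: "a \<in> carrier A"
  shows "the_elem (F ` (I +> a)) = F a"
proof -
  interpret B: abelian_group B by (rule B)
  have "F ` (I +> a) = {F a}"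
  proof -
    have "F b = F a" if "b \<in> I +> a" for b
    proof -
      from that obtain i where i: "i \<in> I" "b = i \<oplus> a" by (auto simp: a_r_coset_def')
      then show ?thesis using add[of i a] a van[OF i(1)] I.Icarr[OF i(1)] cl[OF a] by simp
    qed
    then show ?thesis using I.a_rcos_self[OF a] by blast
  qed
  then show ?thesis by simp
qed

end

lemma (in abelian_group) minus_eq_iff:
  assumes "a \<in> carrier G" "b \<in> carrier G" "c \<in> carrier G"
  shows "a \<ominus> b = c \<longleftrightarrow> a = c \<oplus> b"
  using assms by (metis a_minus_def add.inv_solve_right)

lemma alg_hom_zero_minus:
  assumes h: "h \<in> alg_hom A B" and A: "calg A" and B: "calg B"
  shows "h \<zero>\<^bsub>A\<^esub> = \<zero>\<^bsub>B\<^esub>"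
    and "a \<in> carrier A \<Longrightarrow> b \<in> carrier A \<Longrightarrow> h (a \<ominus>\<^bsub>A\<^esub> b) = h a \<ominus>\<^bsub>B\<^esub> h b"
proof -
  interpret A: calg A by (rule A)
  interpret B: calg B by (rule B)
  have "h \<zero>\<^bsub>A\<^esub> = h (0 \<odot>\<^bsub>A\<^esub> \<zero>\<^bsub>A\<^esub>)" by simp
  also have "\<dots> = 0 \<odot>\<^bsub>B\<^esub> h \<zero>\<^bsub>A\<^esub>" by (rule alg_homD[OF h]) simp
  also have "\<dots> = \<zero>\<^bsub>B\<^esub>" using alg_homD(1)[OF h, of "\<zero>\<^bsub>A\<^esub>"] by simp
  finally show "h \<zero>\<^bsub>A\<^esub> = \<zero>\<^bsub>B\<^esub>" .
  show "a \<in> carrier A \<Longrightarrow> b \<in> carrier A \<Longrightarrow> h (a \<ominus>\<^bsub>A\<^esub> b) = h a \<ominus>\<^bsub>B\<^esub> h b"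
    using alg_homD[OF h] by (simp add: A.minus_eq_smult B.minus_eq_smult)
qed

section \<open>Presented algebras\<close>

abbreviation word_monoid :: "'g list monoid" where
  "word_monoid \<equiv> \<lparr>carrier = UNIV, mult = (@), one = []\<rparr>"

lemma word_monoid: "monoid word_monoid"
  by (rule monoidI) auto

interpretation W: monoid word_monoid by (rule word_monoid)

interpretation free: calg free_algebra
  unfolding free_algebra_def by (rule W.monoid_algebra_calg)

lemma free_single [simp]: "single w \<in> carrier free_algebra"
  unfolding free_algebra_def by (rule W.MA_single) simp

lemma free_single_mult: "single v \<otimes>\<^bsub>free_algebra\<^esub> single w = single (v @ w)"
  unfolding free_algebra_def by (subst W.MA_mult_single) auto

lemma free_one: "\<one>\<^bsub>free_algebra\<^esub> = single []"
  unfolding free_algebra_def by (simp add: W.MA_simps)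

lemma free_induct [consumes 1, case_names zero add_single]:
  assumes "f \<in> carrier free_algebra" and "P \<zero>\<^bsub>free_algebra\<^esub>"
    and "\<And>f c w. f \<in> carrier free_algebra \<Longrightarrow> P f \<Longrightarrow> P (f \<oplus>\<^bsub>free_algebra\<^esub> c \<odot>\<^bsub>free_algebra\<^esub> single w)"
  shows "P f"
  using assms unfolding free_algebra_def by (induction f rule: W.MA_induct) simp_all

text \<open>
  An assignment of elements of an algebra to the generators, that is, a homomorphism from the free
  algebra.
\<close>

locale gen_map = B: calg B
  for B :: "(complex, 'b, 'n) module_scheme" (structure) +
  fixes \<phi> :: "'g \<Rightarrow> 'b"
  assumes gen_closed [simp, intro]: "\<phi> g \<in> carrier B"
begin

definition word_eval :: "'g list \<Rightarrow> 'b" where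
  "word_eval w = foldr (\<lambda>g b. \<phi> g \<otimes> b) w \<one>"

lemma word_eval_simps [simp]: "word_eval [] = \<one>" "word_eval (g # w) = \<phi> g \<otimes> word_eval w"
  by (simp_all add: word_eval_def)

lemma word_eval_closed [simp]: "word_eval w \<in> carrier B"
  by (induction w) auto

lemma word_eval_append: "word_eval (v @ w) = word_eval v \<otimes> word_eval w"
  by (induction v) (auto simp: B.m_assoc)

sublocale ext: monoid_to_calg word_monoid B word_eval
  by unfold_locales auto

lemma free_eval_eq: "free_eval B \<phi> = lin_ext B word_eval"
  by (rule ext) (simp add: free_eval_def lin_ext_def word_eval_def)

lemma free_eval_alg_hom: "free_eval B \<phi> \<in> alg_hom free_algebra B"
  unfolding free_eval_eq free_algebra_def
  by (rule alg_homI)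
    (simp_all add: ext.lin_ext_closed ext.lin_ext_add ext.lin_ext_smult ext.lin_ext_mult
      word_eval_append ext.lin_ext_single W.MA_simps(4))

lemma free_eval_gen: "free_eval B \<phi> (single [g]) = \<phi> g"
  unfolding free_eval_eq by (simp add: ext.lin_ext_single)

end

locale presentation =
  fixes R :: "(('g list \<Rightarrow> complex) \<times> ('g list \<Rightarrow> complex)) set"
  assumes relations: "R \<subseteq> carrier free_algebra \<times> carrier free_algebra"
begin

lemma relation_diffs: "{l \<ominus>\<^bsub>free_algebra\<^esub> r | l r. (l, r) \<in> R} \<subseteq> carrier free_algebra"
  using relations by (auto intro: free.minus_closed)

lemma relation_ideal: "calg_ideal free_algebra (relation_ideal R)"
  unfolding relation_ideal_def
  by (intro calg_ideal.intro free.calg_axioms free.genideal_ideal relation_diffs)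

interpretation calg_ideal free_algebra "relation_ideal R" by (rule relation_ideal)

abbreviation (input) "PA \<equiv> presented_algebra R"
abbreviation (input) "cls f \<equiv> relation_ideal R +>\<^bsub>free_algebra\<^esub> f"

lemma presented_calg: "calg PA"
  unfolding presented_algebra_def by (rule quot_algebra_calg)

sublocale PA: calg "presented_algebra R" by (rule presented_calg)

lemma gen_closed [simp]: "presented_gen R g \<in> carrier PA"
  unfolding presented_algebra_def presented_gen_def by (simp add: QA_closed)

lemma coset_word: "cls (single (g # w)) =
    presented_gen R g \<otimes>\<^bsub>PA\<^esub> (cls (single w))"
  unfolding presented_algebra_def presented_gen_def
  by (simp add: QA_mult free_single_mult)

text \<open>
  Words span the free algebra and are built by prepending one generator at a time.
\<close>

lemma presented_induct [consumes 1, case_names one add smult gen]: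
  assumes X: "X \<in> carrier PA"
    and one: "P \<one>\<^bsub>PA\<^esub>"
    and add: "\<And>X Y. X \<in> carrier PA \<Longrightarrow> Y \<in> carrier PA \<Longrightarrow> P X \<Longrightarrow> P Y \<Longrightarrow> P (X \<oplus>\<^bsub>PA\<^esub> Y)"
    and smult: "\<And>c X. X \<in> carrier PA \<Longrightarrow> P X \<Longrightarrow> P (c \<odot>\<^bsub>PA\<^esub> X)"
    and gen: "\<And>g X. X \<in> carrier PA \<Longrightarrow> P X \<Longrightarrow> P (presented_gen R g \<otimes>\<^bsub>PA\<^esub> X)"
  shows "P X"
proof -
  let ?p = "\<lambda>f. cls f"
  have cl: "f \<in> carrier free_algebra \<Longrightarrow> ?p f \<in> carrier PA" for f
    unfolding presented_algebra_def by (simp add: QA_closed)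
  have w: "P (?p (single w))" for w
  proof (induction w)
    case Nil
    then show ?case using one by (simp add: presented_algebra_def QA_fields(2) free_one)
  next
    case (Cons g w)
    then show ?case using gen[OF cl] by (simp add: coset_word)
  qed
  have P0: "P (?p \<zero>\<^bsub>free_algebra\<^esub>)"
    using smult[OF cl[OF free_single] w, of 0]
    by (simp add: presented_algebra_def QA_smult)
  obtain f where f: "f \<in> carrier free_algebra" "X = ?p f"
    using X unfolding presented_algebra_def by (rule QA_cases)
  show ?thesis unfolding f(2) using f(1)
  proof (induction f rule: free_induct)
    case zero
    show ?case by (rule P0)
  next
    case (add_single f c v)
    have "P (?p f \<oplus>\<^bsub>PA\<^esub> c \<odot>\<^bsub>PA\<^esub> ?p (single v))"
      using add_single w by (intro add smult cl PA.smult_closed) auto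
    then show ?case using add_single by (simp add: presented_algebra_def QA_smult QA_add)
  qed
qed

lemma alg_hom_eq:
  assumes h: "h \<in> alg_hom PA B" and h': "h' \<in> alg_hom PA B"
    and "\<And>g. h (presented_gen R g) = h' (presented_gen R g)" and "X \<in> carrier PA"
  shows "h X = h' X"
  using assms(4)
proof (induction X rule: presented_induct)
  case one
  show ?case by (simp only: alg_homD(5)[OF h] alg_homD(5)[OF h'])
next
  case (add X Y)
  then show ?case by (simp only: alg_homD(3)[OF h] alg_homD(3)[OF h'])
next
  case (smult c X)
  then show ?case by (simp only: alg_homD(4)[OF h] alg_homD(4)[OF h'])
next
  case (gen g X)
  then show ?case by (simp only: alg_homD(2)[OF h gen_closed] alg_homD(2)[OF h' gen_closed] assms(3))
qed

text \<open>
  Composed with the projection, a homomorphism out of a presented algebra is the evaluation of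
  noncommutative polynomials at the images of the generators.
\<close>

lemma alg_hom_free_eval:
  assumes h: "h \<in> alg_hom PA B" and B: "calg B" and f: "f \<in> carrier free_algebra"
  shows "free_eval B (\<lambda>g. h (presented_gen R g)) f = h (cls f)"
proof -
  interpret E: gen_map B "\<lambda>g. h (presented_gen R g)"
    using B alg_homD(1)[OF h] by (simp add: gen_map_def gen_map_axioms_def)
  note h' = alg_homD[OF quot_proj_alg_hom, folded presented_algebra_def]
  have w: "free_eval B (\<lambda>g. h (presented_gen R g)) (single w) =
      h (cls (single w))" for w
  proof (induction w)
    case Nil
    then show ?case using alg_homD(5)[OF E.free_eval_alg_hom] h'(5) alg_homD(5)[OF h]
      by (simp add: free_one)
  next
    case (Cons g w)
    have "free_eval B (\<lambda>g. h (presented_gen R g)) (single [g] \<otimes>\<^bsub>free_algebra\<^esub> single w) =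
      h (presented_gen R g) \<otimes>\<^bsub>B\<^esub> free_eval B (\<lambda>g. h (presented_gen R g)) (single w)"
      by (subst alg_homD(2)[OF E.free_eval_alg_hom]) (simp_all add: E.free_eval_gen)
    then show ?case using Cons h'(1)[of "single w"]
      by (simp add: free_single_mult coset_word alg_homD(2)[OF h])
  qed
  show ?thesis using f
  proof (induction f rule: free_induct)
    case zero
    then show ?case
      using alg_hom_zero_minus(1)[OF E.free_eval_alg_hom free.calg_axioms B]
        alg_hom_zero_minus(1)[OF h PA.calg_axioms B]
      by (simp add: QA_fields(3)[symmetric] presented_algebra_def)
  next
    case (add_single f c v)
    then show ?case
      using h'(3)[of f "c \<odot>\<^bsub>free_algebra\<^esub> single v"] h'(4)[of "single v" c] h'(1)[of f] h'(1)[of "single v"]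
      by (simp add: alg_homD[OF E.free_eval_alg_hom] w alg_homD[OF h])
  qed
qed

lemma alg_hom_relation:
  assumes h: "h \<in> alg_hom PA B" and B: "calg B" and lr: "(l, r) \<in> R"
  shows "free_eval B (\<lambda>g. h (presented_gen R g)) l = free_eval B (\<lambda>g. h (presented_gen R g)) r"
proof -
  have c: "l \<in> carrier free_algebra" "r \<in> carrier free_algebra" using relations lr by auto
  have "l \<ominus>\<^bsub>free_algebra\<^esub> r \<in> relation_ideal R"
    unfolding relation_ideal_def using free.genideal_self[OF relation_diffs] lr by blast
  then have "cls l = cls r"
    using QA_eq_iff[OF c] by blast
  then show ?thesis by (simp only: alg_hom_free_eval[OF h B] c)
qed

end

locale presented_map = presentation R + gen_map B \<phi>
  for R :: "(('g list \<Rightarrow> complex) \<times> ('g list \<Rightarrow> complex)) set"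
    and B :: "(complex, 'b, 'n) module_scheme" and \<phi> :: "'g \<Rightarrow> 'b" +
  assumes rel: "(l, r) \<in> R \<Longrightarrow> free_eval B \<phi> l = free_eval B \<phi> r"
begin

interpretation calg_ideal free_algebra "relation_ideal R" by (rule relation_ideal)

text \<open>
  The kernel of the evaluation is a two-sided ideal that contains the differences of the two sides
  of the relations, hence it contains the ideal they generate.
\<close>

lemma relation_ideal_kernel:
  assumes "f \<in> relation_ideal R"
  shows "free_eval B \<phi> f = \<zero>\<^bsub>B\<^esub>"
proof -
  interpret H: ring_hom_ring free_algebra B "free_eval B \<phi>"
    using free_eval_alg_hom by unfold_locales (simp add: alg_hom_def)
  have "relation_ideal R \<subseteq> a_kernel free_algebra B (free_eval B \<phi>)"
    unfolding relation_ideal_def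
  proof (rule free.genideal_minimal[OF H.kernel_is_ideal])
    show "{l \<ominus>\<^bsub>free_algebra\<^esub> r | l r. (l, r) \<in> R} \<subseteq> a_kernel free_algebra B (free_eval B \<phi>)"
    proof
      fix x assume "x \<in> {l \<ominus>\<^bsub>free_algebra\<^esub> r | l r. (l, r) \<in> R}"
      then obtain l r where x: "x = l \<ominus>\<^bsub>free_algebra\<^esub> r" and lr: "(l, r) \<in> R" by blast
      have c: "l \<in> carrier free_algebra" "r \<in> carrier free_algebra" using relations lr by auto
      have "free_eval B \<phi> (l \<ominus>\<^bsub>free_algebra\<^esub> r) = \<zero>\<^bsub>B\<^esub>"
        using alg_homD(1)[OF free_eval_alg_hom c(2)]
        unfolding alg_hom_zero_minus(2)[OF free_eval_alg_hom free.calg_axioms B.calg_axioms c] rel[OF lr]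
        by (simp add: B.r_neg B.minus_eq)
      then show "x \<in> a_kernel free_algebra B (free_eval B \<phi>)"
        unfolding x a_kernel_def' using c by (simp add: free.minus_closed)
    qed
  qed
  then have "f \<in> a_kernel free_algebra B (free_eval B \<phi>)" using assms by (rule subsetD)
  then show ?thesis unfolding a_kernel_def' by simp
qed

lemma presented_lift_coset:
  "f \<in> carrier free_algebra \<Longrightarrow> presented_lift B \<phi> (cls f) = free_eval B \<phi> f"
  unfolding presented_lift_def
  by (rule the_elem_coset[where B=B])
    (simp_all add: alg_homD[OF free_eval_alg_hom] relation_ideal_kernel B.is_abelian_group)

lemma presented_lift_alg_hom: "presented_lift B \<phi> \<in> alg_hom (presented_algebra R) B"
proof (rule alg_homI)
  note h = alg_homD[OF free_eval_alg_hom]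
  fix X Y c assume X: "X \<in> carrier (presented_algebra R)" 
  obtain f where f: "f \<in> carrier free_algebra" "X = cls f"
    using X unfolding presented_algebra_def by (rule QA_cases)
  show "presented_lift B \<phi> X \<in> carrier B"
    "presented_lift B \<phi> (c \<odot>\<^bsub>presented_algebra R\<^esub> X) = c \<odot>\<^bsub>B\<^esub> presented_lift B \<phi> X"
    using f by (simp_all add: presented_lift_coset h presented_algebra_def QA_smult)
  assume Y: "Y \<in> carrier (presented_algebra R)"
  obtain g where g: "g \<in> carrier free_algebra" "Y = cls g"
    using Y unfolding presented_algebra_def by (rule QA_cases)
  show "presented_lift B \<phi> (X \<otimes>\<^bsub>presented_algebra R\<^esub> Y) = presented_lift B \<phi> X \<otimes>\<^bsub>B\<^esub> presented_lift B \<phi> Y"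
    "presented_lift B \<phi> (X \<oplus>\<^bsub>presented_algebra R\<^esub> Y) = presented_lift B \<phi> X \<oplus>\<^bsub>B\<^esub> presented_lift B \<phi> Y"
    using f g by (simp_all add: presented_lift_coset h presented_algebra_def QA_mult QA_add)
next
  show "presented_lift B \<phi> \<one>\<^bsub>presented_algebra R\<^esub> = \<one>\<^bsub>B\<^esub>"
    using alg_homD(5)[OF free_eval_alg_hom]
    by (simp add: presented_algebra_def QA_fields(2) presented_lift_coset)
qed

lemma presented_lift_gen: "presented_lift B \<phi> (presented_gen R g) = \<phi> g"
  by (simp add: presented_gen_def presented_lift_coset free_eval_gen)

end

section \<open>Tensor products\<close>

locale tensor = A: calg A + B: calg B
  for A :: "(complex, 'a, 'm) module_scheme" and B :: "(complex, 'b, 'n) module_scheme"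
begin

abbreviation (input) "AB \<equiv> A \<times>\<times> B"
abbreviation (input) "FT \<equiv> monoid_algebra (A \<times>\<times> B)"
abbreviation (input) "TT \<equiv> tensor_algebra A B"
abbreviation "pt \<equiv> pure_tensor A B"

sublocale AB: monoid "A \<times>\<times> B"
  by (intro DirProd_monoid A.monoid_axioms B.monoid_axioms)

sublocale FT: calg "monoid_algebra (A \<times>\<times> B)" by (rule AB.monoid_algebra_calg)

lemma FT_single [simp]: "a \<in> carrier A \<Longrightarrow> b \<in> carrier B \<Longrightarrow> single (a, b) \<in> carrier FT"
  by (rule AB.MA_single) simp

definition tensor_relators :: "('a \<times> 'b \<Rightarrow> complex) set" where
  "tensor_relators =
      {single (a \<oplus>\<^bsub>A\<^esub> a', b) \<ominus>\<^bsub>FT\<^esub> (single (a, b) \<oplus>\<^bsub>FT\<^esub> single (a', b)) | a a' b.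
          a \<in> carrier A \<and> a' \<in> carrier A \<and> b \<in> carrier B} \<union>
       {single (a, b \<oplus>\<^bsub>B\<^esub> b') \<ominus>\<^bsub>FT\<^esub> (single (a, b) \<oplus>\<^bsub>FT\<^esub> single (a, b')) | a b b'.
          a \<in> carrier A \<and> b \<in> carrier B \<and> b' \<in> carrier B} \<union>
       {single (c \<odot>\<^bsub>A\<^esub> a, b) \<ominus>\<^bsub>FT\<^esub> c \<odot>\<^bsub>FT\<^esub> single (a, b) | c a b.
          a \<in> carrier A \<and> b \<in> carrier B} \<union>
       {single (a, c \<odot>\<^bsub>B\<^esub> b) \<ominus>\<^bsub>FT\<^esub> c \<odot>\<^bsub>FT\<^esub> single (a, b) | c a b.
          a \<in> carrier A \<and> b \<in> carrier B}"

lemma tensor_ideal_eq: "tensor_ideal A B = Idl\<^bsub>FT\<^esub> tensor_relators"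
  by (simp add: tensor_ideal_def Let_def tensor_relators_def)

lemma tensor_relators_carrier: "tensor_relators \<subseteq> carrier FT"
  by (auto simp: tensor_relators_def intro!: FT.minus_closed)

lemma tensor_ideal: "calg_ideal (monoid_algebra (A \<times>\<times> B)) (tensor_ideal A B)"
  unfolding tensor_ideal_eq
  by (intro calg_ideal.intro FT.calg_axioms FT.genideal_ideal tensor_relators_carrier)

interpretation calg_ideal "monoid_algebra (A \<times>\<times> B)" "tensor_ideal A B" by (rule tensor_ideal)

sublocale TT: calg "tensor_algebra A B"
  unfolding tensor_algebra_def by (rule quot_algebra_calg)

lemma pt_closed [simp]: "a \<in> carrier A \<Longrightarrow> b \<in> carrier B \<Longrightarrow> pt a b \<in> carrier TT"
  unfolding pure_tensor_def tensor_algebra_def by (simp add: QA_closed)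

lemma pt_relator:
  assumes "f \<ominus>\<^bsub>FT\<^esub> g \<in> tensor_relators" "f \<in> carrier FT" "g \<in> carrier FT"
  shows "tensor_ideal A B +>\<^bsub>FT\<^esub> f = tensor_ideal A B +>\<^bsub>FT\<^esub> g"
proof -
  have "f \<ominus>\<^bsub>FT\<^esub> g \<in> tensor_ideal A B"
    unfolding tensor_ideal_eq using assms FT.genideal_self[OF tensor_relators_carrier] by blast
  then show ?thesis using assms QA_eq_iff by blast
qed

lemma pt_add_left: "a \<in> carrier A \<Longrightarrow> a' \<in> carrier A \<Longrightarrow> b \<in> carrier B \<Longrightarrow>
    pt (a \<oplus>\<^bsub>A\<^esub> a') b = pt a b \<oplus>\<^bsub>TT\<^esub> pt a' b"
  unfolding pure_tensor_def tensor_algebra_def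
  by (subst QA_add, simp_all, rule pt_relator) (unfold tensor_relators_def, auto)

lemma pt_add_right: "a \<in> carrier A \<Longrightarrow> b \<in> carrier B \<Longrightarrow> b' \<in> carrier B \<Longrightarrow>
    pt a (b \<oplus>\<^bsub>B\<^esub> b') = pt a b \<oplus>\<^bsub>TT\<^esub> pt a b'"
  unfolding pure_tensor_def tensor_algebra_def
  by (subst QA_add, simp_all, rule pt_relator) (unfold tensor_relators_def, auto)

lemma pt_smult_left: "a \<in> carrier A \<Longrightarrow> b \<in> carrier B \<Longrightarrow> pt (c \<odot>\<^bsub>A\<^esub> a) b = c \<odot>\<^bsub>TT\<^esub> pt a b"
  unfolding pure_tensor_def tensor_algebra_def
  by (subst QA_smult, simp_all, rule pt_relator) (unfold tensor_relators_def, auto)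

lemma pt_smult_right: "a \<in> carrier A \<Longrightarrow> b \<in> carrier B \<Longrightarrow> pt a (c \<odot>\<^bsub>B\<^esub> b) = c \<odot>\<^bsub>TT\<^esub> pt a b"
  unfolding pure_tensor_def tensor_algebra_def
  by (subst QA_smult, simp_all, rule pt_relator) (unfold tensor_relators_def, auto)

lemma pt_mult: "a \<in> carrier A \<Longrightarrow> b \<in> carrier B \<Longrightarrow> a' \<in> carrier A \<Longrightarrow> b' \<in> carrier B \<Longrightarrow>
    pt a b \<otimes>\<^bsub>TT\<^esub> pt a' b' = pt (a \<otimes>\<^bsub>A\<^esub> a') (b \<otimes>\<^bsub>B\<^esub> b')"
  unfolding pure_tensor_def tensor_algebra_def
  by (simp add: QA_mult AB.MA_mult_single)

lemma pt_one: "\<one>\<^bsub>TT\<^esub> = pt \<one>\<^bsub>A\<^esub> \<one>\<^bsub>B\<^esub>"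
  by (simp add: pure_tensor_def tensor_algebra_def QA_fields(2) AB.MA_simps(4))

text \<open>
  A coefficient in front of a pure tensor can be absorbed into its first factor, so that sums of
  pure tensors suffice.
\<close>

lemma tensor_induct [consumes 1, case_names pure add]:
  assumes T: "T \<in> carrier TT"
    and pure: "\<And>a b. a \<in> carrier A \<Longrightarrow> b \<in> carrier B \<Longrightarrow> P (pt a b)"
    and add: "\<And>S T. S \<in> carrier TT \<Longrightarrow> T \<in> carrier TT \<Longrightarrow> P S \<Longrightarrow> P T \<Longrightarrow> P (S \<oplus>\<^bsub>TT\<^esub> T)"
  shows "P T"
proof -
  let ?p = "\<lambda>f. tensor_ideal A B +>\<^bsub>FT\<^esub> f"
  note h = alg_homD[OF quot_proj_alg_hom, folded tensor_algebra_def]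
  have z: "?p \<zero>\<^bsub>FT\<^esub> = pt \<zero>\<^bsub>A\<^esub> \<one>\<^bsub>B\<^esub>"
  proof -
    have "?p \<zero>\<^bsub>FT\<^esub> = \<zero>\<^bsub>TT\<^esub>" by (simp add: QA_fields(3) tensor_algebra_def)
    then show ?thesis using pt_smult_left[of "\<zero>\<^bsub>A\<^esub>" "\<one>\<^bsub>B\<^esub>" 0] by simp
  qed
  obtain f where f: "f \<in> carrier FT" "T = ?p f"
    using T unfolding tensor_algebra_def by (rule QA_cases)
  show ?thesis unfolding f(2) using f(1)
  proof (induction f rule: AB.MA_induct)
    case zero
    show ?case unfolding z by (intro pure) simp_all
  next
    case (add_single f c x)
    obtain a b where x: "x = (a, b)" "a \<in> carrier A" "b \<in> carrier B" using add_single by auto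
    have "?p (f \<oplus>\<^bsub>FT\<^esub> c \<odot>\<^bsub>FT\<^esub> single x) = ?p f \<oplus>\<^bsub>TT\<^esub> c \<odot>\<^bsub>TT\<^esub> ?p (single x)"
      using add_single x by (simp add: h)
    also have "\<dots> = ?p f \<oplus>\<^bsub>TT\<^esub> pt (c \<odot>\<^bsub>A\<^esub> a) b"
      using x by (simp add: pt_smult_left) (simp add: pure_tensor_def)
    finally show ?case using x add_single by (simp add: add pure h)
  qed
qed

end

locale bilinear_tensor = tensor A B + V: calg V
  for A :: "(complex, 'a, 'm) module_scheme" and B :: "(complex, 'b, 'n) module_scheme"
    and V :: "(complex, 'v, 'k) module_scheme"
begin

interpretation calg_ideal "monoid_algebra (A \<times>\<times> B)" "tensor_ideal A B" by (rule tensor_ideal)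

definition bilinear_maps :: "('a \<Rightarrow> 'b \<Rightarrow> 'v) set" where
  "bilinear_maps = {\<beta>. (\<forall>a\<in>carrier A. \<forall>b\<in>carrier B. \<beta> a b \<in> carrier V) \<and>
     (\<forall>a\<in>carrier A. \<forall>a'\<in>carrier A. \<forall>b\<in>carrier B. \<beta> (a \<oplus>\<^bsub>A\<^esub> a') b = \<beta> a b \<oplus>\<^bsub>V\<^esub> \<beta> a' b) \<and>
     (\<forall>a\<in>carrier A. \<forall>b\<in>carrier B. \<forall>b'\<in>carrier B. \<beta> a (b \<oplus>\<^bsub>B\<^esub> b') = \<beta> a b \<oplus>\<^bsub>V\<^esub> \<beta> a b') \<and>
     (\<forall>c. \<forall>a\<in>carrier A. \<forall>b\<in>carrier B. \<beta> (c \<odot>\<^bsub>A\<^esub> a) b = c \<odot>\<^bsub>V\<^esub> \<beta> a b) \<and>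
     (\<forall>c. \<forall>a\<in>carrier A. \<forall>b\<in>carrier B. \<beta> a (c \<odot>\<^bsub>B\<^esub> b) = c \<odot>\<^bsub>V\<^esub> \<beta> a b)}"

abbreviation "bext \<beta> \<equiv> lin_ext V (\<lambda>(a, b). \<beta> a b)"

lemma bilinear_ext: "\<beta> \<in> bilinear_maps \<Longrightarrow> monoid_to_calg (A \<times>\<times> B) V (\<lambda>(a, b). \<beta> a b)"
  by (intro monoid_to_calg.intro AB.monoid_axioms V.calg_axioms monoid_to_calg_axioms.intro)
    (auto simp: bilinear_maps_def)

lemma bilinear_shift:
  assumes "\<beta> \<in> bilinear_maps" "u \<in> carrier A" "v \<in> carrier B"
  shows "(\<lambda>a b. \<beta> (u \<otimes>\<^bsub>A\<^esub> a) (v \<otimes>\<^bsub>B\<^esub> b)) \<in> bilinear_maps"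
    and "(\<lambda>a b. \<beta> (a \<otimes>\<^bsub>A\<^esub> u) (b \<otimes>\<^bsub>B\<^esub> v)) \<in> bilinear_maps"
  using assms by (simp_all add: bilinear_maps_def A.l_distr A.r_distr B.l_distr B.r_distr
      A.smult_mult_left A.smult_mult_right B.smult_mult_left B.smult_mult_right)

lemma bext_shift:
  assumes \<beta>: "\<beta> \<in> bilinear_maps" and u: "u \<in> carrier A" and v: "v \<in> carrier B"
    and f: "f \<in> carrier FT"
  shows "bext \<beta> (single (u, v) \<otimes>\<^bsub>FT\<^esub> f) = bext (\<lambda>a b. \<beta> (u \<otimes>\<^bsub>A\<^esub> a) (v \<otimes>\<^bsub>B\<^esub> b)) f"
    and "bext \<beta> (f \<otimes>\<^bsub>FT\<^esub> single (u, v)) = bext (\<lambda>a b. \<beta> (a \<otimes>\<^bsub>A\<^esub> u) (b \<otimes>\<^bsub>B\<^esub> v)) f"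
proof -
  interpret b: monoid_to_calg "A \<times>\<times> B" V "\<lambda>(a, b). \<beta> a b" by (rule bilinear_ext[OF \<beta>])
  interpret l: monoid_to_calg "A \<times>\<times> B" V "\<lambda>(a, b). \<beta> (u \<otimes>\<^bsub>A\<^esub> a) (v \<otimes>\<^bsub>B\<^esub> b)"
    by (rule bilinear_ext[OF bilinear_shift(1)[OF \<beta> u v]])
  interpret r: monoid_to_calg "A \<times>\<times> B" V "\<lambda>(a, b). \<beta> (a \<otimes>\<^bsub>A\<^esub> u) (b \<otimes>\<^bsub>B\<^esub> v)"
    by (rule bilinear_ext[OF bilinear_shift(2)[OF \<beta> u v]])
  show "bext \<beta> (single (u, v) \<otimes>\<^bsub>FT\<^esub> f) = bext (\<lambda>a b. \<beta> (u \<otimes>\<^bsub>A\<^esub> a) (v \<otimes>\<^bsub>B\<^esub> b)) f" using f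
  proof (induction f rule: AB.MA_induct)
    case zero
    then show ?case using u v by (simp add: b.lin_ext_zero l.lin_ext_zero)
  next
    case (add_single f c x)
    then show ?case using u v
      by (auto simp: FT.r_distr FT.smult_mult_right AB.MA_mult_single b.lin_ext_add b.lin_ext_smult
          l.lin_ext_add l.lin_ext_smult b.lin_ext_single l.lin_ext_single)
  qed
  show "bext \<beta> (f \<otimes>\<^bsub>FT\<^esub> single (u, v)) = bext (\<lambda>a b. \<beta> (a \<otimes>\<^bsub>A\<^esub> u) (b \<otimes>\<^bsub>B\<^esub> v)) f" using f
  proof (induction f rule: AB.MA_induct)
    case zero
    then show ?case using u v by (simp add: b.lin_ext_zero r.lin_ext_zero)
  next
    case (add_single f c x)
    then show ?case using u v
      by (auto simp: FT.l_distr FT.smult_mult_left AB.MA_mult_single b.lin_ext_add b.lin_ext_smult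
          r.lin_ext_add r.lin_ext_smult b.lin_ext_single r.lin_ext_single)
  qed
qed

definition bilinear_kernel :: "('a \<times> 'b \<Rightarrow> complex) set" where
  "bilinear_kernel = {f \<in> carrier FT. \<forall>\<beta>\<in>bilinear_maps. bext \<beta> f = \<zero>\<^bsub>V\<^esub>}"

text \<open>
  The elements killed by a single bilinear map form only a subspace, but those killed by all bilinear
  maps form a two-sided ideal: multiplication by \<open>(u, v)\<close> before applying \<open>\<beta>\<close> is the application of
  another bilinear map, namely \<open>\<beta>\<close> composed with the multiplications by \<open>u\<close> and \<open>v\<close>.
\<close>

lemma bilinear_kernel_mult:
  assumes f: "f \<in> bilinear_kernel" and x: "x \<in> carrier FT"
  shows "x \<otimes>\<^bsub>FT\<^esub> f \<in> bilinear_kernel" "f \<otimes>\<^bsub>FT\<^esub> x \<in> bilinear_kernel"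
proof -
  have fc: "f \<in> carrier FT" using f by (simp add: bilinear_kernel_def)
  have "bext \<beta> (x \<otimes>\<^bsub>FT\<^esub> f) = \<zero>\<^bsub>V\<^esub> \<and> bext \<beta> (f \<otimes>\<^bsub>FT\<^esub> x) = \<zero>\<^bsub>V\<^esub>"
    if \<beta>: "\<beta> \<in> bilinear_maps" for \<beta>
  proof -
    interpret b: monoid_to_calg "A \<times>\<times> B" V "\<lambda>(a, b). \<beta> a b" by (rule bilinear_ext[OF \<beta>])
    show ?thesis using x
    proof (induction x rule: AB.MA_induct)
      case zero
      then show ?case using fc by (simp add: b.lin_ext_zero)
    next
      case (add_single x c y)
      obtain u v where y: "y = (u, v)" "u \<in> carrier A" "v \<in> carrier B" using add_single by auto
      have "bext \<beta> (single y \<otimes>\<^bsub>FT\<^esub> f) = \<zero>\<^bsub>V\<^esub>" "bext \<beta> (f \<otimes>\<^bsub>FT\<^esub> single y) = \<zero>\<^bsub>V\<^esub>"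
        using f bilinear_shift[OF \<beta> y(2,3)] bext_shift[OF \<beta> y(2,3) fc]
        by (simp_all add: y bilinear_kernel_def)
      then show ?case using add_single y fc
        by (simp add: FT.l_distr FT.r_distr FT.smult_mult_left FT.smult_mult_right b.lin_ext_add b.lin_ext_smult)
    qed
  qed
  then show "x \<otimes>\<^bsub>FT\<^esub> f \<in> bilinear_kernel" "f \<otimes>\<^bsub>FT\<^esub> x \<in> bilinear_kernel"
    using fc x by (auto simp: bilinear_kernel_def)
qed

lemma bext_minus:
  assumes "\<beta> \<in> bilinear_maps" "f \<in> carrier FT" "g \<in> carrier FT"
  shows "bext \<beta> (f \<ominus>\<^bsub>FT\<^esub> g) = bext \<beta> f \<ominus>\<^bsub>V\<^esub> bext \<beta> g"
proof -
  interpret b: monoid_to_calg "A \<times>\<times> B" V "\<lambda>(a, b). \<beta> a b" by (rule bilinear_ext[OF assms(1)])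
  show ?thesis using assms
    by (simp add: FT.minus_eq_smult V.minus_eq_smult b.lin_ext_add b.lin_ext_smult b.lin_ext_closed)
qed

lemma bilinear_kernel_ideal: "ideal bilinear_kernel FT"
proof (rule idealI)
  show "ring FT" by (rule FT.ring_axioms)
  show "subgroup bilinear_kernel (add_monoid FT)"
  proof (rule subgroup.intro)
    show "bilinear_kernel \<subseteq> carrier (add_monoid FT)" by (auto simp: bilinear_kernel_def)
    show "\<one>\<^bsub>add_monoid FT\<^esub> \<in> bilinear_kernel"
      using monoid_to_calg.lin_ext_zero[OF bilinear_ext] by (auto simp: bilinear_kernel_def)
    fix f assume f: "f \<in> bilinear_kernel"
    then have "(- 1) \<odot>\<^bsub>FT\<^esub> f \<in> bilinear_kernel"
      using monoid_to_calg.lin_ext_smult[OF bilinear_ext, of _ f] by (auto simp: bilinear_kernel_def)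
    then show "inv\<^bsub>add_monoid FT\<^esub> f \<in> bilinear_kernel"
      using f by (simp add: FT.smult_minus_one a_inv_def bilinear_kernel_def)
    fix g assume "g \<in> bilinear_kernel"
    then show "f \<otimes>\<^bsub>add_monoid FT\<^esub> g \<in> bilinear_kernel"
      using f monoid_to_calg.lin_ext_add[OF bilinear_ext, of _ f g] by (auto simp: bilinear_kernel_def)
  qed
qed (rule bilinear_kernel_mult; assumption)+

text \<open>
  The bilinearity relations are killed by every bilinear map, so the ideal they generate is killed
  too.  This gives the universal property of the tensor product of vector spaces although that
  is defined as a quotient by a two-sided ideal.
\<close>

lemma tensor_ideal_kernel: "tensor_ideal A B \<subseteq> bilinear_kernel"
  unfolding tensor_ideal_eq
proof (rule FT.genideal_minimal[OF bilinear_kernel_ideal], rule subsetI)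
  fix f assume f: "f \<in> tensor_relators"
  have "bext \<beta> f = \<zero>\<^bsub>V\<^esub>" if \<beta>: "\<beta> \<in> bilinear_maps" for \<beta>
  proof -
    interpret b: monoid_to_calg "A \<times>\<times> B" V "\<lambda>(a, b). \<beta> a b" by (rule bilinear_ext[OF \<beta>])
    have cl: "\<beta> a b \<in> carrier V" if "a \<in> carrier A" "b \<in> carrier B" for a b
      using that \<beta> by (simp add: bilinear_maps_def)
    have s: "bext \<beta> (single (a, b)) = \<beta> a b" if "a \<in> carrier A" "b \<in> carrier B" for a b
      using that by (subst b.lin_ext_single) auto
    from f show ?thesis using \<beta> cl
      by (auto simp: tensor_relators_def bext_minus[OF \<beta>] b.lin_ext_add b.lin_ext_smult s
          V.r_neg V.minus_eq V.minus_eq_iff bilinear_maps_def)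
  qed
  then show "f \<in> bilinear_kernel" using f tensor_relators_carrier by (auto simp: bilinear_kernel_def)
qed

definition tensor_lift :: "('a \<Rightarrow> 'b \<Rightarrow> 'v) \<Rightarrow> ('a \<times> 'b \<Rightarrow> complex) set \<Rightarrow> 'v" where
  "tensor_lift \<beta> X = the_elem (bext \<beta> ` X)"

context
  fixes \<beta> assumes \<beta>: "\<beta> \<in> bilinear_maps"
begin

interpretation b: monoid_to_calg "A \<times>\<times> B" V "\<lambda>(a, b). \<beta> a b" by (rule bilinear_ext[OF \<beta>])

lemma tensor_lift_coset:
  "f \<in> carrier FT \<Longrightarrow> tensor_lift \<beta> (tensor_ideal A B +>\<^bsub>FT\<^esub> f) = bext \<beta> f"
  unfolding tensor_lift_def
  by (rule the_elem_coset[where B=V])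
    (use tensor_ideal_kernel \<beta> in \<open>auto simp: b.lin_ext_closed b.lin_ext_add V.is_abelian_group bilinear_kernel_def\<close>)

lemma tensor_lift_pure: "a \<in> carrier A \<Longrightarrow> b \<in> carrier B \<Longrightarrow> tensor_lift \<beta> (pt a b) = \<beta> a b"
  unfolding pure_tensor_def by (simp add: tensor_lift_coset b.lin_ext_single)

lemma tensor_lift_add:
  "S \<in> carrier TT \<Longrightarrow> T \<in> carrier TT \<Longrightarrow>
    tensor_lift \<beta> (S \<oplus>\<^bsub>TT\<^esub> T) = tensor_lift \<beta> S \<oplus>\<^bsub>V\<^esub> tensor_lift \<beta> T"
  unfolding tensor_algebra_def
  by (elim QA_cases) (simp add: QA_add tensor_lift_coset b.lin_ext_add)

lemma tensor_lift_smult: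
  "T \<in> carrier TT \<Longrightarrow> tensor_lift \<beta> (c \<odot>\<^bsub>TT\<^esub> T) = c \<odot>\<^bsub>V\<^esub> tensor_lift \<beta> T"
  unfolding tensor_algebra_def
  by (elim QA_cases) (simp add: QA_smult tensor_lift_coset b.lin_ext_smult)

lemma tensor_lift_closed: "T \<in> carrier TT \<Longrightarrow> tensor_lift \<beta> T \<in> carrier V"
  unfolding tensor_algebra_def
  by (elim QA_cases) (simp add: tensor_lift_coset b.lin_ext_closed)

lemma tensor_lift_zero: "tensor_lift \<beta> \<zero>\<^bsub>TT\<^esub> = \<zero>\<^bsub>V\<^esub>"
  using tensor_lift_smult[of "\<zero>\<^bsub>TT\<^esub>" 0] tensor_lift_closed[of "\<zero>\<^bsub>TT\<^esub>"] by simp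

lemma tensor_lift_finsum:
  assumes "\<And>i. i \<in> I \<Longrightarrow> h i \<in> carrier TT"
  shows "tensor_lift \<beta> (\<Oplus>\<^bsub>TT\<^esub> i\<in>I. h i) = (\<Oplus>\<^bsub>V\<^esub> i\<in>I. tensor_lift \<beta> (h i))"
  using assms
proof (induction I rule: infinite_finite_induct)
  case (insert i I)
  then show ?case by (simp add: Pi_def tensor_lift_add tensor_lift_closed)
qed (simp_all add: tensor_lift_zero)

end

end

section \<open>The algebra of linear endomorphisms\<close>

context calg
begin

abbreviation (input) "LE \<equiv> lin_end A"

lemma lin_end_carrier: "T \<in> carrier LE \<longleftrightarrow> T \<in> extensional (carrier A) \<and>
    (\<forall>a\<in>carrier A. T a \<in> carrier A) \<and>
    (\<forall>a\<in>carrier A. \<forall>b\<in>carrier A. T (a \<oplus> b) = T a \<oplus> T b) \<and>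
    (\<forall>c. \<forall>a\<in>carrier A. T (c \<odot> a) = c \<odot> T a)"
  by (auto simp: lin_end_def PiE_def Pi_def)

lemma lin_end_apply:
  "a \<in> carrier A \<Longrightarrow> (S \<otimes>\<^bsub>LE\<^esub> T) a = S (T a)"
  "a \<in> carrier A \<Longrightarrow> \<one>\<^bsub>LE\<^esub> a = a"
  "a \<in> carrier A \<Longrightarrow> \<zero>\<^bsub>LE\<^esub> a = \<zero>"
  "a \<in> carrier A \<Longrightarrow> (S \<oplus>\<^bsub>LE\<^esub> T) a = S a \<oplus> T a"
  "a \<in> carrier A \<Longrightarrow> (c \<odot>\<^bsub>LE\<^esub> T) a = c \<odot> T a"
  by (simp_all add: lin_end_def compose_def)

lemma lin_end_extensional:
  "S \<otimes>\<^bsub>LE\<^esub> T \<in> extensional (carrier A)" "\<one>\<^bsub>LE\<^esub> \<in> extensional (carrier A)"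
  "\<zero>\<^bsub>LE\<^esub> \<in> extensional (carrier A)" "S \<oplus>\<^bsub>LE\<^esub> T \<in> extensional (carrier A)"
  "c \<odot>\<^bsub>LE\<^esub> T \<in> extensional (carrier A)"
  by (simp_all add: lin_end_def)

lemma lin_end_eqI:
  assumes "S \<in> extensional (carrier A)" "T \<in> extensional (carrier A)"
    and "\<And>a. a \<in> carrier A \<Longrightarrow> S a = T a"
  shows "S = T"
  using assms by (rule extensionalityI)

lemma lin_end_closed:
  assumes "S \<in> carrier LE" "T \<in> carrier LE"
  shows "S \<otimes>\<^bsub>LE\<^esub> T \<in> carrier LE" "S \<oplus>\<^bsub>LE\<^esub> T \<in> carrier LE" "c \<odot>\<^bsub>LE\<^esub> T \<in> carrier LE"
    "\<one>\<^bsub>LE\<^esub> \<in> carrier LE" "\<zero>\<^bsub>LE\<^esub> \<in> carrier LE"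
proof -
  show "S \<otimes>\<^bsub>LE\<^esub> T \<in> carrier LE" "S \<oplus>\<^bsub>LE\<^esub> T \<in> carrier LE"
    using assms unfolding lin_end_carrier
    by (simp_all add: lin_end_apply lin_end_extensional smult_add_right a_ac)
  show "c \<odot>\<^bsub>LE\<^esub> T \<in> carrier LE"
    using assms unfolding lin_end_carrier
    by (simp add: lin_end_apply lin_end_extensional smult_add_right smult_smult mult.commute)
  show "\<one>\<^bsub>LE\<^esub> \<in> carrier LE" "\<zero>\<^bsub>LE\<^esub> \<in> carrier LE"
    unfolding lin_end_carrier by (simp_all add: lin_end_apply lin_end_extensional)
qed

lemma lin_endD:
  assumes "T \<in> carrier LE"
  shows "T \<in> extensional (carrier A)" "a \<in> carrier A \<Longrightarrow> T a \<in> carrier A"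
    "a \<in> carrier A \<Longrightarrow> b \<in> carrier A \<Longrightarrow> T (a \<oplus> b) = T a \<oplus> T b"
    "a \<in> carrier A \<Longrightarrow> T (c \<odot> a) = c \<odot> T a"
    "T \<zero> = \<zero>"
proof -
  show "T \<in> extensional (carrier A)" "a \<in> carrier A \<Longrightarrow> T a \<in> carrier A"
    "a \<in> carrier A \<Longrightarrow> b \<in> carrier A \<Longrightarrow> T (a \<oplus> b) = T a \<oplus> T b"
    "a \<in> carrier A \<Longrightarrow> T (c \<odot> a) = c \<odot> T a"
    using assms by (simp_all add: lin_end_carrier)
  have "T (0 \<odot> \<zero>) = 0 \<odot> T \<zero>" "T \<zero> \<in> carrier A" using assms by (simp_all add: lin_end_carrier del: smult_zero_left smult_zero_right)
  then show "T \<zero> = \<zero>" by simp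
qed

lemma lin_end_ring: "ring LE"
proof (rule ringI)
  show "abelian_group LE"
  proof (rule abelian_groupI)
    fix S T assume S: "S \<in> carrier LE" and T: "T \<in> carrier LE"
    then show "S \<oplus>\<^bsub>LE\<^esub> T \<in> carrier LE" by (rule lin_end_closed)
    show "S \<oplus>\<^bsub>LE\<^esub> T = T \<oplus>\<^bsub>LE\<^esub> S"
      by (rule lin_end_eqI) (simp_all add: lin_end_extensional lin_end_apply lin_endD[OF S] lin_endD[OF T] a_comm)
    fix V assume V: "V \<in> carrier LE"
    show "S \<oplus>\<^bsub>LE\<^esub> T \<oplus>\<^bsub>LE\<^esub> V = S \<oplus>\<^bsub>LE\<^esub> (T \<oplus>\<^bsub>LE\<^esub> V)"
      by (rule lin_end_eqI)
        (simp_all add: lin_end_extensional lin_end_apply lin_endD[OF S] lin_endD[OF T] lin_endD[OF V] a_assoc)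
  next
    fix S assume S: "S \<in> carrier LE"
    show "\<zero>\<^bsub>LE\<^esub> \<oplus>\<^bsub>LE\<^esub> S = S"
      by (rule lin_end_eqI) (simp_all add: lin_end_extensional lin_end_apply lin_endD[OF S])
    have "(- 1) \<odot>\<^bsub>LE\<^esub> S \<oplus>\<^bsub>LE\<^esub> S = \<zero>\<^bsub>LE\<^esub>"
      by (rule lin_end_eqI)
        (simp_all add: lin_end_extensional lin_end_apply lin_endD[OF S] smult_minus_one l_neg)
    then show "\<exists>T\<in>carrier LE. T \<oplus>\<^bsub>LE\<^esub> S = \<zero>\<^bsub>LE\<^esub>"
      using lin_end_closed(3)[OF S S] by blast
  next
    show "\<zero>\<^bsub>LE\<^esub> \<in> carrier LE"
      unfolding lin_end_carrier by (simp add: lin_end_apply lin_end_extensional)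
  qed
  show "monoid LE"
  proof (rule monoidI)
    show "\<one>\<^bsub>LE\<^esub> \<in> carrier LE"
      unfolding lin_end_carrier by (simp add: lin_end_apply lin_end_extensional)
  next
    fix S T assume S: "S \<in> carrier LE" and T: "T \<in> carrier LE"
    then show "S \<otimes>\<^bsub>LE\<^esub> T \<in> carrier LE" by (rule lin_end_closed)
    fix V assume V: "V \<in> carrier LE"
    show "S \<otimes>\<^bsub>LE\<^esub> T \<otimes>\<^bsub>LE\<^esub> V = S \<otimes>\<^bsub>LE\<^esub> (T \<otimes>\<^bsub>LE\<^esub> V)"
      by (rule lin_end_eqI)
        (simp_all add: lin_end_extensional lin_end_apply lin_endD[OF S] lin_endD[OF T] lin_endD[OF V])
  next
    fix S assume S: "S \<in> carrier LE"
    show "\<one>\<^bsub>LE\<^esub> \<otimes>\<^bsub>LE\<^esub> S = S" "S \<otimes>\<^bsub>LE\<^esub> \<one>\<^bsub>LE\<^esub> = S"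
      by (rule lin_end_eqI, simp_all add: lin_end_extensional lin_end_apply lin_endD[OF S])+
  qed
next
  fix S T V assume S: "S \<in> carrier LE" and T: "T \<in> carrier LE" and V: "V \<in> carrier LE"
  show "(S \<oplus>\<^bsub>LE\<^esub> T) \<otimes>\<^bsub>LE\<^esub> V = S \<otimes>\<^bsub>LE\<^esub> V \<oplus>\<^bsub>LE\<^esub> T \<otimes>\<^bsub>LE\<^esub> V"
    "V \<otimes>\<^bsub>LE\<^esub> (S \<oplus>\<^bsub>LE\<^esub> T) = V \<otimes>\<^bsub>LE\<^esub> S \<oplus>\<^bsub>LE\<^esub> V \<otimes>\<^bsub>LE\<^esub> T"
    by (rule lin_end_eqI,
        simp_all add: lin_end_extensional lin_end_apply lin_endD[OF S] lin_endD[OF T] lin_endD[OF V])+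
qed

lemma lin_end_calg: "calg LE"
proof (intro calg.intro calg_axioms.intro lin_end_ring)
  fix S T c d assume S: "S \<in> carrier LE" and T: "T \<in> carrier LE"
  show "c \<odot>\<^bsub>LE\<^esub> (S \<oplus>\<^bsub>LE\<^esub> T) = c \<odot>\<^bsub>LE\<^esub> S \<oplus>\<^bsub>LE\<^esub> c \<odot>\<^bsub>LE\<^esub> T"
    "c \<odot>\<^bsub>LE\<^esub> S \<otimes>\<^bsub>LE\<^esub> T = c \<odot>\<^bsub>LE\<^esub> (S \<otimes>\<^bsub>LE\<^esub> T)"
    "S \<otimes>\<^bsub>LE\<^esub> (c \<odot>\<^bsub>LE\<^esub> T) = c \<odot>\<^bsub>LE\<^esub> (S \<otimes>\<^bsub>LE\<^esub> T)"
    by (rule lin_end_eqI,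
        simp_all add: lin_end_extensional lin_end_apply lin_endD[OF S] lin_endD[OF T] smult_add_right)+
next
  fix S c d assume S: "S \<in> carrier LE"
  show "c \<odot>\<^bsub>LE\<^esub> S \<in> carrier LE" using S S by (rule lin_end_closed)
  show "(c + d) \<odot>\<^bsub>LE\<^esub> S = c \<odot>\<^bsub>LE\<^esub> S \<oplus>\<^bsub>LE\<^esub> d \<odot>\<^bsub>LE\<^esub> S"
    "c \<odot>\<^bsub>LE\<^esub> (d \<odot>\<^bsub>LE\<^esub> S) = (c * d) \<odot>\<^bsub>LE\<^esub> S" "1 \<odot>\<^bsub>LE\<^esub> S = S"
    by (rule lin_end_eqI,
        simp_all add: lin_end_extensional lin_end_apply lin_endD[OF S] smult_add_left smult_smult)+
qed

end

section \<open>Generators and relations of the two algebras\<close>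

text \<open>
  The defining relations, imposed on four elements of an arbitrary algebra.
\<close>

definition uq_rel where
  "uq_rel B q k k' e f \<longleftrightarrow>
     k' \<otimes>\<^bsub>B\<^esub> k = \<one>\<^bsub>B\<^esub> \<and> k \<otimes>\<^bsub>B\<^esub> k' = \<one>\<^bsub>B\<^esub> \<and>
     k \<otimes>\<^bsub>B\<^esub> e = q\<^sup>2 \<odot>\<^bsub>B\<^esub> (e \<otimes>\<^bsub>B\<^esub> k) \<and> k \<otimes>\<^bsub>B\<^esub> f = inverse (q\<^sup>2) \<odot>\<^bsub>B\<^esub> (f \<otimes>\<^bsub>B\<^esub> k) \<and>
     e \<otimes>\<^bsub>B\<^esub> f \<ominus>\<^bsub>B\<^esub> f \<otimes>\<^bsub>B\<^esub> e = (1 / (q - inverse q)) \<odot>\<^bsub>B\<^esub> (k \<ominus>\<^bsub>B\<^esub> k')"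

lemma uq_relations_iff:
  assumes "gen_map B (case_uq_gen k k' e f)"
  shows "(\<forall>(l, r)\<in>uq_relations q. free_eval B (case_uq_gen k k' e f) l = free_eval B (case_uq_gen k k' e f) r) \<longleftrightarrow> uq_rel B q k k' e f"
proof -
  interpret gen_map B "case_uq_gen k k' e f" by (rule assms)
  show ?thesis
  unfolding uq_relations_def Let_def uq_rel_def
  by (simp add: alg_homD[OF free_eval_alg_hom] free_eval_gen free.minus_closed
     alg_hom_zero_minus(2)[OF free_eval_alg_hom free.calg_axioms B.calg_axioms])
qed

lemma uq_relations_carrier: "uq_relations q \<subseteq> carrier free_algebra \<times> carrier free_algebra"
  unfolding uq_relations_def Let_def by (simp add: free.minus_closed)

interpretation uq: presentation "uq_relations q" for q
  by unfold_locales (rule uq_relations_carrier)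

interpretation U: calg "uq_algebra q" for q
  unfolding uq_algebra_def by (rule uq.presented_calg)

lemma uq_gen_closed [simp]:
  "uq_k q \<in> carrier (uq_algebra q)" "uq_kinv q \<in> carrier (uq_algebra q)"
  "uq_e q \<in> carrier (uq_algebra q)" "uq_f q \<in> carrier (uq_algebra q)"
  by (simp_all add: uq_k_def uq_kinv_def uq_e_def uq_f_def uq_algebra_def)

lemma uq_lift:
  assumes "calg B" "k \<in> carrier B" "k' \<in> carrier B" "e \<in> carrier B" "f \<in> carrier B"
    "uq_rel B q k k' e f"
  defines "h \<equiv> presented_lift B (case_uq_gen k k' e f)"
  shows "h \<in> alg_hom (uq_algebra q) B"
    "h (uq_k q) = k" "h (uq_kinv q) = k'" "h (uq_e q) = e" "h (uq_f q) = f"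
proof -
  interpret gen_map B "case_uq_gen k k' e f"
    using assms(1-5) by (simp add: gen_map_def gen_map_axioms_def split: uq_gen.split)
  interpret L: presented_map "uq_relations q" B "case_uq_gen k k' e f"
    using uq_relations_iff[OF gen_map_axioms, of q] assms(6) by unfold_locales auto
  show "h \<in> alg_hom (uq_algebra q) B"
    unfolding h_def uq_algebra_def by (rule L.presented_lift_alg_hom)
  show "h (uq_k q) = k" "h (uq_kinv q) = k'" "h (uq_e q) = e" "h (uq_f q) = f"
    unfolding h_def by (simp_all add: uq_k_def uq_kinv_def uq_e_def uq_f_def L.presented_lift_gen)
qed

lemma uq_rel_hom:
  assumes h: "h \<in> alg_hom (uq_algebra q) B" and B: "calg B"
  shows "uq_rel B q (h (uq_k q)) (h (uq_kinv q)) (h (uq_e q)) (h (uq_f q))"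
proof -
  have h': "h \<in> alg_hom (presented_algebra (uq_relations q)) B" using h by (simp add: uq_algebra_def)
  define \<phi> where "\<phi> = (\<lambda>g. h (presented_gen (uq_relations q) g))"
  interpret gen_map B \<phi>
    using B alg_homD(1)[OF h'] by (simp add: gen_map_def gen_map_axioms_def \<phi>_def)
  have "\<phi> = case_uq_gen (h (uq_k q)) (h (uq_kinv q)) (h (uq_e q)) (h (uq_f q))"
    by (rule ext) (simp add: \<phi>_def uq_k_def uq_kinv_def uq_e_def uq_f_def split: uq_gen.split)
  note eq = this
  show ?thesis
    using uq.alg_hom_relation[OF h' B] uq_relations_iff[OF gen_map_axioms[unfolded eq], of q]
    unfolding \<phi>_def[symmetric] eq by auto
qed

lemma alg_hom_id: "(\<lambda>a. a) \<in> alg_hom A A"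
  by (rule alg_homI) auto

lemma uq_rel_gen: "uq_rel (uq_algebra q) q (uq_k q) (uq_kinv q) (uq_e q) (uq_f q)"
  by (rule uq_rel_hom[OF alg_hom_id U.calg_axioms])

lemma uq_induct [consumes 1, case_names one add smult k kinv e f]:
  assumes "X \<in> carrier (uq_algebra q)"
    and "P \<one>\<^bsub>uq_algebra q\<^esub>"
    and "\<And>X Y. X \<in> carrier (uq_algebra q) \<Longrightarrow> Y \<in> carrier (uq_algebra q) \<Longrightarrow> P X \<Longrightarrow> P Y \<Longrightarrow> P (X \<oplus>\<^bsub>uq_algebra q\<^esub> Y)"
    and "\<And>c X. X \<in> carrier (uq_algebra q) \<Longrightarrow> P X \<Longrightarrow> P (c \<odot>\<^bsub>uq_algebra q\<^esub> X)"
    and "\<And>X. X \<in> carrier (uq_algebra q) \<Longrightarrow> P X \<Longrightarrow> P (uq_k q \<otimes>\<^bsub>uq_algebra q\<^esub> X)"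
    and "\<And>X. X \<in> carrier (uq_algebra q) \<Longrightarrow> P X \<Longrightarrow> P (uq_kinv q \<otimes>\<^bsub>uq_algebra q\<^esub> X)"
    and "\<And>X. X \<in> carrier (uq_algebra q) \<Longrightarrow> P X \<Longrightarrow> P (uq_e q \<otimes>\<^bsub>uq_algebra q\<^esub> X)"
    and "\<And>X. X \<in> carrier (uq_algebra q) \<Longrightarrow> P X \<Longrightarrow> P (uq_f q \<otimes>\<^bsub>uq_algebra q\<^esub> X)"
  shows "P X"
  using assms(1) unfolding uq_algebra_def
proof (induction X rule: uq.presented_induct)
  case one
  show ?case using assms(2) by (simp add: uq_algebra_def)
next
  case (add X Y)
  then show ?case using assms(3)[of X Y] by (simp add: uq_algebra_def)
next
  case (smult c X)
  then show ?case using assms(4)[of X c] by (simp add: uq_algebra_def)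
next
  case (gen g X)
  then show ?case using assms(5-8)[of X]
    by (cases g) (simp_all add: uq_algebra_def uq_k_def uq_kinv_def uq_e_def uq_f_def)
qed

lemma uq_alg_hom_eq:
  assumes "h \<in> alg_hom (uq_algebra q) B" "h' \<in> alg_hom (uq_algebra q) B"
    "h (uq_k q) = h' (uq_k q)" "h (uq_kinv q) = h' (uq_kinv q)"
    "h (uq_e q) = h' (uq_e q)" "h (uq_f q) = h' (uq_f q)"
    and X: "X \<in> carrier (uq_algebra q)"
  shows "h X = h' X"
proof -
  have "h (presented_gen (uq_relations q) g) = h' (presented_gen (uq_relations q) g)" for g
    using assms(3-6) by (cases g) (simp_all add: uq_k_def uq_kinv_def uq_e_def uq_f_def)
  then show ?thesis using uq.alg_hom_eq[of h q B h' X] assms(1,2) X by (simp add: uq_algebra_def)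
qed

lemma qp_relations_carrier: "qp_relations q \<subseteq> carrier free_algebra \<times> carrier free_algebra"
  unfolding qp_relations_def Let_def by simp

interpretation qp: presentation "qp_relations q" for q
  by unfold_locales (rule qp_relations_carrier)

interpretation Q: calg "qplane q" for q
  unfolding qplane_def by (rule qp.presented_calg)

lemma qp_gen_closed [simp]: "qp_x q \<in> carrier (qplane q)" "qp_y q \<in> carrier (qplane q)"
  by (simp_all add: qp_x_def qp_y_def qplane_def)

lemma qp_relations_iff:
  assumes "gen_map B (case_qp_gen x y)"
  shows "(\<forall>(l, r)\<in>qp_relations q. free_eval B (case_qp_gen x y) l = free_eval B (case_qp_gen x y) r) \<longleftrightarrow>
    y \<otimes>\<^bsub>B\<^esub> x = q \<odot>\<^bsub>B\<^esub> (x \<otimes>\<^bsub>B\<^esub> y)"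
proof -
  interpret gen_map B "case_qp_gen x y" by (rule assms)
  show ?thesis
  unfolding qp_relations_def Let_def
  by (simp add: alg_homD[OF free_eval_alg_hom] free_eval_gen)
qed

lemma qp_lift:
  assumes "calg B" "x \<in> carrier B" "y \<in> carrier B" "y \<otimes>\<^bsub>B\<^esub> x = q \<odot>\<^bsub>B\<^esub> (x \<otimes>\<^bsub>B\<^esub> y)"
  defines "h \<equiv> presented_lift B (case_qp_gen x y)"
  shows "h \<in> alg_hom (qplane q) B" "h (qp_x q) = x" "h (qp_y q) = y"
proof -
  interpret gen_map B "case_qp_gen x y"
    using assms(1-3) by (simp add: gen_map_def gen_map_axioms_def split: qp_gen.split)
  interpret L: presented_map "qp_relations q" B "case_qp_gen x y"
    using qp_relations_iff[OF gen_map_axioms, of q] assms(4) by unfold_locales auto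
  show "h \<in> alg_hom (qplane q) B"
    unfolding h_def qplane_def by (rule L.presented_lift_alg_hom)
  show "h (qp_x q) = x" "h (qp_y q) = y"
    unfolding h_def by (simp_all add: qp_x_def qp_y_def L.presented_lift_gen)
qed

lemma qp_yx: "qp_y q \<otimes>\<^bsub>qplane q\<^esub> qp_x q = q \<odot>\<^bsub>qplane q\<^esub> (qp_x q \<otimes>\<^bsub>qplane q\<^esub> qp_y q)"
proof -
  define \<phi> where "\<phi> = presented_gen (qp_relations q)"
  interpret gen_map "qplane q" \<phi>
    by unfold_locales (simp add: \<phi>_def qplane_def)
  have "\<phi> = case_qp_gen (qp_x q) (qp_y q)"
    by (rule ext) (simp add: \<phi>_def qp_x_def qp_y_def split: qp_gen.split)
  note eq = this
  show ?thesis
    using qp.alg_hom_relation[OF alg_hom_id qp.presented_calg, of _ _ q] qp_relations_iff[OF gen_map_axioms[unfolded eq], of q]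
    unfolding \<phi>_def[symmetric] eq qplane_def[symmetric] by auto
qed

lemma qp_induct [consumes 1, case_names one add smult x y]:
  assumes "X \<in> carrier (qplane q)"
    and "P \<one>\<^bsub>qplane q\<^esub>"
    and "\<And>X Y. X \<in> carrier (qplane q) \<Longrightarrow> Y \<in> carrier (qplane q) \<Longrightarrow> P X \<Longrightarrow> P Y \<Longrightarrow> P (X \<oplus>\<^bsub>qplane q\<^esub> Y)"
    and "\<And>c X. X \<in> carrier (qplane q) \<Longrightarrow> P X \<Longrightarrow> P (c \<odot>\<^bsub>qplane q\<^esub> X)"
    and "\<And>X. X \<in> carrier (qplane q) \<Longrightarrow> P X \<Longrightarrow> P (qp_x q \<otimes>\<^bsub>qplane q\<^esub> X)"
    and "\<And>X. X \<in> carrier (qplane q) \<Longrightarrow> P X \<Longrightarrow> P (qp_y q \<otimes>\<^bsub>qplane q\<^esub> X)"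
  shows "P X"
  using assms(1) unfolding qplane_def
proof (induction X rule: qp.presented_induct)
  case one
  show ?case using assms(2) by (simp add: qplane_def)
next
  case (add X Y)
  then show ?case using assms(3)[of X Y] by (simp add: qplane_def)
next
  case (smult c X)
  then show ?case using assms(4)[of X c] by (simp add: qplane_def)
next
  case (gen g X)
  then show ?case using assms(5,6)[of X] by (cases g) (simp_all add: qplane_def qp_x_def qp_y_def)
qed

section \<open>The Hopf algebra maps\<close>

interpretation C: calg complex_algebra
proof (intro calg.intro calg_axioms.intro ringI abelian_groupI monoidI)
  fix x :: complex assume "x \<in> carrier complex_algebra"
  show "\<exists>y\<in>carrier complex_algebra. y \<oplus>\<^bsub>complex_algebra\<^esub> x = \<zero>\<^bsub>complex_algebra\<^esub>"
    by (auto simp: complex_algebra_def intro: exI[of _ "- x"])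
qed (simp_all add: complex_algebra_def algebra_simps)

interpretation UU: tensor "uq_algebra q" "uq_algebra q" for q
  by (intro tensor.intro U.calg_axioms)

lemma uq_counit_hom:
  fixes q :: complex
  shows "uq_counit \<in> alg_hom (uq_algebra q) complex_algebra"
    and "uq_counit (uq_k q) = 1" "uq_counit (uq_kinv q) = 1" "uq_counit (uq_e q) = 0" "uq_counit (uq_f q) = 0"
proof -
  have r: "uq_rel complex_algebra q 1 1 0 0"
  proof -
    have "a \<ominus>\<^bsub>complex_algebra\<^esub> b = a - b" for a b
      by (subst C.minus_eq_smult) (simp_all add: complex_algebra_def)
    then show ?thesis by (simp add: uq_rel_def) (simp add: complex_algebra_def)
  qed
  have c: "x \<in> carrier complex_algebra" for x by (simp add: complex_algebra_def)
  show "uq_counit \<in> alg_hom (uq_algebra q) complex_algebra"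
    and "uq_counit (uq_k q) = 1" "uq_counit (uq_kinv q) = 1" "uq_counit (uq_e q) = 0" "uq_counit (uq_f q) = 0"
    unfolding uq_counit_def using uq_lift[OF C.calg_axioms c c c c r] by auto
qed

lemma (in calg) uq_rel_kinv_e:
  assumes "uq_rel A q k k' e f" "k \<in> carrier A" "k' \<in> carrier A" "e \<in> carrier A"
  shows "e \<otimes> k' = q\<^sup>2 \<odot> (k' \<otimes> e)"
proof -
  have "e \<otimes> k' = (k' \<otimes> k) \<otimes> (e \<otimes> k')" using assms by (simp add: uq_rel_def)
  also have "\<dots> = k' \<otimes> (k \<otimes> e) \<otimes> k'" using assms(2-) by (simp add: m_assoc)
  also have "\<dots> = q\<^sup>2 \<odot> (k' \<otimes> e \<otimes> (k \<otimes> k'))"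
    using assms by (simp add: uq_rel_def m_assoc smult_mult_left smult_mult_right)
  also have "\<dots> = q\<^sup>2 \<odot> (k' \<otimes> e)" using assms by (simp add: uq_rel_def)
  finally show ?thesis .
qed

text \<open>
  The comultiplication respects the relations.  Only the commutator of \<open>e\<close> and \<open>f\<close> needs thought:
  the mixed terms of the two products agree, because the factors \<open>q\<^sup>2\<close> and \<open>q\<^sup>-\<^sup>2\<close> from moving \<open>k'\<close> past
  \<open>e\<close> and \<open>k\<close> past \<open>f\<close> cancel, and what remains is \<open>k' \<otimes> W + W \<otimes> k\<close> with \<open>W = ef - fe\<close> a multiple of
  \<open>k - k'\<close>, a telescoping expression.
\<close>

lemma comult_rel:
  fixes q :: complex
  assumes q: "q \<noteq> 0"
  defines "U \<equiv> uq_algebra q"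
  defines "T \<equiv> tensor_algebra U U"
  defines "t \<equiv> pure_tensor U U"
  defines "k \<equiv> uq_k q" and "k' \<equiv> uq_kinv q" and "e \<equiv> uq_e q" and "f \<equiv> uq_f q"
  shows "uq_rel T q (t k k) (t k' k') (t \<one>\<^bsub>U\<^esub> e \<oplus>\<^bsub>T\<^esub> t e k) (t f \<one>\<^bsub>U\<^esub> \<oplus>\<^bsub>T\<^esub> t k' f)"
proof -
  interpret U: calg U unfolding U_def by (rule U.calg_axioms)
  interpret UU: tensor U U by (intro tensor.intro U.calg_axioms)
  have T: "calg T" unfolding T_def by (rule UU.TT.calg_axioms)
  interpret T: calg T by (rule T)
  have g [simp]: "k \<in> carrier U" "k' \<in> carrier U" "e \<in> carrier U" "f \<in> carrier U"
    by (simp_all add: U_def k_def k'_def e_def f_def)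
  have R: "uq_rel U q k k' e f" using uq_rel_gen unfolding U_def k_def k'_def e_def f_def .
  have t [simp]: "t a b \<in> carrier T" if "a \<in> carrier U" "b \<in> carrier U" for a b
    using that unfolding t_def T_def by simp
  note tl = UU.pt_smult_left[folded t_def T_def] UU.pt_smult_right[folded t_def T_def]
    UU.pt_add_left[folded t_def T_def] UU.pt_add_right[folded t_def T_def]
    UU.pt_mult[folded t_def T_def]
  note rels = R[unfolded uq_rel_def] U.uq_rel_kinv_e[OF R g(1,2,3)]
  define c where "c = 1 / (q - inverse q)"
  define W where "W = c \<odot>\<^bsub>U\<^esub> (k \<ominus>\<^bsub>U\<^esub> k')"
  have W: "W \<in> carrier U" by (simp add: W_def)
  have ef: "e \<otimes>\<^bsub>U\<^esub> f = W \<oplus>\<^bsub>U\<^esub> f \<otimes>\<^bsub>U\<^esub> e"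
    using rels W by (simp add: W_def c_def U.minus_eq_iff)
  have tW: "t k' W = c \<odot>\<^bsub>T\<^esub> (t k' k \<oplus>\<^bsub>T\<^esub> (- 1) \<odot>\<^bsub>T\<^esub> t k' k')"
    "t W k = c \<odot>\<^bsub>T\<^esub> (t k k \<oplus>\<^bsub>T\<^esub> (- 1) \<odot>\<^bsub>T\<^esub> t k' k)"
    by (simp_all add: W_def U.minus_eq_smult tl)
  have key: "t k' W \<oplus>\<^bsub>T\<^esub> t W k = c \<odot>\<^bsub>T\<^esub> (t k k \<ominus>\<^bsub>T\<^esub> t k' k')"
  proof -
    have "t k' W \<oplus>\<^bsub>T\<^esub> t W k = c \<odot>\<^bsub>T\<^esub> ((t k' k \<oplus>\<^bsub>T\<^esub> \<ominus>\<^bsub>T\<^esub> t k' k') \<oplus>\<^bsub>T\<^esub> (t k k \<oplus>\<^bsub>T\<^esub> \<ominus>\<^bsub>T\<^esub> t k' k))"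
      by (simp add: tW T.smult_add_right T.smult_minus_one)
    also have "(t k' k \<oplus>\<^bsub>T\<^esub> \<ominus>\<^bsub>T\<^esub> t k' k') \<oplus>\<^bsub>T\<^esub> (t k k \<oplus>\<^bsub>T\<^esub> \<ominus>\<^bsub>T\<^esub> t k' k) = t k k \<ominus>\<^bsub>T\<^esub> t k' k'"
    proof -
      have "(t k' k \<oplus>\<^bsub>T\<^esub> \<ominus>\<^bsub>T\<^esub> t k' k') \<oplus>\<^bsub>T\<^esub> (t k k \<oplus>\<^bsub>T\<^esub> \<ominus>\<^bsub>T\<^esub> t k' k) =
          (t k' k \<oplus>\<^bsub>T\<^esub> \<ominus>\<^bsub>T\<^esub> t k' k) \<oplus>\<^bsub>T\<^esub> (t k k \<oplus>\<^bsub>T\<^esub> \<ominus>\<^bsub>T\<^esub> t k' k')"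
        by (simp add: T.a_ac)
      then show ?thesis by (simp add: T.r_neg T.minus_eq)
    qed
    finally show ?thesis .
  qed
  have EF: "(t \<one>\<^bsub>U\<^esub> e \<oplus>\<^bsub>T\<^esub> t e k) \<otimes>\<^bsub>T\<^esub> (t f \<one>\<^bsub>U\<^esub> \<oplus>\<^bsub>T\<^esub> t k' f) =
      t f e \<oplus>\<^bsub>T\<^esub> (t k' (e \<otimes>\<^bsub>U\<^esub> f) \<oplus>\<^bsub>T\<^esub> (t (e \<otimes>\<^bsub>U\<^esub> f) k \<oplus>\<^bsub>T\<^esub> t (k' \<otimes>\<^bsub>U\<^esub> e) (f \<otimes>\<^bsub>U\<^esub> k)))"
    using q by (simp add: T.l_distr T.r_distr tl rels T.a_ac T.smult_smult)
  have FE: "(t f \<one>\<^bsub>U\<^esub> \<oplus>\<^bsub>T\<^esub> t k' f) \<otimes>\<^bsub>T\<^esub> (t \<one>\<^bsub>U\<^esub> e \<oplus>\<^bsub>T\<^esub> t e k) =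
      t f e \<oplus>\<^bsub>T\<^esub> (t k' (f \<otimes>\<^bsub>U\<^esub> e) \<oplus>\<^bsub>T\<^esub> (t (f \<otimes>\<^bsub>U\<^esub> e) k \<oplus>\<^bsub>T\<^esub> t (k' \<otimes>\<^bsub>U\<^esub> e) (f \<otimes>\<^bsub>U\<^esub> k)))"
    by (simp add: T.l_distr T.r_distr tl T.a_ac)
  have "(t \<one>\<^bsub>U\<^esub> e \<oplus>\<^bsub>T\<^esub> t e k) \<otimes>\<^bsub>T\<^esub> (t f \<one>\<^bsub>U\<^esub> \<oplus>\<^bsub>T\<^esub> t k' f) \<ominus>\<^bsub>T\<^esub> (t f \<one>\<^bsub>U\<^esub> \<oplus>\<^bsub>T\<^esub> t k' f) \<otimes>\<^bsub>T\<^esub> (t \<one>\<^bsub>U\<^esub> e \<oplus>\<^bsub>T\<^esub> t e k)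
      = t k' W \<oplus>\<^bsub>T\<^esub> t W k"
    unfolding EF FE using W by (subst T.minus_eq_iff) (simp_all add: ef tl T.a_ac)
  moreover have "t k' k' \<otimes>\<^bsub>T\<^esub> t k k = \<one>\<^bsub>T\<^esub>" "t k k \<otimes>\<^bsub>T\<^esub> t k' k' = \<one>\<^bsub>T\<^esub>"
    using rels UU.pt_one[folded t_def T_def] by (simp_all add: tl)
  moreover have "t k k \<otimes>\<^bsub>T\<^esub> (t \<one>\<^bsub>U\<^esub> e \<oplus>\<^bsub>T\<^esub> t e k) = q\<^sup>2 \<odot>\<^bsub>T\<^esub> ((t \<one>\<^bsub>U\<^esub> e \<oplus>\<^bsub>T\<^esub> t e k) \<otimes>\<^bsub>T\<^esub> t k k)"
    using rels by (simp add: T.l_distr T.r_distr tl T.smult_add_right)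
  moreover have "t k k \<otimes>\<^bsub>T\<^esub> (t f \<one>\<^bsub>U\<^esub> \<oplus>\<^bsub>T\<^esub> t k' f) = inverse (q\<^sup>2) \<odot>\<^bsub>T\<^esub> ((t f \<one>\<^bsub>U\<^esub> \<oplus>\<^bsub>T\<^esub> t k' f) \<otimes>\<^bsub>T\<^esub> t k k)"
    using rels by (simp add: T.l_distr T.r_distr tl T.smult_add_right)
  ultimately show ?thesis using key by (simp add: uq_rel_def c_def)
qed

lemma uq_comult_hom:
  fixes q :: complex
  assumes q: "q \<noteq> 0"
  defines "U \<equiv> uq_algebra q"
  defines "T \<equiv> tensor_algebra U U"
  defines "t \<equiv> pure_tensor U U"
  shows "uq_comult q \<in> alg_hom U T"
    "uq_comult q (uq_k q) = t (uq_k q) (uq_k q)"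
    "uq_comult q (uq_kinv q) = t (uq_kinv q) (uq_kinv q)"
    "uq_comult q (uq_e q) = t \<one>\<^bsub>U\<^esub> (uq_e q) \<oplus>\<^bsub>T\<^esub> t (uq_e q) (uq_k q)"
    "uq_comult q (uq_f q) = t (uq_f q) \<one>\<^bsub>U\<^esub> \<oplus>\<^bsub>T\<^esub> t (uq_kinv q) (uq_f q)"
proof -
  note L = uq_lift[OF UU.TT.calg_axioms _ _ _ _ comult_rel[OF q]]
  show "uq_comult q \<in> alg_hom U T"
    "uq_comult q (uq_k q) = t (uq_k q) (uq_k q)"
    "uq_comult q (uq_kinv q) = t (uq_kinv q) (uq_kinv q)"
    "uq_comult q (uq_e q) = t \<one>\<^bsub>U\<^esub> (uq_e q) \<oplus>\<^bsub>T\<^esub> t (uq_e q) (uq_k q)"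
    "uq_comult q (uq_f q) = t (uq_f q) \<one>\<^bsub>U\<^esub> \<oplus>\<^bsub>T\<^esub> t (uq_kinv q) (uq_f q)"
    unfolding uq_comult_def Let_def U_def T_def t_def by (rule L; simp)+
qed

lemma Uq_simps:
  "carrier (Uq q) = carrier (uq_algebra q)" "monoid.mult (Uq q) = monoid.mult (uq_algebra q)"
  "monoid.one (Uq q) = monoid.one (uq_algebra q)" "ring.add (Uq q) = ring.add (uq_algebra q)"
  "ring.zero (Uq q) = ring.zero (uq_algebra q)" "module.smult (Uq q) = module.smult (uq_algebra q)"
  "comult (Uq q) = uq_comult q" "counit (Uq q) = uq_counit"
  by (simp_all add: Uq_def module.defs hopf_algebra.defs)

lemma Uq_alg_hom: "alg_hom (Uq q) B = alg_hom (uq_algebra q) B"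
  by (auto simp: alg_hom_def ring_hom_def Uq_simps)

lemma Uq_tensor:
  "tensor_algebra (Uq q) (Uq q) = tensor_algebra (uq_algebra q) (uq_algebra q)"
  "pure_tensor (Uq q) (Uq q) = pure_tensor (uq_algebra q) (uq_algebra q)"
proof -
  have "Uq q \<times>\<times> Uq q = uq_algebra q \<times>\<times> uq_algebra q" by (simp add: DirProd_def Uq_simps)
  note eqs = tensor_ideal_def Uq_simps this
  show "tensor_algebra (Uq q) (Uq q) = tensor_algebra (uq_algebra q) (uq_algebra q)"
    by (simp only: tensor_algebra_def eqs)
  show "pure_tensor (Uq q) (Uq q) = pure_tensor (uq_algebra q) (uq_algebra q)"
    by (rule ext)+ (simp only: pure_tensor_def eqs)
qed

section \<open>Coordinates on the quantum plane\<close>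

text \<open>
  Elements of the quantum plane are compared through their coordinates with respect to the ordered
  monomials: \<open>mon (m, n)\<close> stands for \<open>x\<^sup>m y\<^sup>n\<close>, and \<open>qm\<close> for the product
  \<open>x\<^sup>m y\<^sup>n \<cdot> x\<^sup>a y\<^sup>b = q\<^sup>n\<^sup>a x\<^sup>m\<^sup>+\<^sup>a y\<^sup>n\<^sup>+\<^sup>b\<close>, extended bilinearly.  Working on a type whose carrier is everything
  frees the later computations from side conditions.
\<close>

type_synonym qpoly = "(nat \<times> nat) \<Rightarrow>\<^sub>0 complex"

abbreviation lookup :: "qpoly \<Rightarrow> nat \<times> nat \<Rightarrow> complex" where "lookup \<equiv> Poly_Mapping.lookup"
abbreviation keys :: "qpoly \<Rightarrow> (nat \<times> nat) set" where "keys \<equiv> Poly_Mapping.keys"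

definition scl :: "complex \<Rightarrow> qpoly \<Rightarrow> qpoly" where
  "scl c p = Poly_Mapping.map ((*) c) p"

abbreviation mon :: "nat \<times> nat \<Rightarrow> qpoly" where
  "mon i \<equiv> Poly_Mapping.single i 1"

lemma lookup_scl [simp]: "lookup (scl c p) i = c * lookup p i"
  by (simp add: scl_def Poly_Mapping.map.rep_eq when_def)

lemma lookup_mon: "lookup (mon i) j = (if i = j then 1 else 0)"
  by (simp add: lookup_single when_def)

lemma scl_simps [simp]: "scl 1 p = p" "scl 0 p = 0" "scl c 0 = 0" "scl c (scl d p) = scl (c * d) p"
  by (rule poly_mapping_eqI; simp)+

lemma scl_add_right: "scl c (p + r) = scl c p + scl c r"
  by (rule poly_mapping_eqI) (simp add: lookup_add algebra_simps)

lemma scl_add_left: "scl (c + d) p = scl c p + scl d p"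
  by (rule poly_mapping_eqI) (simp add: lookup_add algebra_simps)

lemma scl_minus_one: "scl (- 1) p = - p"
  by (rule poly_mapping_eqI) simp

lemma scl_diff_right: "scl c (p - r) = scl c p - scl c r"
  by (rule poly_mapping_eqI) (simp add: lookup_minus algebra_simps)

lemma scl_sum: "scl c (sum g S) = (\<Sum>i\<in>S. scl c (g i))"
  by (induction S rule: infinite_finite_induct) (simp_all add: scl_add_right)

definition lin :: "(qpoly \<Rightarrow> qpoly) \<Rightarrow> bool" where
  "lin f \<longleftrightarrow> (\<forall>p r. f (p + r) = f p + f r) \<and> (\<forall>c p. f (scl c p) = scl c (f p))"

lemma linD: "lin f \<Longrightarrow> f (p + r) = f p + f r" "lin f \<Longrightarrow> f (scl c p) = scl c (f p)"
  by (simp_all add: lin_def)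

lemma lin_zero: "lin f \<Longrightarrow> f 0 = 0"
  by (metis linD(2) scl_simps(2))

lemma lin_diff: "lin f \<Longrightarrow> f (p - r) = f p - f r"
  using linD(1)[of f "p - r" r] by (simp add: eq_diff_eq)

lemma lin_sum: "lin f \<Longrightarrow> f (sum g S) = (\<Sum>i\<in>S. f (g i))"
  by (induction S rule: infinite_finite_induct) (simp_all add: lin_zero linD)

lemma mon_expand: "p = (\<Sum>i\<in>keys p. scl (lookup p i) (mon i))"
  by (rule poly_mapping_eqI) (simp add: lookup_sum lookup_mon in_keys_iff if_distrib[of "(*) _"] cong: if_cong)

lemma lin_eqI:
  assumes "lin f" "lin g" "\<And>i. f (mon i) = g (mon i)"
  shows "f p = g p"
proof -
  have "f (\<Sum>i\<in>keys p. scl (lookup p i) (mon i)) = g (\<Sum>i\<in>keys p. scl (lookup p i) (mon i))"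
    using assms by (simp add: lin_sum linD)
  then show ?thesis using mon_expand[of p] by simp
qed

definition lext :: "(nat \<times> nat \<Rightarrow> qpoly) \<Rightarrow> qpoly \<Rightarrow> qpoly" where
  "lext \<phi> p = (\<Sum>i\<in>keys p. scl (lookup p i) (\<phi> i))"

lemma lext_superset: "finite S \<Longrightarrow> keys p \<subseteq> S \<Longrightarrow> lext \<phi> p = (\<Sum>i\<in>S. scl (lookup p i) (\<phi> i))"
  unfolding lext_def by (rule sum.mono_neutral_left) (auto simp: in_keys_iff)

lemma lext_mon [simp]: "lext \<phi> (mon i) = \<phi> i"
  by (simp add: lext_def)

lemma lin_lext: "lin (lext \<phi>)"
proof (unfold lin_def, intro conjI allI)
  fix p r
  let ?S = "keys p \<union> keys r"
  have "lext \<phi> (p + r) = (\<Sum>i\<in>?S. scl (lookup (p + r) i) (\<phi> i))"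
    using keys_add[of p r] by (intro lext_superset) auto
  then show "lext \<phi> (p + r) = lext \<phi> p + lext \<phi> r"
    by (simp add: lext_superset[of ?S] lookup_add scl_add_left sum.distrib)
next
  fix c p
  have "lext \<phi> (scl c p) = (\<Sum>i\<in>keys p. scl (lookup (scl c p) i) (\<phi> i))"
    by (rule lext_superset) (auto simp: in_keys_iff)
  then show "lext \<phi> (scl c p) = scl c (lext \<phi> p)"
    by (simp add: lext_def scl_sum)
qed

lemma lin_lext_arg:
  assumes "\<And>i. lin (\<lambda>r. \<phi> r i)"
  shows "lin (\<lambda>r. lext (\<phi> r) p)"
  using assms by (auto simp: lin_def lext_def scl_add_right sum.distrib scl_sum mult.commute)

lemma lin_id: "lin (\<lambda>p. p)" and lin_scl: "lin f \<Longrightarrow> lin (\<lambda>p. scl c (f p))"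
  and lin_comp: "lin f \<Longrightarrow> lin g \<Longrightarrow> lin (\<lambda>p. f (g p))"
  and lin_add: "lin f \<Longrightarrow> lin g \<Longrightarrow> lin (\<lambda>p. f p + g p)"
  and lin_minus: "lin f \<Longrightarrow> lin g \<Longrightarrow> lin (\<lambda>p. f p - g p)"
  by (auto simp: lin_def scl_add_right scl_diff_right mult.commute add_ac)

definition qm :: "complex \<Rightarrow> qpoly \<Rightarrow> qpoly \<Rightarrow> qpoly" where
  "qm q p r = lext (\<lambda>i. lext (\<lambda>j. scl (q ^ (snd i * fst j)) (mon (fst i + fst j, snd i + snd j))) r) p"

lemma qm_mon: "qm q (mon (m, n)) (mon (a, b)) = scl (q ^ (n * a)) (mon (m + a, n + b))"
  by (simp add: qm_def)

lemma lin_qm: "lin (\<lambda>p. qm q p r)" "lin (\<lambda>r. qm q p r)"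
  unfolding qm_def by (rule lin_lext, rule lin_lext_arg, rule lin_lext)

lemmas qm_simps = linD[OF lin_qm(1)] linD[OF lin_qm(2)] lin_zero[OF lin_qm(1)] lin_zero[OF lin_qm(2)]
  lin_diff[OF lin_qm(1)] lin_diff[OF lin_qm(2)]

lemma qm_eqI:
  assumes "\<And>p. lin (\<lambda>r. f p r)" "\<And>r. lin (\<lambda>p. f p r)" "\<And>p. lin (\<lambda>r. g p r)" "\<And>r. lin (\<lambda>p. g p r)"
    "\<And>i j. f (mon i) (mon j) = g (mon i) (mon j)"
  shows "f p r = g p r"
proof (rule lin_eqI[of "\<lambda>p. f p r" "\<lambda>p. g p r"])
  fix i show "f (mon i) r = g (mon i) r"
    by (rule lin_eqI[of "\<lambda>r. f (mon i) r" "\<lambda>r. g (mon i) r"]) (use assms in auto)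
qed (use assms in auto)

lemma qm_assoc: "qm q (qm q p r) s = qm q p (qm q r s)"
proof (rule lin_eqI[of "\<lambda>s. qm q (qm q p r) s" "\<lambda>s. qm q p (qm q r s)"])
  fix k
  show "qm q (qm q p r) (mon k) = qm q p (qm q r (mon k))"
  proof (rule qm_eqI[of "\<lambda>p r. qm q (qm q p r) (mon k)" "\<lambda>p r. qm q p (qm q r (mon k))"])
    fix i j
    show "qm q (qm q (mon i) (mon j)) (mon k) = qm q (mon i) (qm q (mon j) (mon k))"
      by (cases i; cases j; cases k)
        (simp add: qm_mon qm_simps power_add[symmetric] algebra_simps)
  qed (intro lin_comp[OF lin_qm(1)] lin_comp[OF lin_qm(2)] lin_qm)+
qed (intro lin_comp[OF lin_qm(1)] lin_comp[OF lin_qm(2)] lin_qm)+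

lemma qm_one: "qm q (mon (0, 0)) p = p" "qm q p (mon (0, 0)) = p"
proof -
  show "qm q (mon (0, 0)) p = p"
    by (rule lin_eqI[OF lin_qm(2) lin_id]) (auto simp: qm_mon)
  show "qm q p (mon (0, 0)) = p"
    by (rule lin_eqI[OF lin_qm(1) lin_id]) (auto simp: qm_mon)
qed

definition QM :: "complex \<Rightarrow> (complex, qpoly) module" where
  "QM q = \<lparr>carrier = UNIV, mult = qm q, one = mon (0, 0), zero = 0, add = (+), smult = scl\<rparr>"

lemma QM_simps [simp]: "p \<in> carrier (QM q)" "p \<otimes>\<^bsub>QM q\<^esub> r = qm q p r" "p \<oplus>\<^bsub>QM q\<^esub> r = p + r"
   "c \<odot>\<^bsub>QM q\<^esub> p = scl c p" "\<one>\<^bsub>QM q\<^esub> = mon (0, 0)" "\<zero>\<^bsub>QM q\<^esub> = 0"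
  by (simp_all add: QM_def)

lemma QM_calg: "calg (QM q)"
proof (intro calg.intro calg_axioms.intro ringI)
  show "abelian_group (QM q)"
  proof (rule abelian_groupI)
    fix p assume "p \<in> carrier (QM q)"
    show "\<exists>r\<in>carrier (QM q). r \<oplus>\<^bsub>QM q\<^esub> p = \<zero>\<^bsub>QM q\<^esub>"
      by (rule bexI[of _ "- p"]) simp_all
  qed (simp_all add: add_ac)
  show "monoid (QM q)" by (rule monoidI) (simp_all add: qm_assoc qm_one)
qed (simp_all add: qm_simps scl_add_left scl_add_right)

interpretation QM: calg "QM q" for q by (rule QM_calg)

definition qcoord :: "complex \<Rightarrow> qp \<Rightarrow> qpoly" where
  "qcoord q = presented_lift (QM q) (case_qp_gen (mon (1, 0)) (mon (0, 1)))"

lemma qcoord_hom: "qcoord q \<in> alg_hom (qplane q) (QM q)"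
  and qcoord_gen: "qcoord q (qp_x q) = mon (1, 0)" "qcoord q (qp_y q) = mon (0, 1)"
  unfolding qcoord_def using qp_lift[OF QM.calg_axioms, of "mon (1, 0)" q "mon (0, 1)"]
  by (simp_all add: qm_mon)

lemmas qcoord_simps = alg_homD(2-5)[OF qcoord_hom, simplified] qcoord_gen
  alg_hom_zero_minus(1)[OF qcoord_hom Q.calg_axioms QM.calg_axioms, simplified]

lemma qp_monom_closed [simp]: "qp_monom q m n \<in> carrier (qplane q)"
  by (simp add: qp_monom_def)

lemma qcoord_monom: "qcoord q (qp_monom q m n) = mon (m, n)"
proof -
  have x: "qcoord q (qp_x q [^]\<^bsub>qplane q\<^esub> m) = mon (m, 0)" for m :: nat
    by (induction m) (simp_all add: qcoord_simps qm_mon)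
  have y: "qcoord q (qp_y q [^]\<^bsub>qplane q\<^esub> n) = mon (0, n)" for n :: nat
    by (induction n) (simp_all add: qcoord_simps qm_mon)
  show ?thesis by (simp add: qp_monom_def qcoord_simps x y qm_mon)
qed

text \<open>
  A coordinate vector is a finitely supported function on this monoid, so that \<^const>\<open>lin_ext\<close>
  extends \<open>(m, n) \<mapsto> x\<^sup>m y\<^sup>n\<close> to a linear map inverse to \<open>qcoord\<close>.
\<close>

abbreviation exponents :: "(nat \<times> nat) monoid" where
  "exponents \<equiv> \<lparr>carrier = UNIV, mult = (\<lambda>i j. (fst i + fst j, snd i + snd j)), one = (0, 0)\<rparr>"

lemma exponents_monoid: "monoid exponents"
  by (rule monoidI) auto

definition qelem :: "complex \<Rightarrow> qpoly \<Rightarrow> qp" where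
  "qelem q p = lin_ext (qplane q) (\<lambda>(m, n). qp_monom q m n) (lookup p)"

interpretation qext: monoid_to_calg exponents "qplane q" "\<lambda>(m, n). qp_monom q m n" for q
  by (intro monoid_to_calg.intro exponents_monoid Q.calg_axioms monoid_to_calg_axioms.intro)
    auto

lemma lookup_carrier: "lookup p \<in> carrier (monoid_algebra exponents)"
  by (simp add: monoid.MA_carrier[OF exponents_monoid])

lemma qelem_closed [simp]: "qelem q p \<in> carrier (qplane q)"
  unfolding qelem_def by (rule qext.lin_ext_closed[OF lookup_carrier])

lemma qelem_add: "qelem q (p + r) = qelem q p \<oplus>\<^bsub>qplane q\<^esub> qelem q r"
proof -
  have "lookup (p + r) = lookup p \<oplus>\<^bsub>monoid_algebra exponents\<^esub> lookup r"
    by (simp add: monoid.MA_simps[OF exponents_monoid] lookup_add fun_eq_iff)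
  then show ?thesis unfolding qelem_def by (simp add: qext.lin_ext_add lookup_carrier)
qed

lemma qelem_scl: "qelem q (scl c p) = c \<odot>\<^bsub>qplane q\<^esub> qelem q p"
proof -
  have "lookup (scl c p) = c \<odot>\<^bsub>monoid_algebra exponents\<^esub> lookup p"
    by (simp add: monoid.MA_simps[OF exponents_monoid] fun_eq_iff)
  then show ?thesis unfolding qelem_def by (simp add: qext.lin_ext_smult lookup_carrier)
qed

lemma qelem_mon: "qelem q (mon (m, n)) = qp_monom q m n"
proof -
  have "lookup (mon (m, n)) = single (m, n)" by (auto simp: single_def lookup_mon)
  then show ?thesis unfolding qelem_def by (simp add: qext.lin_ext_single)
qed

lemma qelem_zero: "qelem q 0 = \<zero>\<^bsub>qplane q\<^esub>"
  using qelem_scl[of q 0 0] by simp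

lemma qpoly_induct [case_names zero add_mon]:
  assumes "P 0" "\<And>p c i. P p \<Longrightarrow> P (p + scl c (mon i))"
  shows "P p"
proof -
  have "finite S \<Longrightarrow> P (\<Sum>i\<in>S. scl (lookup p i) (mon i))" for S
    by (induction S rule: finite_induct) (auto simp: assms add.commute[of _ "sum _ _"])
  then show ?thesis using mon_expand[of p] by (metis finite_keys)
qed

lemma qcoord_qelem [simp]: "qcoord q (qelem q p) = p"
proof (induction p rule: qpoly_induct)
  case zero
  show ?case by (simp add: qelem_zero qcoord_simps)
next
  case (add_mon p c i)
  then show ?case
    by (cases i) (simp add: qelem_add qelem_scl qelem_mon qcoord_simps qcoord_monom)
qed

lemma qelem_x_mult: "qelem q (qm q (mon (1, 0)) p) = qp_x q \<otimes>\<^bsub>qplane q\<^esub> qelem q p"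
proof (induction p rule: qpoly_induct)
  case zero
  show ?case by (simp add: qm_simps qelem_zero)
next
  case (add_mon p c i)
  obtain m n where i: "i = (m, n)" by (cases i)
  have "qelem q (mon (Suc m, n)) = qp_x q \<otimes>\<^bsub>qplane q\<^esub> qelem q (mon (m, n))"
  proof -
    have "qp_x q [^]\<^bsub>qplane q\<^esub> Suc m = qp_x q \<otimes>\<^bsub>qplane q\<^esub> qp_x q [^]\<^bsub>qplane q\<^esub> m"
      by (rule Q.nat_pow_Suc2) simp
    then show ?thesis
      by (simp only: qelem_mon qp_monom_def) (simp add: Q.m_assoc)
  qed
  then show ?case using add_mon
    by (simp add: qm_simps qelem_add qelem_scl i qm_mon Q.r_distr Q.smult_mult_right)
qed

lemma qp_y_x_pow: "qp_y q \<otimes>\<^bsub>qplane q\<^esub> qp_x q [^]\<^bsub>qplane q\<^esub> m =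
    q ^ m \<odot>\<^bsub>qplane q\<^esub> (qp_x q [^]\<^bsub>qplane q\<^esub> m \<otimes>\<^bsub>qplane q\<^esub> qp_y q)" for m :: nat
proof (induction m)
  case (Suc m)
  have "qp_y q \<otimes>\<^bsub>qplane q\<^esub> qp_x q [^]\<^bsub>qplane q\<^esub> Suc m =
      (qp_y q \<otimes>\<^bsub>qplane q\<^esub> qp_x q [^]\<^bsub>qplane q\<^esub> m) \<otimes>\<^bsub>qplane q\<^esub> qp_x q"
    by (simp add: Q.m_assoc)
  also have "\<dots> = q ^ m \<odot>\<^bsub>qplane q\<^esub> (qp_x q [^]\<^bsub>qplane q\<^esub> m \<otimes>\<^bsub>qplane q\<^esub> (qp_y q \<otimes>\<^bsub>qplane q\<^esub> qp_x q))"
    by (simp only: Suc) (simp add: Q.smult_mult_left Q.m_assoc)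
  also have "\<dots> = q ^ Suc m \<odot>\<^bsub>qplane q\<^esub> (qp_x q [^]\<^bsub>qplane q\<^esub> Suc m \<otimes>\<^bsub>qplane q\<^esub> qp_y q)"
    by (simp add: qp_yx Q.smult_mult_right Q.smult_smult Q.m_assoc mult.commute)
  finally show ?case .
qed simp

text \<open>
  Together with \<open>qelem_x_mult\<close> this says that the ordered monomials span a left ideal containing
  \<open>1\<close>, hence everything; they are independent by \<open>qcoord_qelem\<close>.
\<close>

lemma qelem_y_mult: "qelem q (qm q (mon (0, 1)) p) = qp_y q \<otimes>\<^bsub>qplane q\<^esub> qelem q p"
proof (induction p rule: qpoly_induct)
  case zero
  show ?case by (simp add: qm_simps qelem_zero)
next
  case (add_mon p c i)
  obtain m n where i: "i = (m, n)" by (cases i)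
  have "qp_y q \<otimes>\<^bsub>qplane q\<^esub> qelem q (mon (m, n)) = q ^ m \<odot>\<^bsub>qplane q\<^esub> qelem q (mon (m, Suc n))"
  proof -
    have "qp_y q [^]\<^bsub>qplane q\<^esub> Suc n = qp_y q \<otimes>\<^bsub>qplane q\<^esub> qp_y q [^]\<^bsub>qplane q\<^esub> n"
      by (rule Q.nat_pow_Suc2) simp
    then show ?thesis
      by (simp only: qelem_mon qp_monom_def)
        (simp add: Q.m_assoc[symmetric] qp_y_x_pow Q.smult_mult_left)
  qed
  then show ?case using add_mon
    by (simp add: qm_simps qelem_add qelem_scl i qm_mon Q.r_distr Q.smult_mult_right Q.smult_smult)
qed

lemma qelem_qcoord [simp]: "a \<in> carrier (qplane q) \<Longrightarrow> qelem q (qcoord q a) = a"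
proof (induction a rule: qp_induct)
  case one
  show ?case by (simp add: qcoord_simps qelem_mon qp_monom_def)
qed (simp_all add: qcoord_simps qelem_add qelem_scl qelem_x_mult[simplified] qelem_y_mult[simplified])

lemma qcoord_inject: "a \<in> carrier (qplane q) \<Longrightarrow> b \<in> carrier (qplane q) \<Longrightarrow> qcoord q a = qcoord q b \<Longrightarrow> a = b"
  by (metis qelem_qcoord)

lemma qelem_mult: "qelem q (qm q p r) = qelem q p \<otimes>\<^bsub>qplane q\<^esub> qelem q r"
  by (rule qcoord_inject[where q=q]) (simp_all add: qcoord_simps)

lemma lin_span_monom:
  "a \<in> lin_span (qplane q) {qp_monom q m n | m n. R m n} \<longleftrightarrow>
    a \<in> carrier (qplane q) \<and> (\<forall>(m, n)\<in>keys (qcoord q a). R m n)"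
proof
  assume "a \<in> lin_span (qplane q) {qp_monom q m n | m n. R m n}"
  then obtain T c where T: "finite T" "T \<subseteq> {qp_monom q m n | m n. R m n}"
    "a = (\<Oplus>\<^bsub>qplane q\<^esub> v\<in>T. c v \<odot>\<^bsub>qplane q\<^esub> v)" unfolding lin_span_def by blast
  from T(1,2) show "a \<in> carrier (qplane q) \<and> (\<forall>(m, n)\<in>keys (qcoord q a). R m n)"
    unfolding T(3)
  proof (induction T rule: finite_induct)
    case empty
    then show ?case by (simp add: qcoord_simps)
  next
    case (insert v T)
    let ?s = "\<Oplus>\<^bsub>qplane q\<^esub> v\<in>T. c v \<odot>\<^bsub>qplane q\<^esub> v"
    obtain m n where v: "v = qp_monom q m n" "R m n" using insert.prems by auto
    have cl: "(\<lambda>v. c v \<odot>\<^bsub>qplane q\<^esub> v) \<in> T \<rightarrow> carrier (qplane q)" using insert.prems by auto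
    have "?s \<in> carrier (qplane q) \<and> (\<forall>(m, n)\<in>keys (qcoord q ?s). R m n)"
      using insert.prems by (intro insert.IH) simp
    then have s: "?s \<in> carrier (qplane q)" "\<forall>(m, n)\<in>keys (qcoord q ?s). R m n" by blast+
    have "(\<Oplus>\<^bsub>qplane q\<^esub> v\<in>insert v T. c v \<odot>\<^bsub>qplane q\<^esub> v) = c v \<odot>\<^bsub>qplane q\<^esub> v \<oplus>\<^bsub>qplane q\<^esub> ?s"
      using insert.hyps cl v by (simp add: Q.finsum_insert)
    moreover have "keys (qcoord q (c v \<odot>\<^bsub>qplane q\<^esub> v \<oplus>\<^bsub>qplane q\<^esub> ?s)) \<subseteq> insert (m, n) (keys (qcoord q ?s))"
    proof
      fix j assume "j \<in> keys (qcoord q (c v \<odot>\<^bsub>qplane q\<^esub> v \<oplus>\<^bsub>qplane q\<^esub> ?s))"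
      then show "j \<in> insert (m, n) (keys (qcoord q ?s))"
        using s(1) v(1) by (cases "j = (m, n)")
          (simp_all add: qcoord_simps qcoord_monom in_keys_iff lookup_add lookup_mon)
    qed
    moreover have "c v \<odot>\<^bsub>qplane q\<^esub> v \<oplus>\<^bsub>qplane q\<^esub> ?s \<in> carrier (qplane q)" using s v by simp
    ultimately show ?case using s(2) v(2) by (metis (no_types, lifting) case_prodI insertE subsetD)
  qed
next
  assume a: "a \<in> carrier (qplane q) \<and> (\<forall>(m, n)\<in>keys (qcoord q a). R m n)"
  define p where "p = qcoord q a"
  define M where "M = (\<lambda>(m, n). qp_monom q m n)"
  have inj: "inj M"
  proof (rule injI)
    fix i j assume "M i = M j"
    then have "qcoord q (M i) = qcoord q (M j)" by simp
    then have "mon i = mon j" by (cases i, cases j) (simp only: M_def case_prod_conv qcoord_monom)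
    then have "lookup (mon i) j = 1" by (simp only: lookup_mon simp_thms if_True)
    then show "i = j" unfolding lookup_mon by (simp split: if_splits)
  qed
  have Mc: "M i \<in> carrier (qplane q)" for i by (auto simp: M_def split: prod.splits)
  have "a = qelem q p" using a by (simp add: p_def)
  also have "\<dots> = (\<Oplus>\<^bsub>qplane q\<^esub> i\<in>keys p. lookup p i \<odot>\<^bsub>qplane q\<^esub> M i)"
  proof -
    have "{i. lookup p i \<noteq> 0} = keys p" by (auto simp: in_keys_iff)
    then show ?thesis unfolding qelem_def lin_ext_def M_def by simp
  qed
  also have "\<dots> = (\<Oplus>\<^bsub>qplane q\<^esub> v\<in>M ` keys p. lookup p (inv_into UNIV M v) \<odot>\<^bsub>qplane q\<^esub> v)"
  proof -
    have "inj_on M (keys p)" using inj by (rule inj_on_subset) simp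
    moreover have "(\<lambda>v. lookup p (inv_into UNIV M v) \<odot>\<^bsub>qplane q\<^esub> v) \<in> M ` keys p \<rightarrow> carrier (qplane q)"
      using Mc by blast
    ultimately show ?thesis using inj by (simp only: Q.finsum_reindex inv_f_f)
  qed
  finally have "a = (\<Oplus>\<^bsub>qplane q\<^esub> v\<in>M ` keys p. lookup p (inv_into UNIV M v) \<odot>\<^bsub>qplane q\<^esub> v)" .
  moreover have "finite (M ` keys p)" by simp
  moreover have "M ` keys p \<subseteq> {qp_monom q m n | m n. R m n}"
  proof
    fix v assume "v \<in> M ` keys p"
    then obtain m n where "(m, n) \<in> keys p" and "v = qp_monom q m n" by (auto simp: M_def)
    moreover from this have "R m n" using a by (auto simp: p_def)
    ultimately show "v \<in> {qp_monom q m n | m n. R m n}" by blast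
  qed
  ultimately show "a \<in> lin_span (qplane q) {qp_monom q m n | m n. R m n}"
    unfolding lin_span_def mem_Collect_eq by (intro exI conjI)
qed

definition hcomp :: "nat \<Rightarrow> qpoly \<Rightarrow> qpoly" where
  "hcomp d = lext (\<lambda>j. if fst j + snd j = d then mon j else 0)"

lemma lookup_hcomp: "lookup (hcomp d p) j = (if fst j + snd j = d then lookup p j else 0)"
proof (induction p rule: qpoly_induct)
  case zero
  show ?case by (simp add: hcomp_def lin_zero[OF lin_lext])
next
  case (add_mon p c i)
  then show ?case by (auto simp: hcomp_def linD[OF lin_lext] lookup_add lookup_mon)
qed

lemma qp_component_iff:
  "r \<in> qp_component q d \<longleftrightarrow> r \<in> carrier (qplane q) \<and> (\<forall>(m, n)\<in>keys (qcoord q r). m + n = d)"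
  unfolding qp_component_def by (rule lin_span_monom)

text \<open>
  The description in the definition of the projection determines it uniquely, because a monomial
  cannot occur both in degree \<open>d\<close> and in another degree.
\<close>

lemma qp_proj_eq:
  assumes a: "a \<in> carrier (qplane q)"
  shows "qp_proj q d a = qelem q (hcomp d (qcoord q a))"
  unfolding qp_proj_def
proof (rule the_equality)
  define s where "s = qelem q (qcoord q a - hcomp d (qcoord q a))"
  have "qelem q (hcomp d (qcoord q a)) \<in> qp_component q d"
    unfolding qp_component_iff by (auto simp: in_keys_iff lookup_hcomp split: if_splits)
  moreover have "s \<in> lin_span (qplane q) {qp_monom q m n | m n. m + n \<noteq> d}"
    unfolding lin_span_monom by (auto simp: s_def in_keys_iff lookup_hcomp lookup_minus)
  moreover have "a = qelem q (hcomp d (qcoord q a)) \<oplus>\<^bsub>qplane q\<^esub> s"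
    using a by (simp add: s_def qelem_add[symmetric])
  ultimately show "qelem q (hcomp d (qcoord q a)) \<in> qp_component q d \<and>
    (\<exists>s\<in>lin_span (qplane q) {qp_monom q m n | m n. m + n \<noteq> d}.
      a = qelem q (hcomp d (qcoord q a)) \<oplus>\<^bsub>qplane q\<^esub> s)" by (intro conjI bexI)
next
  fix r assume r': "r \<in> qp_component q d \<and>
    (\<exists>s\<in>lin_span (qplane q) {qp_monom q m n | m n. m + n \<noteq> d}. a = r \<oplus>\<^bsub>qplane q\<^esub> s)"
  then obtain s where s': "s \<in> lin_span (qplane q) {qp_monom q m n | m n. m + n \<noteq> d}"
    and as: "a = r \<oplus>\<^bsub>qplane q\<^esub> s" by (elim conjE bexE)
  note r = r'[THEN conjunct1, unfolded qp_component_iff] and s = s'[unfolded lin_span_monom]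
  have "lookup (hcomp d (qcoord q a)) (m, n) = lookup (qcoord q r) (m, n)" for m n
  proof (cases "m + n = d")
    case True
    then have "lookup (qcoord q s) (m, n) = 0" using s by (auto simp: in_keys_iff)
    then show ?thesis using True r s by (simp add: as qcoord_simps lookup_hcomp lookup_add)
  next
    case False
    then have "lookup (qcoord q r) (m, n) = 0" using r by (auto simp: in_keys_iff)
    then show ?thesis using False by (simp add: lookup_hcomp)
  qed
  then have "hcomp d (qcoord q a) = qcoord q r"
    by (intro poly_mapping_eqI) (metis surj_pair)
  then show "r = qelem q (hcomp d (qcoord q a))" using r by simp
qed

lemma qp_proj_zero_iff:
  assumes "a \<in> carrier (qplane q)"
  shows "qp_proj q d a = \<zero>\<^bsub>qplane q\<^esub> \<longleftrightarrow> (\<forall>m n. m + n = d \<longrightarrow> lookup (qcoord q a) (m, n) = 0)"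
proof -
  have "qp_proj q d a = \<zero>\<^bsub>qplane q\<^esub> \<longleftrightarrow> hcomp d (qcoord q a) = 0"
    unfolding qp_proj_eq[OF assms] by (metis qcoord_qelem qelem_zero)
  also have "\<dots> \<longleftrightarrow> (\<forall>m n. m + n = d \<longrightarrow> lookup (qcoord q a) (m, n) = 0)"
    by (auto simp: poly_mapping_eq_iff fun_eq_iff lookup_hcomp)
  finally show ?thesis .
qed

section \<open>Module algebra structures as triples of operators\<close>

text \<open>
  The actions of \<open>k\<close>, \<open>k\<^sup>-\<^sup>1\<close>, \<open>e\<close> and \<open>f\<close> in coordinates: the defining relations, then the rules on
  products dictated by the comultiplication, then the values at \<open>1\<close> dictated by the counit.
\<close>

definition qstruct where
  "qstruct q K K' E F \<longleftrightarrow> lin K \<and> lin K' \<and> lin E \<and> lin F \<and>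
     (\<forall>p. K' (K p) = p) \<and> (\<forall>p. K (K' p) = p) \<and>
     (\<forall>p. K (E p) = scl (q\<^sup>2) (E (K p))) \<and>
     (\<forall>p. K (F p) = scl (inverse (q\<^sup>2)) (F (K p))) \<and>
     (\<forall>p. E (F p) - F (E p) = scl (1 / (q - inverse q)) (K p - K' p)) \<and>
     (\<forall>p r. K (qm q p r) = qm q (K p) (K r)) \<and>
     (\<forall>p r. K' (qm q p r) = qm q (K' p) (K' r)) \<and>
     (\<forall>p r. E (qm q p r) = qm q p (E r) + qm q (E p) (K r)) \<and>
     (\<forall>p r. F (qm q p r) = qm q (F p) r + qm q (K' p) (F r)) \<and>
     K (mon (0, 0)) = mon (0, 0) \<and> K' (mon (0, 0)) = mon (0, 0) \<and>
     E (mon (0, 0)) = 0 \<and> F (mon (0, 0)) = 0"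

definition op_of :: "complex \<Rightarrow> (uq \<Rightarrow> qp \<Rightarrow> qp) \<Rightarrow> uq \<Rightarrow> qpoly \<Rightarrow> qpoly" where
  "op_of q \<pi> u p = qcoord q (\<pi> u (qelem q p))"

interpretation LQ: calg "lin_end (qplane q)" for q
  by (rule Q.lin_end_calg)

lemma structureD:
  fixes n :: nat
  assumes "\<pi> \<in> uq_structures q"
  shows "\<pi> \<in> alg_hom (uq_algebra q) (lin_end (qplane q))"
    and "\<pi> \<in> extensional (carrier (uq_algebra q))"
    and "u \<in> carrier (uq_algebra q) \<Longrightarrow> \<pi> u \<in> carrier (lin_end (qplane q))"
    and "u \<in> carrier (uq_algebra q) \<Longrightarrow> \<pi> u \<one>\<^bsub>qplane q\<^esub> = uq_counit u \<odot>\<^bsub>qplane q\<^esub> \<one>\<^bsub>qplane q\<^esub>"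
    and "u \<in> carrier (uq_algebra q) \<Longrightarrow> a \<in> carrier (qplane q) \<Longrightarrow> b \<in> carrier (qplane q) \<Longrightarrow>
      (\<And>i. i < n \<Longrightarrow> h1 i \<in> carrier (uq_algebra q) \<and> h2 i \<in> carrier (uq_algebra q)) \<Longrightarrow>
      uq_comult q u = (\<Oplus>\<^bsub>tensor_algebra (uq_algebra q) (uq_algebra q)\<^esub> i\<in>{..<n}.
        pure_tensor (uq_algebra q) (uq_algebra q) (h1 i) (h2 i)) \<Longrightarrow>
      \<pi> u (a \<otimes>\<^bsub>qplane q\<^esub> b) = (\<Oplus>\<^bsub>qplane q\<^esub> i\<in>{..<n}. \<pi> (h1 i) a \<otimes>\<^bsub>qplane q\<^esub> \<pi> (h2 i) b)"
proof -
  note m = assms[unfolded uq_structures_def module_algebra_structures_def Uq_simps Uq_tensor Uq_alg_hom mem_Collect_eq]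
  note m1 = m[THEN conjunct1] and m2 = m[THEN conjunct2, THEN conjunct1] and m3 = m[THEN conjunct2, THEN conjunct2]
  show 1: "\<pi> \<in> alg_hom (uq_algebra q) (lin_end (qplane q))"
    and "\<pi> \<in> extensional (carrier (uq_algebra q))"
    using m1 by (simp_all only: Int_iff)
  show "u \<in> carrier (uq_algebra q) \<Longrightarrow> \<pi> u \<in> carrier (lin_end (qplane q))"
    by (rule alg_homD(1)[OF 1])
  show "u \<in> carrier (uq_algebra q) \<Longrightarrow> \<pi> u \<one>\<^bsub>qplane q\<^esub> = uq_counit u \<odot>\<^bsub>qplane q\<^esub> \<one>\<^bsub>qplane q\<^esub>"
    by (rule m3[rule_format])
  assume u: "u \<in> carrier (uq_algebra q)" "a \<in> carrier (qplane q)" "b \<in> carrier (qplane q)"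
    and h: "\<And>i. i < n \<Longrightarrow> h1 i \<in> carrier (uq_algebra q) \<and> h2 i \<in> carrier (uq_algebra q)"
    and c: "uq_comult q u = (\<Oplus>\<^bsub>tensor_algebra (uq_algebra q) (uq_algebra q)\<^esub> i\<in>{..<n}.
        pure_tensor (uq_algebra q) (uq_algebra q) (h1 i) (h2 i))"
  from h have h': "\<forall>i<n. h1 i \<in> carrier (uq_algebra q) \<and> h2 i \<in> carrier (uq_algebra q)" by simp
  show "\<pi> u (a \<otimes>\<^bsub>qplane q\<^esub> b) = (\<Oplus>\<^bsub>qplane q\<^esub> i\<in>{..<n}. \<pi> (h1 i) a \<otimes>\<^bsub>qplane q\<^esub> \<pi> (h2 i) b)"
    by (rule m2[THEN bspec, OF u(1), THEN bspec, OF u(2), THEN bspec, OF u(3),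
          THEN spec, THEN spec, THEN spec, THEN mp, OF h', THEN mp, OF c])
qed

lemma (in calg) finsum_lessThan_1: "g 0 \<in> carrier A \<Longrightarrow> finsum A g {..<1::nat} = g 0"
  by (simp add: lessThan_Suc)

lemma (in calg) finsum_lessThan_2:
  "g 0 \<in> carrier A \<Longrightarrow> g 1 \<in> carrier A \<Longrightarrow> finsum A g {..<2::nat} = g 0 \<oplus> g 1"
  by (simp add: numeral_2_eq_2 lessThan_Suc a_comm)

text \<open>
  The module algebra axiom is used for the decompositions of the comultiplication into one or two
  pure tensors that define it on the generators.
\<close>

lemma structure_leibniz:
  assumes q: "q \<noteq> 0" and \<pi>: "\<pi> \<in> uq_structures q"
    and a: "a \<in> carrier (qplane q)" and b: "b \<in> carrier (qplane q)"
  shows "\<pi> (uq_k q) (a \<otimes>\<^bsub>qplane q\<^esub> b) = \<pi> (uq_k q) a \<otimes>\<^bsub>qplane q\<^esub> \<pi> (uq_k q) b"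
    and "\<pi> (uq_kinv q) (a \<otimes>\<^bsub>qplane q\<^esub> b) = \<pi> (uq_kinv q) a \<otimes>\<^bsub>qplane q\<^esub> \<pi> (uq_kinv q) b"
    and "\<pi> (uq_e q) (a \<otimes>\<^bsub>qplane q\<^esub> b) =
      a \<otimes>\<^bsub>qplane q\<^esub> \<pi> (uq_e q) b \<oplus>\<^bsub>qplane q\<^esub> \<pi> (uq_e q) a \<otimes>\<^bsub>qplane q\<^esub> \<pi> (uq_k q) b"
    and "\<pi> (uq_f q) (a \<otimes>\<^bsub>qplane q\<^esub> b) =
      \<pi> (uq_f q) a \<otimes>\<^bsub>qplane q\<^esub> b \<oplus>\<^bsub>qplane q\<^esub> \<pi> (uq_kinv q) a \<otimes>\<^bsub>qplane q\<^esub> \<pi> (uq_f q) b"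
proof -
  note h = alg_homD[OF structureD(1)[OF \<pi>]]
  have cl: "u \<in> carrier (uq_algebra q) \<Longrightarrow> c \<in> carrier (qplane q) \<Longrightarrow> \<pi> u c \<in> carrier (qplane q)" for u c
    by (rule Q.lin_endD(2)[OF structureD(3)[OF \<pi>]])
  have one: "c \<in> carrier (qplane q) \<Longrightarrow> \<pi> \<one>\<^bsub>uq_algebra q\<^esub> c = c" for c
    by (simp add: h(5) Q.lin_end_apply)
  have two: "\<pi> u (a \<otimes>\<^bsub>qplane q\<^esub> b) =
      \<pi> u1 a \<otimes>\<^bsub>qplane q\<^esub> \<pi> v1 b \<oplus>\<^bsub>qplane q\<^esub> \<pi> u2 a \<otimes>\<^bsub>qplane q\<^esub> \<pi> v2 b"
    if "u \<in> carrier (uq_algebra q)" "u1 \<in> carrier (uq_algebra q)" "v1 \<in> carrier (uq_algebra q)"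
      "u2 \<in> carrier (uq_algebra q)" "v2 \<in> carrier (uq_algebra q)"
      "uq_comult q u = pure_tensor (uq_algebra q) (uq_algebra q) u1 v1
        \<oplus>\<^bsub>tensor_algebra (uq_algebra q) (uq_algebra q)\<^esub> pure_tensor (uq_algebra q) (uq_algebra q) u2 v2"
    for u u1 v1 u2 v2
  proof -
    define h1 h2 where "h1 = (\<lambda>i::nat. if i = 0 then u1 else u2)" and "h2 = (\<lambda>i::nat. if i = 0 then v1 else v2)"
    have hc: "h1 i \<in> carrier (uq_algebra q)" "h2 i \<in> carrier (uq_algebra q)" for i
      using that by (simp_all add: h1_def h2_def)
    have "uq_comult q u = (\<Oplus>\<^bsub>tensor_algebra (uq_algebra q) (uq_algebra q)\<^esub> i\<in>{..<2}.
        pure_tensor (uq_algebra q) (uq_algebra q) (h1 i) (h2 i))"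
      by (subst UU.TT.finsum_lessThan_2) (simp_all add: hc, simp add: that(6) h1_def h2_def)
    from structureD(5)[OF \<pi> that(1) a b _ this] hc
    have "\<pi> u (a \<otimes>\<^bsub>qplane q\<^esub> b) = (\<Oplus>\<^bsub>qplane q\<^esub> i\<in>{..<2}. \<pi> (h1 i) a \<otimes>\<^bsub>qplane q\<^esub> \<pi> (h2 i) b)" by blast
    also have "\<dots> = \<pi> (h1 0) a \<otimes>\<^bsub>qplane q\<^esub> \<pi> (h2 0) b \<oplus>\<^bsub>qplane q\<^esub> \<pi> (h1 1) a \<otimes>\<^bsub>qplane q\<^esub> \<pi> (h2 1) b"
      by (rule Q.finsum_lessThan_2) (simp_all add: hc cl a b)
    finally show ?thesis by (simp add: h1_def h2_def)
  qed
  have single: "\<pi> u (a \<otimes>\<^bsub>qplane q\<^esub> b) = \<pi> u a \<otimes>\<^bsub>qplane q\<^esub> \<pi> u b"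
    if u: "u \<in> carrier (uq_algebra q)" and
      c: "uq_comult q u = pure_tensor (uq_algebra q) (uq_algebra q) u u" for u
  proof -
    have "uq_comult q u = (\<Oplus>\<^bsub>tensor_algebra (uq_algebra q) (uq_algebra q)\<^esub> i\<in>{..<1::nat}.
        pure_tensor (uq_algebra q) (uq_algebra q) u u)"
      by (subst UU.TT.finsum_lessThan_1) (simp_all only: c u UU.pt_closed)
    from structureD(5)[OF \<pi> u a b _ this] u
    have "\<pi> u (a \<otimes>\<^bsub>qplane q\<^esub> b) = (\<Oplus>\<^bsub>qplane q\<^esub> i\<in>{..<1::nat}. \<pi> u a \<otimes>\<^bsub>qplane q\<^esub> \<pi> u b)" by blast
    also have "\<dots> = \<pi> u a \<otimes>\<^bsub>qplane q\<^esub> \<pi> u b"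
      by (rule Q.finsum_lessThan_1) (simp_all add: u cl a b)
    finally show ?thesis .
  qed
  note D = uq_comult_hom(2-5)[OF q]
  show "\<pi> (uq_k q) (a \<otimes>\<^bsub>qplane q\<^esub> b) = \<pi> (uq_k q) a \<otimes>\<^bsub>qplane q\<^esub> \<pi> (uq_k q) b"
    by (rule single[OF _ D(1)]) simp
  show "\<pi> (uq_kinv q) (a \<otimes>\<^bsub>qplane q\<^esub> b) = \<pi> (uq_kinv q) a \<otimes>\<^bsub>qplane q\<^esub> \<pi> (uq_kinv q) b"
    by (rule single[OF _ D(2)]) simp
  show "\<pi> (uq_e q) (a \<otimes>\<^bsub>qplane q\<^esub> b) =
      a \<otimes>\<^bsub>qplane q\<^esub> \<pi> (uq_e q) b \<oplus>\<^bsub>qplane q\<^esub> \<pi> (uq_e q) a \<otimes>\<^bsub>qplane q\<^esub> \<pi> (uq_k q) b"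
    using two[OF _ _ _ _ _ D(3)] a b by (simp add: one)
  show "\<pi> (uq_f q) (a \<otimes>\<^bsub>qplane q\<^esub> b) =
      \<pi> (uq_f q) a \<otimes>\<^bsub>qplane q\<^esub> b \<oplus>\<^bsub>qplane q\<^esub> \<pi> (uq_kinv q) a \<otimes>\<^bsub>qplane q\<^esub> \<pi> (uq_f q) b"
    using two[OF _ _ _ _ _ D(4)] a b by (simp add: one)
qed

lemma qcoord_minus: "a \<in> carrier (qplane q) \<Longrightarrow> b \<in> carrier (qplane q) \<Longrightarrow>
    qcoord q (a \<ominus>\<^bsub>qplane q\<^esub> b) = qcoord q a - qcoord q b"
  by (simp add: Q.minus_eq_smult qcoord_simps scl_minus_one)

lemma structure_qstruct:
  assumes q: "q \<noteq> 0" and \<pi>: "\<pi> \<in> uq_structures q"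
  shows "qstruct q (op_of q \<pi> (uq_k q)) (op_of q \<pi> (uq_kinv q)) (op_of q \<pi> (uq_e q)) (op_of q \<pi> (uq_f q))"
proof -
  note h = alg_homD[OF structureD(1)[OF \<pi>]]
  have cl: "u \<in> carrier (uq_algebra q) \<Longrightarrow> c \<in> carrier (qplane q) \<Longrightarrow> \<pi> u c \<in> carrier (qplane q)" for u c
    by (rule Q.lin_endD(2)[OF structureD(3)[OF \<pi>]])
  have le: "u \<in> carrier (uq_algebra q) \<Longrightarrow> \<pi> u \<in> carrier (lin_end (qplane q))" for u
    by (rule structureD(3)[OF \<pi>])
  have l: "lin (op_of q \<pi> u)" if "u \<in> carrier (uq_algebra q)" for u
    using that by (auto simp: lin_def op_of_def qelem_add qelem_scl Q.lin_endD[OF le] qcoord_simps cl)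
  have R: "uq_rel (lin_end (qplane q)) q (\<pi> (uq_k q)) (\<pi> (uq_kinv q)) (\<pi> (uq_e q)) (\<pi> (uq_f q))"
    by (rule uq_rel_hom[OF structureD(1)[OF \<pi>] Q.lin_end_calg])
  have app: "S = T \<Longrightarrow> S (qelem q p) = T (qelem q p)" for S T :: "qp \<Rightarrow> qp" and p by simp
  have minus: "S \<in> carrier (lin_end (qplane q)) \<Longrightarrow> T \<in> carrier (lin_end (qplane q)) \<Longrightarrow> a \<in> carrier (qplane q) \<Longrightarrow>
      (S \<ominus>\<^bsub>lin_end (qplane q)\<^esub> T) a = S a \<ominus>\<^bsub>qplane q\<^esub> T a" for S T a
    by (simp add: LQ.minus_eq_smult Q.minus_eq_smult Q.lin_end_apply Q.lin_endD)
  note r = R[unfolded uq_rel_def, THEN conjunct1] R[unfolded uq_rel_def, THEN conjunct2, THEN conjunct1]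
    R[unfolded uq_rel_def, THEN conjunct2, THEN conjunct2, THEN conjunct1]
    R[unfolded uq_rel_def, THEN conjunct2, THEN conjunct2, THEN conjunct2, THEN conjunct1]
    R[unfolded uq_rel_def, THEN conjunct2, THEN conjunct2, THEN conjunct2, THEN conjunct2]
  note rr = app[OF r(1)] app[OF r(2)] app[OF r(3)] app[OF r(4)] app[OF r(5)]
  have o: "qelem q (mon (0, 0)) = \<one>\<^bsub>qplane q\<^esub>" by (simp add: qelem_mon qp_monom_def)
  have "qcoord q (\<pi> (uq_kinv q) (\<pi> (uq_k q) (qelem q p))) = p"
    "qcoord q (\<pi> (uq_k q) (\<pi> (uq_kinv q) (qelem q p))) = p" for p
    using rr(1)[of p] rr(2)[of p] by (simp_all add: Q.lin_end_apply)
  moreover have "qcoord q (\<pi> (uq_k q) (\<pi> (uq_e q) (qelem q p))) = scl (q\<^sup>2) (qcoord q (\<pi> (uq_e q) (\<pi> (uq_k q) (qelem q p))))"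
    "qcoord q (\<pi> (uq_k q) (\<pi> (uq_f q) (qelem q p))) = scl (inverse (q\<^sup>2)) (qcoord q (\<pi> (uq_f q) (\<pi> (uq_k q) (qelem q p))))" for p
    using rr(3)[of p] rr(4)[of p] by (simp_all add: Q.lin_end_apply qcoord_simps cl)
  moreover have "qcoord q (\<pi> (uq_e q) (\<pi> (uq_f q) (qelem q p))) - qcoord q (\<pi> (uq_f q) (\<pi> (uq_e q) (qelem q p))) =
      scl (1 / (q - inverse q)) (qcoord q (\<pi> (uq_k q) (qelem q p)) - qcoord q (\<pi> (uq_kinv q) (qelem q p)))" for p
  proof -
    have "qcoord q ((\<pi> (uq_e q) \<otimes>\<^bsub>lin_end (qplane q)\<^esub> \<pi> (uq_f q) \<ominus>\<^bsub>lin_end (qplane q)\<^esub>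
        \<pi> (uq_f q) \<otimes>\<^bsub>lin_end (qplane q)\<^esub> \<pi> (uq_e q)) (qelem q p)) =
      qcoord q (((1 / (q - inverse q)) \<odot>\<^bsub>lin_end (qplane q)\<^esub> (\<pi> (uq_k q) \<ominus>\<^bsub>lin_end (qplane q)\<^esub> \<pi> (uq_kinv q))) (qelem q p))"
      by (simp only: r(5))
    then show ?thesis
      by (simp add: minus le Q.lin_end_closed Q.lin_end_apply qcoord_minus cl qcoord_simps Q.minus_closed)
  qed
  ultimately show ?thesis
    unfolding qstruct_def
    using structure_leibniz[OF q \<pi>]
    by (simp add: l) (simp add: op_of_def cl qelem_mult qcoord_simps o structureD(4)[OF \<pi>] uq_counit_hom(2-5)[where q=q])
qed

lemma structure_eqI:
  assumes \<pi>: "\<pi> \<in> uq_structures q" and \<pi>': "\<pi>' \<in> uq_structures q"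
    and "op_of q \<pi> (uq_k q) = op_of q \<pi>' (uq_k q)" "op_of q \<pi> (uq_kinv q) = op_of q \<pi>' (uq_kinv q)"
      "op_of q \<pi> (uq_e q) = op_of q \<pi>' (uq_e q)" "op_of q \<pi> (uq_f q) = op_of q \<pi>' (uq_f q)"
  shows "\<pi> = \<pi>'"
proof (rule extensionalityI[OF structureD(2)[OF \<pi>] structureD(2)[OF \<pi>']])
  have e: "\<pi> u = \<pi>' u" if u: "u \<in> carrier (uq_algebra q)" and o: "op_of q \<pi> u = op_of q \<pi>' u" for u
  proof (rule extensionalityI)
    show "\<pi> u \<in> extensional (carrier (qplane q))" "\<pi>' u \<in> extensional (carrier (qplane q))"
      using Q.lin_endD(1) structureD(3) \<pi> \<pi>' u by blast+
    fix a assume a: "a \<in> carrier (qplane q)"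
    have "op_of q \<pi> u (qcoord q a) = op_of q \<pi>' u (qcoord q a)" by (simp add: o)
    then have "qcoord q (\<pi> u a) = qcoord q (\<pi>' u a)" unfolding op_of_def using a by simp
    then show "\<pi> u a = \<pi>' u a"
      by (rule qcoord_inject[OF Q.lin_endD(2)[OF structureD(3)[OF \<pi> u] a]
            Q.lin_endD(2)[OF structureD(3)[OF \<pi>' u] a]])
  qed
  fix u assume u: "u \<in> carrier (uq_algebra q)"
  show "\<pi> u = \<pi>' u"
    by (rule uq_alg_hom_eq[OF structureD(1)[OF \<pi>] structureD(1)[OF \<pi>'] _ _ _ _ u])
      (simp_all add: e assms)
qed

definition lift_op :: "complex \<Rightarrow> (qpoly \<Rightarrow> qpoly) \<Rightarrow> qp \<Rightarrow> qp" where
  "lift_op q f = (\<lambda>a\<in>carrier (qplane q). qelem q (f (qcoord q a)))"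

lemma lift_op_apply: "a \<in> carrier (qplane q) \<Longrightarrow> lift_op q f a = qelem q (f (qcoord q a))"
  by (simp add: lift_op_def)

lemma lift_op_extensional: "lift_op q f \<in> extensional (carrier (qplane q))"
  by (simp add: lift_op_def)

lemma lift_op_closed: "lin f \<Longrightarrow> lift_op q f \<in> carrier (lin_end (qplane q))"
  unfolding Q.lin_end_carrier
  by (simp add: lift_op_def qcoord_simps linD qelem_add qelem_scl)

lemma lift_op_algebra:
  "lift_op q f \<otimes>\<^bsub>lin_end (qplane q)\<^esub> lift_op q g = lift_op q (\<lambda>p. f (g p))"
  "lift_op q f \<oplus>\<^bsub>lin_end (qplane q)\<^esub> lift_op q g = lift_op q (\<lambda>p. f p + g p)"
  "c \<odot>\<^bsub>lin_end (qplane q)\<^esub> lift_op q f = lift_op q (\<lambda>p. scl c (f p))"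
  "\<one>\<^bsub>lin_end (qplane q)\<^esub> = lift_op q (\<lambda>p. p)"
  by (rule Q.lin_end_eqI[where q=q];
      simp add: Q.lin_end_extensional Q.lin_end_apply lift_op_extensional qelem_add qelem_scl lift_op_apply)+

lemma lift_op_minus: "lin f \<Longrightarrow> lin g \<Longrightarrow>
    lift_op q f \<ominus>\<^bsub>lin_end (qplane q)\<^esub> lift_op q g = lift_op q (\<lambda>p. f p - g p)"
  by (simp add: LQ.minus_eq_smult lift_op_closed lift_op_algebra scl_minus_one)

lemma uq_rel_lift_op:
  assumes "qstruct q K K' E F"
  shows "uq_rel (lin_end (qplane q)) q (lift_op q K) (lift_op q K') (lift_op q E) (lift_op q F)"
  using assms unfolding uq_rel_def qstruct_def
  by (simp add: lift_op_algebra lift_op_minus lin_comp)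

context
  fixes q K K' E F
  assumes q: "q \<noteq> 0" and S: "qstruct q K K' E F"
begin

definition struct_of :: "uq \<Rightarrow> qp \<Rightarrow> qp" where
  "struct_of = restrict (presented_lift (lin_end (qplane q))
     (case_uq_gen (lift_op q K) (lift_op q K') (lift_op q E) (lift_op q F))) (carrier (uq_algebra q))"

lemma struct_of_hom: "struct_of \<in> alg_hom (uq_algebra q) (lin_end (qplane q))"
  and struct_of_gen: "struct_of (uq_k q) = lift_op q K" "struct_of (uq_kinv q) = lift_op q K'"
    "struct_of (uq_e q) = lift_op q E" "struct_of (uq_f q) = lift_op q F"
proof -
  have l: "lin K" "lin K'" "lin E" "lin F" using S by (simp_all add: qstruct_def)
  note L = uq_lift[OF Q.lin_end_calg, OF lift_op_closed[OF l(1)] lift_op_closed[OF l(2)]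
      lift_op_closed[OF l(3)] lift_op_closed[OF l(4)] uq_rel_lift_op[OF S]]
  show "struct_of \<in> alg_hom (uq_algebra q) (lin_end (qplane q))"
    using alg_homD[OF L(1)] by (intro alg_homI) (simp_all add: struct_of_def)
  show "struct_of (uq_k q) = lift_op q K" "struct_of (uq_kinv q) = lift_op q K'"
    "struct_of (uq_e q) = lift_op q E" "struct_of (uq_f q) = lift_op q F"
    by (simp_all add: struct_of_def L)
qed

lemma struct_of_closed:
  "u \<in> carrier (uq_algebra q) \<Longrightarrow> a \<in> carrier (qplane q) \<Longrightarrow> struct_of u a \<in> carrier (qplane q)"
  using Q.lin_endD(2)[OF alg_homD(1)[OF struct_of_hom]] .

lemma struct_of_apply:
  "u \<in> carrier (uq_algebra q) \<Longrightarrow> v \<in> carrier (uq_algebra q) \<Longrightarrow> a \<in> carrier (qplane q) \<Longrightarrow>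
    struct_of (u \<otimes>\<^bsub>uq_algebra q\<^esub> v) a = struct_of u (struct_of v a)"
  "u \<in> carrier (uq_algebra q) \<Longrightarrow> v \<in> carrier (uq_algebra q) \<Longrightarrow> a \<in> carrier (qplane q) \<Longrightarrow>
    struct_of (u \<oplus>\<^bsub>uq_algebra q\<^esub> v) a = struct_of u a \<oplus>\<^bsub>qplane q\<^esub> struct_of v a"
  "u \<in> carrier (uq_algebra q) \<Longrightarrow> a \<in> carrier (qplane q) \<Longrightarrow>
    struct_of (c \<odot>\<^bsub>uq_algebra q\<^esub> u) a = c \<odot>\<^bsub>qplane q\<^esub> struct_of u a"
  "a \<in> carrier (qplane q) \<Longrightarrow> struct_of \<one>\<^bsub>uq_algebra q\<^esub> a = a"
  by (simp_all add: alg_homD[OF struct_of_hom] Q.lin_end_apply)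

lemma struct_of_linear:
  assumes "u \<in> carrier (uq_algebra q)" "a \<in> carrier (qplane q)"
  shows "b \<in> carrier (qplane q) \<Longrightarrow> struct_of u (a \<oplus>\<^bsub>qplane q\<^esub> b) = struct_of u a \<oplus>\<^bsub>qplane q\<^esub> struct_of u b"
    "struct_of u (c \<odot>\<^bsub>qplane q\<^esub> a) = c \<odot>\<^bsub>qplane q\<^esub> struct_of u a"
  using assms Q.lin_endD(3,4)[OF alg_homD(1)[OF struct_of_hom]] by auto

lemma struct_of_leibniz:
  assumes a: "a \<in> carrier (qplane q)" and b: "b \<in> carrier (qplane q)"
  shows "struct_of (uq_k q) (a \<otimes>\<^bsub>qplane q\<^esub> b) = struct_of (uq_k q) a \<otimes>\<^bsub>qplane q\<^esub> struct_of (uq_k q) b"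
    and "struct_of (uq_kinv q) (a \<otimes>\<^bsub>qplane q\<^esub> b) = struct_of (uq_kinv q) a \<otimes>\<^bsub>qplane q\<^esub> struct_of (uq_kinv q) b"
    and "struct_of (uq_e q) (a \<otimes>\<^bsub>qplane q\<^esub> b) =
      a \<otimes>\<^bsub>qplane q\<^esub> struct_of (uq_e q) b \<oplus>\<^bsub>qplane q\<^esub> struct_of (uq_e q) a \<otimes>\<^bsub>qplane q\<^esub> struct_of (uq_k q) b"
    and "struct_of (uq_f q) (a \<otimes>\<^bsub>qplane q\<^esub> b) =
      struct_of (uq_f q) a \<otimes>\<^bsub>qplane q\<^esub> b \<oplus>\<^bsub>qplane q\<^esub> struct_of (uq_kinv q) a \<otimes>\<^bsub>qplane q\<^esub> struct_of (uq_f q) b"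
  using a b S
  by (simp_all add: struct_of_gen lift_op_apply qcoord_simps qstruct_def qelem_add qelem_mult)

interpretation B: bilinear_tensor "uq_algebra q" "uq_algebra q" "qplane q"
  by (intro bilinear_tensor.intro tensor.intro U.calg_axioms Q.calg_axioms)

abbreviation (input) "paired a b \<equiv> (\<lambda>u v. struct_of u a \<otimes>\<^bsub>qplane q\<^esub> struct_of v b)"
abbreviation (input) "TU \<equiv> tensor_algebra (uq_algebra q) (uq_algebra q)"

lemma struct_of_bilinear:
  "a \<in> carrier (qplane q) \<Longrightarrow> b \<in> carrier (qplane q) \<Longrightarrow>
    (paired a b) \<in> B.bilinear_maps"
  unfolding B.bilinear_maps_def
  by (simp add: struct_of_closed struct_of_apply Q.l_distr Q.r_distr Q.smult_mult_left Q.smult_mult_right)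

text \<open>
  The induction step for the Leibniz rule: letting a generator act on the value of
  \<open>u \<otimes> v \<mapsto> u(a) v(b)\<close> has the same effect as multiplying the argument by its comultiplication.  On a
  pure tensor this is the rule \<open>struct_of_leibniz\<close> for the elements \<open>u(a)\<close> and \<open>v(b)\<close>.
\<close>

lemma struct_of_tensor_gen:
  assumes a: "a \<in> carrier (qplane q)" and b: "b \<in> carrier (qplane q)" and T: "T \<in> carrier TU"
    and g: "g = uq_k q \<or> g = uq_kinv q \<or> g = uq_e q \<or> g = uq_f q"
  shows "struct_of g (B.tensor_lift (paired a b) T) =
    B.tensor_lift (paired a b) (uq_comult q g \<otimes>\<^bsub>TU\<^esub> T)"
proof -
  note \<beta> = struct_of_bilinear[OF a b]
  note D = uq_comult_hom[OF q]
  have gc: "g \<in> carrier (uq_algebra q)" using g by auto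
  have Dc: "uq_comult q g \<in> carrier TU" by (rule alg_homD(1)[OF D(1) gc])
  show ?thesis using T
  proof (induction T rule: UU.tensor_induct)
    case (add S T)
    then show ?case using Dc gc
      by (simp add: UU.TT.r_distr B.tensor_lift_add[OF \<beta>] B.tensor_lift_closed[OF \<beta>] struct_of_linear)
  next
    case (pure u v)
    have *: "struct_of u a \<in> carrier (qplane q)" "struct_of v b \<in> carrier (qplane q)"
      using pure a b struct_of_closed by auto
    note L = struct_of_leibniz[OF *]
    from g show ?case
    proof (elim disjE)
      assume g: "g = uq_k q"
      show ?thesis using pure a b L
        by (simp add: g D(2) UU.pt_mult B.tensor_lift_pure[OF \<beta>] struct_of_apply)
    next
      assume g: "g = uq_kinv q"
      show ?thesis using pure a b L
        by (simp add: g D(3) UU.pt_mult B.tensor_lift_pure[OF \<beta>] struct_of_apply)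
    next
      assume g: "g = uq_e q"
      show ?thesis using pure a b L
        by (simp add: g D(4) UU.pt_mult B.tensor_lift_pure[OF \<beta>] B.tensor_lift_add[OF \<beta>] UU.TT.l_distr struct_of_apply)
    next
      assume g: "g = uq_f q"
      show ?thesis using pure a b L
        by (simp add: g D(5) UU.pt_mult B.tensor_lift_pure[OF \<beta>] B.tensor_lift_add[OF \<beta>] UU.TT.l_distr struct_of_apply)
    qed
  qed
qed

lemma struct_of_comult:
  assumes u: "u \<in> carrier (uq_algebra q)" and a: "a \<in> carrier (qplane q)" and b: "b \<in> carrier (qplane q)"
  shows "struct_of u (a \<otimes>\<^bsub>qplane q\<^esub> b) =
    B.tensor_lift (paired a b) (uq_comult q u)"
proof -
  note \<beta> = struct_of_bilinear[OF a b]
  note D = alg_homD[OF uq_comult_hom(1)[OF q]]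
  have gen: "struct_of (g \<otimes>\<^bsub>uq_algebra q\<^esub> v) (a \<otimes>\<^bsub>qplane q\<^esub> b) =
      B.tensor_lift (paired a b) (uq_comult q (g \<otimes>\<^bsub>uq_algebra q\<^esub> v))"
    if v: "v \<in> carrier (uq_algebra q)" and g: "g = uq_k q \<or> g = uq_kinv q \<or> g = uq_e q \<or> g = uq_f q"
    and IH: "struct_of v (a \<otimes>\<^bsub>qplane q\<^esub> b) =
      B.tensor_lift (paired a b) (uq_comult q v)" for g v
  proof -
    have gc: "g \<in> carrier (uq_algebra q)" using g by auto
    have "struct_of (g \<otimes>\<^bsub>uq_algebra q\<^esub> v) (a \<otimes>\<^bsub>qplane q\<^esub> b) = struct_of g (struct_of v (a \<otimes>\<^bsub>qplane q\<^esub> b))"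
      using a b gc v by (intro struct_of_apply) auto
    also have "\<dots> = B.tensor_lift (paired a b) (uq_comult q g \<otimes>\<^bsub>TU\<^esub> uq_comult q v)"
      unfolding IH by (rule struct_of_tensor_gen[OF a b D(1)[OF v] g])
    finally show ?thesis by (simp only: D(2)[OF gc v])
  qed
  show ?thesis using u
  proof (induction u rule: uq_induct)
    case one
    then show ?case using a b
      by (simp add: D(5) UU.pt_one B.tensor_lift_pure[OF \<beta>] struct_of_apply)
  next
    case (add u v)
    then show ?case using a b
      by (simp add: D(1,3) struct_of_apply B.tensor_lift_add[OF \<beta>])
  next
    case (smult c u)
    then show ?case using a b
      by (simp add: D(1,4) struct_of_apply B.tensor_lift_smult[OF \<beta>])
  qed (simp_all add: gen)
qed

lemma struct_of_counit:
  assumes u: "u \<in> carrier (uq_algebra q)"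
  shows "struct_of u \<one>\<^bsub>qplane q\<^esub> = uq_counit u \<odot>\<^bsub>qplane q\<^esub> \<one>\<^bsub>qplane q\<^esub>"
proof -
  note h = alg_homD[OF uq_counit_hom(1)[of q]]
  have c: "a \<oplus>\<^bsub>complex_algebra\<^esub> b = a + b" "a \<otimes>\<^bsub>complex_algebra\<^esub> b = a * b"
    "a \<odot>\<^bsub>complex_algebra\<^esub> b = a * b" "\<one>\<^bsub>complex_algebra\<^esub> = 1" for a b
    by (simp_all add: complex_algebra_def)
  have o: "qelem q (mon (0, 0)) = \<one>\<^bsub>qplane q\<^esub>" by (simp add: qelem_mon qp_monom_def)
  have g: "struct_of (uq_k q) \<one>\<^bsub>qplane q\<^esub> = \<one>\<^bsub>qplane q\<^esub>" "struct_of (uq_kinv q) \<one>\<^bsub>qplane q\<^esub> = \<one>\<^bsub>qplane q\<^esub>"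
    "struct_of (uq_e q) \<one>\<^bsub>qplane q\<^esub> = \<zero>\<^bsub>qplane q\<^esub>" "struct_of (uq_f q) \<one>\<^bsub>qplane q\<^esub> = \<zero>\<^bsub>qplane q\<^esub>"
    using S by (simp_all add: struct_of_gen lift_op_apply qcoord_simps qstruct_def o qelem_zero)
  show ?thesis using u
  proof (induction u rule: uq_induct)
  qed (simp_all add: h c struct_of_apply struct_of_linear g Q.smult_add_left Q.smult_smult
      uq_counit_hom(2-5)[where q=q])
qed

text \<open>
  By \<open>struct_of_comult\<close> the action on a product is a linear function of the comultiplication, so every
  decomposition into pure tensors gives the same right-hand side.
\<close>

lemma struct_of_structure: "struct_of \<in> uq_structures q"
  unfolding uq_structures_def module_algebra_structures_def Uq_simps Uq_tensor Uq_alg_hom mem_Collect_eq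
proof (intro conjI ballI allI impI)
  show "struct_of \<in> alg_hom (uq_algebra q) (lin_end (qplane q)) \<inter> extensional (carrier (uq_algebra q))"
    using struct_of_hom by (simp add: struct_of_def)
  fix u assume u: "u \<in> carrier (uq_algebra q)"
  show "struct_of u \<one>\<^bsub>qplane q\<^esub> = uq_counit u \<odot>\<^bsub>qplane q\<^esub> \<one>\<^bsub>qplane q\<^esub>"
    by (rule struct_of_counit[OF u])
  fix a b and n :: nat and h1 h2
  assume a: "a \<in> carrier (qplane q)" and b: "b \<in> carrier (qplane q)"
    and h: "\<forall>i<n. h1 i \<in> carrier (uq_algebra q) \<and> h2 i \<in> carrier (uq_algebra q)"
    and c: "uq_comult q u = (\<Oplus>\<^bsub>TU\<^esub> i\<in>{..<n}. pure_tensor (uq_algebra q) (uq_algebra q) (h1 i) (h2 i))"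
  note \<beta> = struct_of_bilinear[OF a b]
  have "struct_of u (a \<otimes>\<^bsub>qplane q\<^esub> b) =
     (\<Oplus>\<^bsub>qplane q\<^esub> i\<in>{..<n}. B.tensor_lift (paired a b)
       (pure_tensor (uq_algebra q) (uq_algebra q) (h1 i) (h2 i)))"
    unfolding struct_of_comult[OF u a b] c by (rule B.tensor_lift_finsum[OF \<beta>]) (use h in simp)
  also have "\<dots> = (\<Oplus>\<^bsub>qplane q\<^esub> i\<in>{..<n}. struct_of (h1 i) a \<otimes>\<^bsub>qplane q\<^esub> struct_of (h2 i) b)"
    using h a b by (intro Q.finsum_cong') (auto simp: B.tensor_lift_pure[OF \<beta>] struct_of_closed)
  finally show "struct_of u (a \<otimes>\<^bsub>qplane q\<^esub> b) =
    (\<Oplus>\<^bsub>qplane q\<^esub> i\<in>{..<n}. struct_of (h1 i) a \<otimes>\<^bsub>qplane q\<^esub> struct_of (h2 i) b)" .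
qed

lemma qstruct_structure:
  "\<exists>\<pi>\<in>uq_structures q. op_of q \<pi> (uq_k q) = K \<and> op_of q \<pi> (uq_kinv q) = K' \<and>
     op_of q \<pi> (uq_e q) = E \<and> op_of q \<pi> (uq_f q) = F"
  by (rule bexI[OF _ struct_of_structure])
    (simp add: op_of_def struct_of_gen lift_op_apply fun_eq_iff)

end

section \<open>Leading exponents and automorphisms\<close>

abbreviation gen_x :: qpoly where "gen_x \<equiv> mon (Suc 0, 0)"
abbreviation gen_y :: qpoly where "gen_y \<equiv> mon (0, Suc 0)"

text \<open>
  Lexicographic order of exponents in which \<open>y\<close> dominates \<open>x\<close>.  It is compatible with addition, so
  that leading exponents add under multiplication.
\<close>

definition lex_le :: "nat \<times> nat \<Rightarrow> nat \<times> nat \<Rightarrow> bool" where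
  "lex_le i j \<longleftrightarrow> snd i < snd j \<or> snd i = snd j \<and> fst i \<le> fst j"

definition is_lead :: "qpoly \<Rightarrow> nat \<times> nat \<Rightarrow> bool" where
  "is_lead p i \<longleftrightarrow> i \<in> keys p \<and> (\<forall>j\<in>keys p. lex_le j i)"

abbreviation exp_add :: "nat \<times> nat \<Rightarrow> nat \<times> nat \<Rightarrow> nat \<times> nat" where
  "exp_add i j \<equiv> (fst i + fst j, snd i + snd j)"

lemma lex_le_refl: "lex_le i i"
  and lex_le_linear: "lex_le i j \<or> lex_le j i"
  and lex_le_trans: "lex_le i j \<Longrightarrow> lex_le j k \<Longrightarrow> lex_le i k"
  and lex_le_antisym: "lex_le i j \<Longrightarrow> lex_le j i \<Longrightarrow> i = j"
  and lex_le_add: "lex_le i i' \<Longrightarrow> lex_le j j' \<Longrightarrow> lex_le (exp_add i j) (exp_add i' j')"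
  and lex_le_add_eq: "lex_le i i' \<Longrightarrow> lex_le j j' \<Longrightarrow> exp_add i j = exp_add i' j' \<Longrightarrow> i = i' \<and> j = j'"
  by (auto simp: lex_le_def prod_eq_iff)

lemma lex_max_exists:
  assumes "finite S" "S \<noteq> {}"
  shows "\<exists>i\<in>S. \<forall>j\<in>S. lex_le (f j) (f i)"
  using assms
proof (induction S rule: finite_ne_induct)
  case (singleton x)
  then show ?case by (simp add: lex_le_refl)
next
  case (insert x S)
  then obtain i where i: "i \<in> S" "\<forall>j\<in>S. lex_le (f j) (f i)" by blast
  show ?case
  proof (cases "lex_le (f x) (f i)")
    case True
    then show ?thesis using i by blast
  next
    case False
    then have "lex_le (f i) (f x)" using lex_le_linear by blast
    then show ?thesis using i lex_le_trans lex_le_refl by (metis insert_iff)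
  qed
qed

lemma is_lead_exists: "p \<noteq> 0 \<Longrightarrow> \<exists>i. is_lead p i"
  using lex_max_exists[of "keys p" "\<lambda>i. i"] unfolding is_lead_def
  by (metis finite_keys keys_eq_empty)

lemma is_lead_mon: "is_lead (mon i) i"
  by (simp add: is_lead_def lex_le_refl)

lemma lookup_qm:
  "lookup (qm q p r) k = (\<Sum>i\<in>keys p. \<Sum>j\<in>keys r.
     if exp_add i j = k then lookup p i * lookup r j * q ^ (snd i * fst j) else 0)"
  unfolding qm_def lext_def
  by (auto simp: lookup_sum lookup_mon scl_sum intro!: sum.cong)

text \<open>
  Strict monotonicity of addition leaves a single pair of exponents that sums up to the leading one;
  no cancellation is possible.
\<close>

lemma lookup_qm_lead:
  assumes p: "is_lead p i" and r: "is_lead r j"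
  shows "lookup (qm q p r) (exp_add i j) = lookup p i * lookup r j * q ^ (snd i * fst j)"
proof -
  have "lookup (qm q p r) (exp_add i j) = (\<Sum>i'\<in>keys p. \<Sum>j'\<in>keys r.
      if i' = i then if j' = j then lookup p i * lookup r j * q ^ (snd i * fst j) else 0 else 0)"
    unfolding lookup_qm using p r
    by (intro sum.cong refl) (auto simp: is_lead_def dest: lex_le_add_eq)
  also have "\<dots> = (\<Sum>i'\<in>keys p. if i' = i then lookup p i * lookup r j * q ^ (snd i * fst j) else 0)"
    using r by (intro sum.cong refl) (simp add: is_lead_def)
  also have "\<dots> = lookup p i * lookup r j * q ^ (snd i * fst j)"
    using p by (simp add: is_lead_def)
  finally show ?thesis .
qed

lemma is_lead_qm:
  assumes "q \<noteq> 0" "is_lead p i" "is_lead r j"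
  shows "is_lead (qm q p r) (exp_add i j)"
proof -
  have "exp_add i j \<in> keys (qm q p r)"
    using assms lookup_qm_lead[OF assms(2,3), of q] by (simp add: is_lead_def in_keys_iff)
  moreover have "lex_le k (exp_add i j)" if "k \<in> keys (qm q p r)" for k
  proof -
    have "lookup (qm q p r) k \<noteq> 0" using that by (simp add: in_keys_iff)
    then obtain i' j' where "i' \<in> keys p" "j' \<in> keys r" "k = exp_add i' j'"
      unfolding lookup_qm by (auto elim!: sum.not_neutral_contains_not_neutral split: if_splits)
    then show ?thesis using assms lex_le_add by (auto simp: is_lead_def)
  qed
  ultimately show ?thesis by (simp add: is_lead_def)
qed

definition qend :: "complex \<Rightarrow> (qpoly \<Rightarrow> qpoly) \<Rightarrow> bool" where
  "qend q \<Psi> \<longleftrightarrow> lin \<Psi> \<and> (\<forall>p r. \<Psi> (qm q p r) = qm q (\<Psi> p) (\<Psi> r)) \<and> \<Psi> (mon (0, 0)) = mon (0, 0)"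

lemma mon_Suc: "mon (Suc m, n) = qm q gen_x (mon (m, n))"
  "mon (0, Suc n) = qm q gen_y (mon (0, n))"
  by (simp_all add: qm_mon)

lemma mon_induct [case_names one x y]:
  assumes "P (0, 0)" "\<And>m n. P (m, n) \<Longrightarrow> P (Suc m, n)" "\<And>n. P (0, n) \<Longrightarrow> P (0, Suc n)"
  shows "P i"
proof -
  have "P (0, n)" for n by (induction n) (auto simp: assms)
  then have "P (m, n)" for m n by (induction m) (auto simp: assms)
  then show ?thesis by (cases i) simp
qed

lemma lookup_mult_gen:
  "lookup (qm q p gen_x) (Suc m, n) = q ^ n * lookup p (m, n)"
  "lookup (qm q p gen_x) (0, n) = 0"
  "lookup (qm q gen_x p) (Suc m, n) = lookup p (m, n)"
  "lookup (qm q gen_x p) (0, n) = 0"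
  "lookup (qm q p gen_y) (m, Suc n) = lookup p (m, n)"
  "lookup (qm q p gen_y) (m, 0) = 0"
  "lookup (qm q gen_y p) (m, Suc n) = q ^ m * lookup p (m, n)"
  "lookup (qm q gen_y p) (m, 0) = 0"
proof (induction p rule: qpoly_induct)
  case zero
  { case 1 show ?case by (simp add: qm_simps) }
  { case 2 show ?case by (simp add: qm_simps) }
  { case 3 show ?case by (simp add: qm_simps) }
  { case 4 show ?case by (simp add: qm_simps) }
  { case 5 show ?case by (simp add: qm_simps) }
  { case 6 show ?case by (simp add: qm_simps) }
  { case 7 show ?case by (simp add: qm_simps) }
  { case 8 show ?case by (simp add: qm_simps) }
next
  case (add_mon p c i)
  note IH = add_mon
  { case 1 show ?case using IH by (cases i) (simp add: qm_simps lookup_add qm_mon lookup_mon algebra_simps) }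
  { case 2 show ?case using IH by (cases i) (simp add: qm_simps lookup_add qm_mon lookup_mon) }
  { case 3 show ?case using IH by (cases i) (simp add: qm_simps lookup_add qm_mon lookup_mon) }
  { case 4 show ?case using IH by (cases i) (simp add: qm_simps lookup_add qm_mon lookup_mon) }
  { case 5 show ?case using IH by (cases i) (simp add: qm_simps lookup_add qm_mon lookup_mon) }
  { case 6 show ?case using IH by (cases i) (simp add: qm_simps lookup_add qm_mon lookup_mon) }
  { case 7 show ?case using IH by (cases i) (simp add: qm_simps lookup_add qm_mon lookup_mon algebra_simps) }
  { case 8 show ?case using IH by (cases i) (simp add: qm_simps lookup_add qm_mon lookup_mon) }
qed

context
  fixes q :: complex
  assumes q0: "q \<noteq> 0" and q_root: "\<forall>n::nat. 0 < n \<longrightarrow> q ^ n \<noteq> 1"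
begin

lemma q_power_inject: "q ^ i = q ^ j \<longleftrightarrow> i = j"
proof -
  have "\<not> i < j" if "q ^ i = q ^ j" for i j
  proof
    assume "i < j"
    then have "q ^ j = q ^ i * q ^ (j - i)" by (simp flip: power_add)
    then show False using q0 q_root \<open>i < j\<close> that by simp
  qed
  then show ?thesis by (metis nat_neq_iff)
qed

lemma q_neq: "q \<noteq> 1" "q\<^sup>2 \<noteq> 1" "q ^ 4 \<noteq> 1"
  using q_root[rule_format, of 1] q_root[rule_format, of 2] q_root[rule_format, of 4] by auto

text \<open>
  Comparing leading coefficients in \<open>YX = qXY\<close>, for the images \<open>X\<close> and \<open>Y\<close> of the generators with
  leading exponents \<open>(a, b)\<close> and \<open>(c, d)\<close>, gives \<open>ad - bc = 1\<close>, since the powers of \<open>q\<close> are distinct.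
  Hence the monomials in \<open>X\<close> and \<open>Y\<close> have pairwise distinct leading exponents, and the leading exponent
  of any combination of them is one of these.  Surjectivity now requires that \<open>(a, b)\<close> and \<open>(c, d)\<close>
  generate all exponents additively, so they are \<open>(1, 0)\<close> and \<open>(0, 1)\<close>.  This bounds \<open>X\<close> and \<open>Y\<close> to
  \<open>\<alpha>x + \<gamma>\<close> and \<open>\<beta>y + h(x)\<close>, and \<open>YX = qXY\<close> kills \<open>\<gamma>\<close> and \<open>h\<close>.
\<close>

lemma aut_diagonal:
  assumes \<Psi>: "qend q \<Psi>" and bij: "bij \<Psi>"
  obtains \<alpha> \<beta> where "\<alpha> \<noteq> 0" "\<beta> \<noteq> 0" "\<Psi> gen_x = scl \<alpha> gen_x" "\<Psi> gen_y = scl \<beta> gen_y"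
proof -
  have l: "lin \<Psi>" and m: "\<Psi> (qm q p r) = qm q (\<Psi> p) (\<Psi> r)" and o: "\<Psi> (mon (0, 0)) = mon (0, 0)" for p r
    using \<Psi> by (auto simp: qend_def)
  define X Y where "X = \<Psi> gen_x" and "Y = \<Psi> gen_y"
  have nz: "\<Psi> p \<noteq> 0" if "p \<noteq> 0" for p
    using that bij lin_zero[OF l] by (metis bij_pointE)
  have "mon i \<noteq> 0" for i by (metis keys_zero is_lead_mon is_lead_def empty_iff)
  then obtain i j where i: "is_lead X i" and j: "is_lead Y j"
    using is_lead_exists nz X_def Y_def by metis
  obtain a b where ab: "i = (a, b)" by (cases i)
  obtain c d where cd: "j = (c, d)" by (cases j)
  have rel: "qm q Y X = scl q (qm q X Y)"
  proof -
    have "\<Psi> (qm q gen_y gen_x) = \<Psi> (scl q (qm q gen_x gen_y))"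
      by (simp add: qm_mon)
    then show ?thesis by (simp only: m linD[OF l] X_def Y_def)
  qed
  have "lookup Y j * lookup X i * q ^ (d * a) = q * (lookup X i * lookup Y j * q ^ (b * c))"
    using lookup_qm_lead[OF j i, of q] lookup_qm_lead[OF i j, of q] rel
    by (auto simp: ab cd add.commute)
  moreover have "lookup X i \<noteq> 0" "lookup Y j \<noteq> 0" using i j by (auto simp: is_lead_def in_keys_iff)
  ultimately have "q ^ (d * a) = q ^ (Suc (b * c))" by simp
  then have det: "d * a = Suc (b * c)" by (simp only: q_power_inject)
  define L where "L = (\<lambda>k. (fst k * a + snd k * c, fst k * b + snd k * d))"
  have lead: "is_lead (\<Psi> (mon k)) (L k)" for k
  proof (induction k rule: mon_induct)
    case one
    then show ?case by (simp add: o L_def is_lead_mon)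
  next
    case (x m n)
    have "is_lead (qm q X (\<Psi> (mon (m, n)))) (exp_add i (L (m, n)))"
      by (rule is_lead_qm[OF q0 i x])
    then show ?case by (simp only: mon_Suc(1)[of m n q] m X_def) (simp add: L_def ab add.assoc)
  next
    case (y n)
    have "is_lead (qm q Y (\<Psi> (mon (0, n)))) (exp_add j (L (0, n)))"
      by (rule is_lead_qm[OF q0 j y])
    then show ?case by (simp only: mon_Suc(2)[of n q] m Y_def) (simp add: L_def cd add.assoc)
  qed
  \<comment> \<open>The linear map L has determinant one.\<close>
  have Linj: "k = k'" if "L k = L k'" for k k'
  proof -
    obtain m n where k: "k = (m, n)" by (cases k)
    obtain m' n' where k': "k' = (m', n')" by (cases k')
    have 1: "int m * a + int n * c = int m' * a + int n' * c" "int m * b + int n * d = int m' * b + int n' * d"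
      using that unfolding L_def k k' by (metis (mono_tags) fst_conv snd_conv of_nat_add of_nat_mult)+
    have D: "int d * int a = 1 + int b * int c" using det by (metis of_nat_Suc of_nat_mult)
    have 2: "(int m - int m') * int a = (int n' - int n) * int c"
      "(int m - int m') * int b = (int n' - int n) * int d"
      using 1 by (simp_all add: algebra_simps)
    have "(int m - int m') * (int d * int a - int b * int c) =
        int d * ((int m - int m') * int a) - int c * ((int m - int m') * int b)"
      by (simp add: algebra_simps)
    also have "\<dots> = 0" unfolding 2 by (simp add: algebra_simps)
    finally have "(int m - int m') * (int d * int a - int b * int c) = 0" .
    moreover have "(int n' - int n) * (int d * int a - int b * int c) =
        int a * ((int n' - int n) * int d) - int b * ((int n' - int n) * int c)"
      by (simp add: algebra_simps)
    then have "(int n' - int n) * (int d * int a - int b * int c) = 0"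
      unfolding 2[symmetric] by (simp add: algebra_simps)
    ultimately show ?thesis using D by (simp add: k k')
  qed
  \<comment> \<open>Write a preimage of the monomial e as a combination of monomials; the image of the one
    with the largest L k cannot be cancelled by the others.\<close>
  have range: "\<exists>k. L k = e" for e
  proof -
    obtain p where p: "\<Psi> p = mon e" using bij by (metis bij_pointE)
    have "p \<noteq> 0" using p lin_zero[OF l] \<open>\<And>i. mon i \<noteq> 0\<close> by metis
    then have "keys p \<noteq> {}" by simp
    then obtain k where k: "k \<in> keys p" "\<forall>j\<in>keys p. lex_le (L j) (L k)"
      using lex_max_exists[of "keys p" L] by auto
    have exp: "\<Psi> p = (\<Sum>i\<in>keys p. scl (lookup p i) (\<Psi> (mon i)))"
    proof -
      have "\<Psi> p = \<Psi> (\<Sum>i\<in>keys p. scl (lookup p i) (mon i))" using mon_expand[of p] by simp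
      then show ?thesis by (simp only: lin_sum[OF l] linD[OF l])
    qed
    have "lookup (\<Psi> p) (L k) = (\<Sum>i\<in>keys p. lookup p i * lookup (\<Psi> (mon i)) (L k))"
      unfolding exp by (simp add: lookup_sum)
    also have "\<dots> = (\<Sum>i\<in>keys p. if i = k then lookup p k * lookup (\<Psi> (mon k)) (L k) else 0)"
    proof (rule sum.cong[OF refl])
      fix i' assume i': "i' \<in> keys p"
      have "lookup (\<Psi> (mon i')) (L k) = 0" if "i' \<noteq> k"
      proof (rule ccontr)
        assume "lookup (\<Psi> (mon i')) (L k) \<noteq> 0"
        then have "lex_le (L k) (L i')" using lead[of i'] by (auto simp: is_lead_def in_keys_iff)
        then have "L k = L i'" using k i' lex_le_antisym by blast
        then show False using Linj that by blast
      qed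
      then show "lookup p i' * lookup (\<Psi> (mon i')) (L k) =
          (if i' = k then lookup p k * lookup (\<Psi> (mon k)) (L k) else 0)" by auto
    qed
    also have "\<dots> = lookup p k * lookup (\<Psi> (mon k)) (L k)" using k by simp
    also have "\<dots> \<noteq> 0" using k lead[of k] by (auto simp: is_lead_def in_keys_iff)
    finally have "L k = e" unfolding p by (simp add: lookup_mon split: if_splits)
    then show ?thesis ..
  qed
  obtain k k' where "L k = (Suc 0, 0)" "L k' = (0, Suc 0)" using range by metis
  then have e: "fst k * a + snd k * c = 1" "fst k * b + snd k * d = 0"
    "fst k' * a + snd k' * c = 0" "fst k' * b + snd k' * d = 1" by (auto simp: L_def)
  have "d \<noteq> 0" "a \<noteq> 0" using det by (auto intro: gr0I)
  then have "snd k = 0" "fst k' = 0" using e(2,3) by auto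
  then have "a = Suc 0" "fst k = 1" "d = Suc 0" "snd k' = 1" using e by auto
  then have "b = 0" "c = 0" using e \<open>snd k = 0\<close> \<open>fst k' = 0\<close> by auto
  have X_keys: "lookup X (m, n) = 0" if "(m, n) \<noteq> (Suc 0, 0)" "(m, n) \<noteq> (0, 0)" for m n
  proof (rule ccontr)
    assume "lookup X (m, n) \<noteq> 0"
    then have "lex_le (m, n) i" using i by (simp add: is_lead_def in_keys_iff)
    then show False using that by (simp add: ab \<open>a = Suc 0\<close> \<open>b = 0\<close> lex_le_def)
  qed
  have Y_keys: "lookup Y (m, n) = 0" if "(m, n) \<noteq> (0, Suc 0)" "n \<noteq> 0" for m n
  proof (rule ccontr)
    assume "lookup Y (m, n) \<noteq> 0"
    then have "lex_le (m, n) j" using j by (simp add: is_lead_def in_keys_iff)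
    then show False using that by (auto simp: cd \<open>c = 0\<close> \<open>d = Suc 0\<close> lex_le_def)
  qed
  define \<alpha> \<beta> \<gamma> where "\<alpha> = lookup X (Suc 0, 0)" and "\<beta> = lookup Y (0, Suc 0)" and "\<gamma> = lookup X (0, 0)"
  have nz: "\<alpha> \<noteq> 0" "\<beta> \<noteq> 0"
    using i j by (auto simp: ab cd \<open>a = Suc 0\<close> \<open>b = 0\<close> \<open>c = 0\<close> \<open>d = Suc 0\<close> \<alpha>_def \<beta>_def is_lead_def in_keys_iff)
  have X: "X = scl \<alpha> gen_x + scl \<gamma> (mon (0, 0))"
  proof (rule poly_mapping_eqI)
    fix k show "lookup X k = lookup (scl \<alpha> gen_x + scl \<gamma> (mon (0, 0))) k"
      using X_keys by (cases k) (auto simp: lookup_add lookup_mon \<alpha>_def \<gamma>_def)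
  qed
  have YX: "lookup (qm q Y X) (m, n) = \<alpha> * lookup (qm q Y gen_x) (m, n) + \<gamma> * lookup Y (m, n)" for m n
    unfolding X by (simp add: qm_simps qm_one lookup_add)
  have XY: "lookup (qm q X Y) (m, n) = \<alpha> * lookup (qm q gen_x Y) (m, n) + \<gamma> * lookup Y (m, n)" for m n
    unfolding X by (simp add: qm_simps qm_one lookup_add)
  have rel': "lookup (qm q Y X) k = q * lookup (qm q X Y) k" for k using rel by simp
  \<comment> \<open>Coefficient of y in YX = qXY.\<close>
  have "\<gamma> * \<beta> = q * (\<gamma> * \<beta>)"
    using rel'[of "(0, Suc 0)"] unfolding YX XY using lookup_mult_gen(2,4) by (simp add: \<beta>_def)
  then have \<gamma>: "\<gamma> = 0" using nz q_neq by simp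
  \<comment> \<open>Coefficient of the power m + 1 of x.\<close>
  have "lookup Y (m, 0) = 0" for m
    using rel'[of "(Suc m, 0)"] unfolding YX XY \<gamma> lookup_mult_gen using nz q_neq by simp
  note Y0 = this
  have Y: "Y = scl \<beta> gen_y"
  proof (rule poly_mapping_eqI)
    fix k show "lookup Y k = lookup (scl \<beta> gen_y) k"
      using Y_keys[of "fst k" "snd k"] Y0[of "fst k"]
      by (cases k, cases "snd k = 0") (auto simp: lookup_mon \<beta>_def)
  qed
  show ?thesis using that[of \<alpha> \<beta>] nz X Y unfolding X_def Y_def \<gamma> by simp
qed

end

lemma qend_diagonal:
  assumes \<Psi>: "qend q \<Psi>" and "\<Psi> gen_x = scl \<alpha> gen_x" "\<Psi> gen_y = scl \<beta> gen_y"
  shows "\<Psi> (mon (m, n)) = scl (\<alpha> ^ m * \<beta> ^ n) (mon (m, n))"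
proof -
  have l: "lin \<Psi>" and m: "\<Psi> (qm q p r) = qm q (\<Psi> p) (\<Psi> r)" and o: "\<Psi> (mon (0, 0)) = mon (0, 0)" for p r
    using \<Psi> by (auto simp: qend_def)
  have "\<Psi> (mon i) = scl (\<alpha> ^ fst i * \<beta> ^ snd i) (mon i)" for i
  proof (induction i rule: mon_induct)
    case one
    then show ?case by (simp add: o)
  next
    case (x m n)
    then show ?case unfolding mon_Suc(1)[of m n q] assms(2) m
      by (simp add: qm_simps mult_ac)
  next
    case (y n)
    then show ?case unfolding mon_Suc(2)[of n q] assms(3) m
      by (simp add: qm_simps mult_ac)
  qed
  then show ?thesis by simp
qed

lemma qend_diagonal_lookup:
  assumes "qend q \<Psi>" "\<Psi> gen_x = scl \<alpha> gen_x" "\<Psi> gen_y = scl \<beta> gen_y"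
  shows "lookup (\<Psi> p) (m, n) = \<alpha> ^ m * \<beta> ^ n * lookup p (m, n)"
proof -
  have l: "lin \<Psi>" using assms(1) by (simp add: qend_def)
  show ?thesis
  proof (induction p rule: qpoly_induct)
    case zero
    then show ?case by (simp add: lin_zero[OF l])
  next
    case (add_mon p c i)
    then show ?case
      by (cases i) (simp add: linD[OF l] qend_diagonal[OF assms] lookup_add lookup_mon algebra_simps)
  qed
qed

section \<open>Classification of the operator triples\<close>

lemma qstructD:
  assumes "qstruct q K K' E F"
  shows "lin K" "lin K'" "lin E" "lin F" "K' (K p) = p" "K (K' p) = p"
    "K (E p) = scl (q\<^sup>2) (E (K p))" "K (F p) = scl (inverse (q\<^sup>2)) (F (K p))"
    "E (F p) - F (E p) = scl (1 / (q - inverse q)) (K p - K' p)"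
    "K (qm q p r) = qm q (K p) (K r)" "K' (qm q p r) = qm q (K' p) (K' r)"
    "E (qm q p r) = qm q p (E r) + qm q (E p) (K r)"
    "F (qm q p r) = qm q (F p) r + qm q (K' p) (F r)"
    "K (mon (0, 0)) = mon (0, 0)" "K' (mon (0, 0)) = mon (0, 0)" "E (mon (0, 0)) = 0" "F (mon (0, 0)) = 0"
    "qend q K" "qend q K'" "bij K"
proof -
  show "lin K" "lin K'" "lin E" "lin F" "K' (K p) = p" "K (K' p) = p"
    "K (E p) = scl (q\<^sup>2) (E (K p))" "K (F p) = scl (inverse (q\<^sup>2)) (F (K p))"
    "E (F p) - F (E p) = scl (1 / (q - inverse q)) (K p - K' p)"
    "K (qm q p r) = qm q (K p) (K r)" "K' (qm q p r) = qm q (K' p) (K' r)"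
    "E (qm q p r) = qm q p (E r) + qm q (E p) (K r)"
    "F (qm q p r) = qm q (F p) r + qm q (K' p) (F r)"
    "K (mon (0, 0)) = mon (0, 0)" "K' (mon (0, 0)) = mon (0, 0)" "E (mon (0, 0)) = 0" "F (mon (0, 0)) = 0"
    "qend q K" "qend q K'"
    using assms by (auto simp: qstruct_def qend_def)
  have "K' \<circ> K = id" "K \<circ> K' = id" using assms by (auto simp: qstruct_def)
  then show "bij K" by (rule o_bij)
qed

definition qgiven :: "complex \<Rightarrow> (qpoly \<Rightarrow> qpoly) \<Rightarrow> (qpoly \<Rightarrow> qpoly) \<Rightarrow> (qpoly \<Rightarrow> qpoly) \<Rightarrow> param \<Rightarrow> bool" where
  "qgiven q K E F = (\<lambda>(d0, s, t).
     K gen_x = scl q gen_x \<and> K gen_y = scl (q\<^sup>2) gen_y \<and>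
     E gen_x = scl (- q * inverse d0) (mon (Suc 0, Suc 0)) + scl s (mon (3, 0)) \<and>
     E gen_y = scl (- q * inverse d0) (mon (0, 2)) + scl t (mon (4, 0)) \<and>
     F gen_x = 0 \<and> F gen_y = scl d0 (mon (0, 0)))"

text \<open>
  The four operators are determined on \<open>x\<close> and \<open>y\<close>, and the rules on products propagate the equality
  to all monomials.
\<close>

lemma qstruct_unique:
  assumes S: "qstruct q K K' E F" and T: "qstruct q L L' G H"
    and g: "qgiven q K E F w" "qgiven q L G H w"
  shows "K = L" "K' = L'" "E = G" "F = H"
proof -
  note S = qstructD[OF S] and T = qstructD[OF T]
  have hx: "K gen_x = L gen_x" "E gen_x = G gen_x" "F gen_x = H gen_x"
    and hy: "K gen_y = L gen_y" "E gen_y = G gen_y" "F gen_y = H gen_y"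
    using g by (auto simp: qgiven_def split: prod.splits)
  have "K (mon i) = L (mon i)" for i
  proof (induction i rule: mon_induct)
    case one show ?case by (simp only: S(14) T(14))
  next
    case (x m n) then show ?case by (simp only: mon_Suc(1)[of m n q] S(10) T(10) hx)
  next
    case (y n) then show ?case by (simp only: mon_Suc(2)[of n q] S(10) T(10) hy)
  qed
  then have K: "K p = L p" for p by (rule lin_eqI[OF S(1) T(1)])
  have K': "K' p = L' p" for p using K S(5)[of "L' p"] T(6)[of p] by simp
  have "E (mon i) = G (mon i)" for i
  proof (induction i rule: mon_induct)
    case one show ?case by (simp only: S(16) T(16))
  next
    case (x m n) then show ?case by (simp only: mon_Suc(1)[of m n q] S(12) T(12) hx K)
  next
    case (y n) then show ?case by (simp only: mon_Suc(2)[of n q] S(12) T(12) hy K)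
  qed
  then have E: "E p = G p" for p by (rule lin_eqI[OF S(3) T(3)])
  have "F (mon i) = H (mon i)" for i
  proof (induction i rule: mon_induct)
    case one show ?case by (simp only: S(17) T(17))
  next
    case (x m n) then show ?case by (simp only: mon_Suc(1)[of m n q] S(13) T(13) hx K')
  next
    case (y n) then show ?case by (simp only: mon_Suc(2)[of n q] S(13) T(13) hy K')
  qed
  then have F: "F p = H p" for p by (rule lin_eqI[OF S(4) T(4)])
  show "K = L" "K' = L'" "E = G" "F = H" using K K' E F by auto
qed

context
  fixes q :: complex
  assumes q0: "q \<noteq> 0" and q_root: "\<forall>n::nat. 0 < n \<longrightarrow> q ^ n \<noteq> 1"
begin

text \<open>
  Once \<open>K\<close> is known to be diagonal, comparing single coefficients determines everything but the three
  parameters.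
\<close>

lemma qstruct_classify:
  assumes S: "qstruct q K K' E F" and d0: "lookup (F gen_y) (0, 0) \<noteq> 0"
  shows "\<exists>w\<in>params. qgiven q K E F w"
proof -
  note S = qstructD[OF S]
  note inj = q_power_inject[OF q0 q_root] and qn = q_neq[OF q0 q_root]
  obtain \<alpha> \<beta> where nz: "\<alpha> \<noteq> 0" "\<beta> \<noteq> 0" and Kx: "K gen_x = scl \<alpha> gen_x"
    and Ky: "K gen_y = scl \<beta> gen_y"
    by (rule aut_diagonal[OF q0 q_root S(18) S(20)])
  note LK = qend_diagonal_lookup[OF S(18) Kx Ky]
  have K'x: "K' gen_x = scl (inverse \<alpha>) gen_x"
    using S(5)[of "scl (inverse \<alpha>) gen_x"] nz by (simp add: linD[OF S(1)] Kx)
  have K'y: "K' gen_y = scl (inverse \<beta>) gen_y"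
    using S(5)[of "scl (inverse \<beta>) gen_y"] nz by (simp add: linD[OF S(1)] Ky)
  define d where "d = lookup (F gen_y) (0, 0)"
  have d: "d \<noteq> 0" using d0 by (simp add: d_def)
  \<comment> \<open>The constant term of KF(y) determines the eigenvalue of y.\<close>
  have "lookup (K (F gen_y)) (0, 0) = lookup (scl (inverse (q\<^sup>2)) (F (K gen_y))) (0, 0)"
    by (simp only: S(8))
  then have \<beta>: "\<beta> = q\<^sup>2" using d q0
    by (simp add: LK Ky linD[OF S(4)] d_def field_simps)
  \<comment> \<open>The coefficient of x in F(yx) = q F(xy) determines the eigenvalue of x.\<close>
  have "F (qm q gen_y gen_x) = scl q (F (qm q gen_x gen_y))"
    by (simp add: qm_mon linD[OF S(4)])
  then have "lookup (qm q (F gen_y) gen_x + qm q (K' gen_y) (F gen_x)) (Suc 0, 0) =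
      lookup (scl q (qm q (F gen_x) gen_y + qm q (K' gen_x) (F gen_y))) (Suc 0, 0)"
    by (simp only: S(13))
  then have "d = q * (inverse \<alpha> * d)"
    using lookup_mult_gen(1,3)[where m=0 and n=0] lookup_mult_gen(6,8)[where m=1]
    by (simp add: K'x K'y qm_simps lookup_add d_def)
  then have \<alpha>: "\<alpha> = q" using d nz by (simp add: field_simps)
  have LK: "lookup (K p) (m, n) = q ^ (m + 2 * n) * lookup p (m, n)" for p m n
    unfolding LK \<alpha> \<beta> by (simp add: power_add power_mult)
  \<comment> \<open>The weight of the monomial with exponents (m, n) is m + 2n; the operator E raises it by
    two and F lowers it by two.\<close>
  have wE: "lookup (E p) (m, n) = 0" if "K p = scl (q ^ k) p" "m + 2 * n \<noteq> k + 2" for p m n k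
  proof -
    have "lookup (K (E p)) (m, n) = lookup (scl (q\<^sup>2) (E (K p))) (m, n)" by (simp only: S(7))
    then have "q ^ (m + 2 * n) * lookup (E p) (m, n) = q ^ (k + 2) * lookup (E p) (m, n)"
      by (simp add: LK that(1) linD[OF S(3)] power_add power2_eq_square mult_ac)
    then show ?thesis using that(2) inj[of "m + 2 * n" "k + 2"] by (metis mult_cancel_right)
  qed
  have wF: "lookup (F p) (m, n) = 0" if "K p = scl (q ^ k) p" "m + 2 * n + 2 \<noteq> k" for p m n k
  proof -
    have "lookup (K (F p)) (m, n) = lookup (scl (inverse (q\<^sup>2)) (F (K p))) (m, n)" by (simp only: S(8))
    then have "q ^ (m + 2 * n + 2) * lookup (F p) (m, n) = q ^ k * lookup (F p) (m, n)"
      using q0 by (simp add: LK that(1) linD[OF S(4)] power_add power2_eq_square field_simps)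
    then show ?thesis using that(2) inj[of "m + 2 * n + 2" k] by (metis mult_cancel_right)
  qed
  have Kx1: "K gen_x = scl (q ^ 1) gen_x" and Ky1: "K gen_y = scl (q ^ 2) gen_y"
    by (simp_all only: Kx Ky \<alpha> \<beta> power_one_right)
  define b s where "b = lookup (E gen_x) (Suc 0, Suc 0)" and "s = lookup (E gen_x) (3, 0)"
  define g u t where "g = lookup (E gen_y) (0, 2)" and "u = lookup (E gen_y) (2, 1)"
    and "t = lookup (E gen_y) (4, 0)"
  have Ex: "E gen_x = scl b (mon (Suc 0, Suc 0)) + scl s (mon (3, 0))"
  proof (rule poly_mapping_eqI)
    fix k :: "nat \<times> nat"
    obtain m n where k: "k = (m, n)" by (cases k)
    show "lookup (E gen_x) k = lookup (scl b (mon (Suc 0, Suc 0)) + scl s (mon (3, 0))) k"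
    proof (cases "m + 2 * n = 3")
      case True
      then have "(m, n) = (Suc 0, Suc 0) \<or> (m, n) = (3, 0)" by auto presburger+
      then show ?thesis by (auto simp: k lookup_add lookup_mon b_def s_def)
    next
      case False
      then show ?thesis using wE[OF Kx1, of m n] by (auto simp: k lookup_add lookup_mon)
    qed
  qed
  have Ey: "E gen_y = scl g (mon (0, 2)) + scl u (mon (2, 1)) + scl t (mon (4, 0))"
  proof (rule poly_mapping_eqI)
    fix k :: "nat \<times> nat"
    obtain m n where k: "k = (m, n)" by (cases k)
    show "lookup (E gen_y) k = lookup (scl g (mon (0, 2)) + scl u (mon (2, 1)) + scl t (mon (4, 0))) k"
    proof (cases "m + 2 * n = 4")
      case True
      then have "(m, n) = (0, 2) \<or> (m, n) = (2, 1) \<or> (m, n) = (4, 0)" by auto presburger+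
      then show ?thesis by (auto simp: k lookup_add lookup_mon g_def u_def t_def)
    next
      case False
      then show ?thesis using wE[OF Ky1, of m n] by (auto simp: k lookup_add lookup_mon)
    qed
  qed
  have Fx: "F gen_x = 0"
  proof (rule poly_mapping_eqI)
    fix k show "lookup (F gen_x) k = lookup 0 k"
      using wF[OF Kx1, of "fst k" "snd k"] by simp
  qed
  have Fy: "F gen_y = scl d (mon (0, 0))"
  proof (rule poly_mapping_eqI)
    fix k :: "nat \<times> nat"
    obtain m n where k: "k = (m, n)" by (cases k)
    show "lookup (F gen_y) k = lookup (scl d (mon (0, 0))) k"
      using wF[OF Ky1, of m n] by (auto simp: k lookup_mon d_def)
  qed
  \<comment> \<open>The coefficient with exponents (3, 1) in E(yx) = q E(xy) excludes the second monomial of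
    weight four.\<close>
  have "E (qm q gen_y gen_x) = scl q (E (qm q gen_x gen_y))"
    by (simp add: qm_mon linD[OF S(3)])
  then have "lookup (qm q gen_y (E gen_x) + qm q (E gen_y) (K gen_x)) (3, 1) =
      lookup (scl q (qm q gen_x (E gen_y) + qm q (E gen_x) (K gen_y))) (3, 1)"
    by (simp only: S(12))
  then have "q ^ 3 * s + q * (q * u) = q * (u + q\<^sup>2 * s)"
    unfolding Ex Ey Kx1 Ky1 by (simp add: qm_simps qm_mon lookup_add lookup_mon mult_ac)
  then have "q * (q - 1) * u = 0" by (simp add: algebra_simps power2_eq_square power3_eq_cube)
  then have u: "u = 0" using q0 qn by simp
  have Fxm: "F (mon (m, 0)) = 0" for m
  proof (induction m)
    case 0 show ?case by (rule S(17))
  next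
    case (Suc m) then show ?case by (simp only: mon_Suc(1)[of m 0 q] S(13) Fx) (simp add: qm_simps)
  qed
  have c: "(q - inverse q) * (q + inverse q) = q\<^sup>2 - inverse (q\<^sup>2)" "q - inverse q \<noteq> 0" "1 + inverse (q\<^sup>2) \<noteq> 0"
  proof -
    show "(q - inverse q) * (q + inverse q) = q\<^sup>2 - inverse (q\<^sup>2)"
      by (simp add: algebra_simps power2_eq_square)
    show "q - inverse q \<noteq> 0"
    proof
      assume "q - inverse q = 0"
      then have "q * q = 1" using q0 by (metis eq_iff_diff_eq_0 right_inverse)
      then show False using qn(2) by (simp add: power2_eq_square)
    qed
    show "1 + inverse (q\<^sup>2) \<noteq> 0"
    proof
      assume "1 + inverse (q\<^sup>2) = 0"
      then have "q\<^sup>2 = - 1" using q0 by (simp add: field_simps add_eq_0_iff)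
      then have "q ^ 4 = 1" by (simp add: power4_eq_xxxx power2_eq_square)
      then show False using qn by simp
    qed
  qed
  have "F (mon (0, 2)) = F (qm q gen_y gen_y)" by (simp add: qm_mon numeral_2_eq_2)
  also have "\<dots> = scl (d * (1 + inverse (q\<^sup>2))) gen_y"
    by (simp add: S(13) Fy K'y \<beta> qm_simps qm_one scl_add_left[symmetric] algebra_simps)
  finally have Fyy: "F (mon (0, 2)) = scl (d * (1 + inverse (q\<^sup>2))) gen_y" .
  \<comment> \<open>The commutator relation on y and on x determines g and b.\<close>
  have "lookup (E (F gen_y) - F (E gen_y)) (0, Suc 0) =
      lookup (scl (1 / (q - inverse q)) (K gen_y - K' gen_y)) (0, Suc 0)"
    by (simp only: S(9))
  then have "- (g * (d * (1 + inverse (q\<^sup>2)))) = 1 / (q - inverse q) * (q\<^sup>2 - inverse (q\<^sup>2))"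
    by (simp add: Fy Ey u linD[OF S(3)] linD[OF S(4)] S(16) Fyy Fxm Ky1 K'y \<beta> lookup_minus lookup_mon lookup_add)
  then have "- (g * (d * (1 + inverse (q\<^sup>2)))) = q + inverse q"
    unfolding c(1)[symmetric] using c(2) by simp
  also have "\<dots> = q * (1 + inverse (q\<^sup>2))" using q0 by (simp add: field_simps power2_eq_square)
  finally have "(- g * d) * (1 + inverse (q\<^sup>2)) = q * (1 + inverse (q\<^sup>2))" by (simp add: mult.assoc)
  then have "- g * d = q" using c(3) by (metis mult_cancel_right)
  then have g: "g = - q * inverse d" using d by (auto simp: field_simps)
  have "F (mon (Suc 0, Suc 0)) = F (qm q gen_x gen_y)" by (simp add: qm_mon)
  also have "\<dots> = scl (inverse q * d) gen_x"
    by (simp add: S(13) Fy Fx K'x \<alpha> qm_simps qm_one mult.commute)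
  finally have Fxy: "F (mon (Suc 0, Suc 0)) = scl (inverse q * d) gen_x" .
  have "lookup (E (F gen_x) - F (E gen_x)) (Suc 0, 0) =
      lookup (scl (1 / (q - inverse q)) (K gen_x - K' gen_x)) (Suc 0, 0)"
    by (simp only: S(9))
  then have "- (b * (inverse q * d)) = 1 / (q - inverse q) * (q - inverse q)"
    by (simp add: Fx Ex linD[OF S(4)] lin_zero[OF S(3)] Fxy Fxm Kx1 K'x \<alpha> lookup_minus lookup_mon lookup_add)
  then have "- (b * (inverse q * d)) = 1" using c(2) by simp
  then have b: "b = - q * inverse d" using d q0 by (simp add: field_simps) (metis minus_minus)
  have "qgiven q K E F (d, s, t)"
    unfolding qgiven_def using Ex Ey Fx Fy Kx Ky by (simp add: b g u \<alpha> \<beta>)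
  moreover have "(d, s, t) \<in> params" using d by (simp add: params_def)
  ultimately show ?thesis by blast
qed

end

section \<open>The explicit family\<close>

definition fam_K :: "complex \<Rightarrow> qpoly \<Rightarrow> qpoly" where
  "fam_K q = lext (\<lambda>(m, n). scl (q ^ m * (q ^ n)\<^sup>2) (mon (m, n)))"

definition fam_K' :: "complex \<Rightarrow> qpoly \<Rightarrow> qpoly" where
  "fam_K' q = lext (\<lambda>(m, n). scl (inverse (q ^ m * (q ^ n)\<^sup>2)) (mon (m, n)))"

definition fam_F :: "complex \<Rightarrow> complex \<Rightarrow> qpoly \<Rightarrow> qpoly" where
  "fam_F q a = lext (\<lambda>(m, n). scl (a * (inverse (q ^ m) - inverse (q ^ m * (q ^ n)\<^sup>2))) (mon (m, n - 1)))"

text \<open>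
  The coordinates of \<open>w K(p) - p w\<close> with \<open>w = b y + c x\<^sup>2 + d x\<^sup>4 y\<^sup>-\<^sup>1\<close>; likewise \<^const>\<open>fam_F\<close> is
  \<open>v p - K'(p) v\<close> with \<open>v = a y\<^sup>-\<^sup>1\<close>.  For \<open>n = 0\<close> the coefficients of the terms with exponent \<open>n - 1\<close>
  vanish, so the truncated subtraction is harmless.
\<close>

definition fam_E :: "complex \<Rightarrow> complex \<Rightarrow> complex \<Rightarrow> complex \<Rightarrow> qpoly \<Rightarrow> qpoly" where
  "fam_E q b c d = lext (\<lambda>(m, n). scl (b * ((q ^ m * q ^ n)\<^sup>2 - 1)) (mon (m, Suc n)) +
      scl (c * (q ^ m - 1) * (q ^ n)\<^sup>2) (mon (m + 2, n)) +
      scl (d * ((q ^ n)\<^sup>2 - (q ^ n) ^ 4)) (mon (m + 4, n - 1)))"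

lemma lin_fam: "lin (fam_K q)" "lin (fam_K' q)" "lin (fam_F q a)" "lin (fam_E q b c d)"
  unfolding fam_K_def fam_K'_def fam_F_def fam_E_def by (rule lin_lext)+

lemma fam_mon:
  "fam_K q (mon (m, n)) = scl (q ^ m * (q ^ n)\<^sup>2) (mon (m, n))"
  "fam_K' q (mon (m, n)) = scl (inverse (q ^ m * (q ^ n)\<^sup>2)) (mon (m, n))"
  "fam_F q a (mon (m, 0)) = 0"
  "fam_F q a (mon (m, Suc n)) =
    scl (a * (inverse (q ^ m) - inverse (q ^ m * (q ^ Suc n)\<^sup>2))) (mon (m, n))"
  "fam_E q b c d (mon (m, 0)) = scl (b * ((q ^ m)\<^sup>2 - 1)) (mon (m, 1)) + scl (c * (q ^ m - 1)) (mon (m + 2, 0))"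
  "fam_E q b c d (mon (m, Suc n)) = scl (b * ((q ^ m * q ^ Suc n)\<^sup>2 - 1)) (mon (m, Suc (Suc n))) +
      scl (c * (q ^ m - 1) * (q ^ Suc n)\<^sup>2) (mon (m + 2, Suc n)) +
      scl (d * ((q ^ Suc n)\<^sup>2 - (q ^ Suc n) ^ 4)) (mon (m + 4, n))"
  by (simp_all add: fam_K_def fam_K'_def fam_F_def fam_E_def)

lemmas fam_lin = linD[OF lin_fam(1)] linD[OF lin_fam(2)] linD[OF lin_fam(3)] linD[OF lin_fam(4)]
  lin_zero[OF lin_fam(1)] lin_zero[OF lin_fam(2)] lin_zero[OF lin_fam(3)] lin_zero[OF lin_fam(4)]

lemma scl_cong: "c = d \<Longrightarrow> scl c p = scl d p" by simp

lemma power_mult_add: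
  "q ^ (n * (a + 2)) = q ^ (n * a) * (q ^ n * q ^ n)"
  "q ^ (n * (a + 4)) = q ^ (n * a) * (q ^ n * q ^ n * q ^ n * q ^ n)"
  "q ^ (n * 2) = q ^ n * q ^ n"
  "q ^ (n * 4) = q ^ n * q ^ n * q ^ n * q ^ n" for q :: complex
  by (simp_all add: distrib_left power_add power_mult power2_eq_square power4_eq_xxxx mult.assoc)

lemma fam_KE:
  assumes "q \<noteq> 0"
  shows "fam_K q (fam_E q b c d p) = scl (q\<^sup>2) (fam_E q b c d (fam_K q p))"
proof (rule lin_eqI[of "\<lambda>p. fam_K q (fam_E q b c d p)" "\<lambda>p. scl (q\<^sup>2) (fam_E q b c d (fam_K q p))"])
  fix i :: "nat \<times> nat"
  obtain m n where i: "i = (m, n)" by (cases i)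
  show "fam_K q (fam_E q b c d (mon i)) = scl (q\<^sup>2) (fam_E q b c d (fam_K q (mon i)))"
    unfolding i by (cases n)
      (simp_all add: fam_mon fam_lin scl_add_right power_add power2_eq_square power4_eq_xxxx mult_ac)
qed (intro lin_comp[OF lin_fam(1)] lin_scl lin_comp[OF lin_fam(4)] lin_fam)+

lemma fam_KF:
  assumes "q \<noteq> 0"
  shows "fam_K q (fam_F q a p) = scl (inverse (q\<^sup>2)) (fam_F q a (fam_K q p))"
proof (rule lin_eqI[of "\<lambda>p. fam_K q (fam_F q a p)" "\<lambda>p. scl (inverse (q\<^sup>2)) (fam_F q a (fam_K q p))"])
  fix i :: "nat \<times> nat"
  obtain m n where i: "i = (m, n)" by (cases i)
  show "fam_K q (fam_F q a (mon i)) = scl (inverse (q\<^sup>2)) (fam_F q a (fam_K q (mon i)))"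
    unfolding i using assms by (cases n)
      (simp_all add: fam_mon fam_lin power2_eq_square, rule scl_cong, simp add: field_simps)
qed (intro lin_comp[OF lin_fam(1)] lin_scl lin_comp[OF lin_fam(3)] lin_fam)+

lemma fam_KK':
  assumes "q \<noteq> 0"
  shows "fam_K q (fam_K' q p) = p" "fam_K' q (fam_K q p) = p"
proof -
  have c: "inverse (q ^ m * (q ^ n)\<^sup>2) * (q ^ m * (q ^ n)\<^sup>2) = 1" for m n
    using assms by (intro left_inverse) simp
  have "fam_K q (fam_K' q (mon i)) = mon i \<and> fam_K' q (fam_K q (mon i)) = mon i" for i
    by (cases i) (simp only: fam_mon fam_lin scl_simps c mult.commute[of _ "inverse _"] simp_thms)
  then show "fam_K q (fam_K' q p) = p" "fam_K' q (fam_K q p) = p"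
    using lin_eqI[OF lin_comp[OF lin_fam(1,2)] lin_id] lin_eqI[OF lin_comp[OF lin_fam(2,1)] lin_id] by blast+
qed

lemma fam_K_mult:
  shows "fam_K q (qm q p r) = qm q (fam_K q p) (fam_K q r)"
    and "fam_K' q (qm q p r) = qm q (fam_K' q p) (fam_K' q r)"
proof -
  show "fam_K q (qm q p r) = qm q (fam_K q p) (fam_K q r)"
  proof (rule qm_eqI[of "\<lambda>p r. fam_K q (qm q p r)" "\<lambda>p r. qm q (fam_K q p) (fam_K q r)"])
    fix i j show "fam_K q (qm q (mon i) (mon j)) = qm q (fam_K q (mon i)) (fam_K q (mon j))"
      by (cases i; cases j) (simp add: fam_mon fam_lin qm_mon qm_simps power_add power2_eq_square mult_ac)
  qed (intro lin_comp[OF lin_fam(1)] lin_comp[OF lin_qm(1)] lin_comp[OF lin_qm(2)] lin_qm lin_fam)+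
  show "fam_K' q (qm q p r) = qm q (fam_K' q p) (fam_K' q r)"
  proof (rule qm_eqI[of "\<lambda>p r. fam_K' q (qm q p r)" "\<lambda>p r. qm q (fam_K' q p) (fam_K' q r)"])
    fix i j show "fam_K' q (qm q (mon i) (mon j)) = qm q (fam_K' q (mon i)) (fam_K' q (mon j))"
      by (cases i; cases j) (simp add: fam_mon fam_lin qm_mon qm_simps power_add power2_eq_square mult_ac)
  qed (intro lin_comp[OF lin_fam(2)] lin_comp[OF lin_qm(1)] lin_comp[OF lin_qm(2)] lin_qm lin_fam)+
qed

lemma fam_F_leibniz:
  assumes "q \<noteq> 0"
  shows "fam_F q a (qm q p r) = qm q (fam_F q a p) r + qm q (fam_K' q p) (fam_F q a r)"
proof (rule qm_eqI[of "\<lambda>p r. fam_F q a (qm q p r)" "\<lambda>p r. qm q (fam_F q a p) r + qm q (fam_K' q p) (fam_F q a r)"])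
  fix i j :: "nat \<times> nat"
  obtain m n k l where ij: "i = (m, n)" "j = (k, l)" by (cases i; cases j)
  have eq: "scl u (mon e) = scl v (mon e) + scl w (mon e)" if "u = v + w" for u v w e
    using that by (simp add: scl_add_left)
  show "fam_F q a (qm q (mon i) (mon j)) = qm q (fam_F q a (mon i)) (mon j) + qm q (fam_K' q (mon i)) (fam_F q a (mon j))"
    unfolding ij
    by (cases n; cases l; simp add: fam_mon fam_lin qm_mon qm_simps;
        (rule scl_cong | rule eq)?; simp add: assms power_add power2_eq_square field_simps)
qed (intro lin_add lin_comp[OF lin_fam(3)] lin_comp[OF lin_qm(1)] lin_comp[OF lin_qm(2)] lin_qm lin_fam)+

lemma fam_E_leibniz:
  assumes "q \<noteq> 0"
  shows "fam_E q b c d (qm q p r) = qm q p (fam_E q b c d r) + qm q (fam_E q b c d p) (fam_K q r)"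
proof (rule qm_eqI[of "\<lambda>p r. fam_E q b c d (qm q p r)"
      "\<lambda>p r. qm q p (fam_E q b c d r) + qm q (fam_E q b c d p) (fam_K q r)"])
  fix i j :: "nat \<times> nat"
  obtain m n k l where ij: "i = (m, n)" "j = (k, l)" by (cases i; cases j)
  show "fam_E q b c d (qm q (mon i) (mon j)) =
      qm q (mon i) (fam_E q b c d (mon j)) + qm q (fam_E q b c d (mon i)) (fam_K q (mon j))"
    unfolding ij
    by (rule poly_mapping_eqI, cases n; cases l;
        simp add: fam_mon fam_lin qm_mon qm_simps lookup_add lookup_mon power_mult_add
          power2_eq_square power4_eq_xxxx;
        auto simp: power_add power_mult_add power4_eq_xxxx algebra_simps)
qed (intro lin_add lin_comp[OF lin_fam(4)] lin_comp[OF lin_qm(1)] lin_comp[OF lin_qm(2)] lin_qm lin_fam)+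

text \<open>
  The commutator relation on \<open>x\<^sup>m y\<^sup>n\<close>, with \<open>u = q\<^sup>m\<close> and \<open>v = q\<^sup>n\<close>.  The value of \<open>ab\<close> is forced by it.
\<close>

lemma fam_EF_coeff:
  fixes u v q a b :: complex
  assumes "u \<noteq> 0" "v \<noteq> 0" "q \<noteq> 0" "q\<^sup>2 \<noteq> 1" and ab: "a * b = - (q ^ 3 / (q\<^sup>2 - 1)\<^sup>2)"
  shows "a * (inverse u - inverse (u * v\<^sup>2)) * (b * ((u * v * inverse q)\<^sup>2 - 1)) -
      b * ((u * v)\<^sup>2 - 1) * (a * (inverse u - inverse (u * (v * q)\<^sup>2))) =
    1 / (q - inverse q) * (u * v\<^sup>2 - inverse (u * v\<^sup>2))"
proof -
  have n: "q\<^sup>2 - 1 \<noteq> 0" using assms by simp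
  have "a * (inverse u - inverse (u * v\<^sup>2)) * (b * ((u * v * inverse q)\<^sup>2 - 1)) -
      b * ((u * v)\<^sup>2 - 1) * (a * (inverse u - inverse (u * (v * q)\<^sup>2))) =
    (a * b) * ((inverse u - inverse (u * v\<^sup>2)) * ((u * v * inverse q)\<^sup>2 - 1) -
       ((u * v)\<^sup>2 - 1) * (inverse u - inverse (u * (v * q)\<^sup>2)))"
    by (simp add: algebra_simps)
  also have "(inverse u - inverse (u * v\<^sup>2)) * ((u * v * inverse q)\<^sup>2 - 1) -
       ((u * v)\<^sup>2 - 1) * (inverse u - inverse (u * (v * q)\<^sup>2)) =
      - ((q\<^sup>2 - 1) / q\<^sup>2) * (u * v\<^sup>2 - inverse (u * v\<^sup>2))"
    using assms(1-3) by (simp add: divide_simps power2_eq_square) (simp add: algebra_simps)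
  also have "(a * b) * (- ((q\<^sup>2 - 1) / q\<^sup>2) * (u * v\<^sup>2 - inverse (u * v\<^sup>2))) =
      (q / (q\<^sup>2 - 1)) * (u * v\<^sup>2 - inverse (u * v\<^sup>2))"
    unfolding ab using n assms(3) by (simp add: divide_simps power2_eq_square power3_eq_cube)
  also have "q / (q\<^sup>2 - 1) = 1 / (q - inverse q)"
    using n assms(3) by (simp add: divide_simps power2_eq_square)
  finally show ?thesis .
qed

text \<open>
  The terms of \<open>E\<close> that come from \<open>x\<^sup>2\<close> and \<open>x\<^sup>4 y\<^sup>-\<^sup>1\<close> contribute equally to \<open>EF\<close> and \<open>FE\<close>; those from \<open>y\<close> produce
  the right-hand side.
\<close>

lemma fam_EF:
  assumes q: "q \<noteq> 0" "q\<^sup>2 \<noteq> 1" and ab: "a * b = - (q ^ 3 / (q\<^sup>2 - 1)\<^sup>2)"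
  shows "fam_E q b c d (fam_F q a p) - fam_F q a (fam_E q b c d p) =
    scl (1 / (q - inverse q)) (fam_K q p - fam_K' q p)"
proof (rule lin_eqI[of "\<lambda>p. fam_E q b c d (fam_F q a p) - fam_F q a (fam_E q b c d p)"
      "\<lambda>p. scl (1 / (q - inverse q)) (fam_K q p - fam_K' q p)"])
  fix i :: "nat \<times> nat"
  obtain m n where i: "i = (m, n)" by (cases i)
  have K: "scl (1 / (q - inverse q)) (fam_K q (mon (m, n)) - fam_K' q (mon (m, n))) =
     scl (1 / (q - inverse q) * (q ^ m * (q ^ n)\<^sup>2 - inverse (q ^ m * (q ^ n)\<^sup>2))) (mon (m, n))" for n
    by (rule poly_mapping_eqI) (simp add: fam_mon lookup_minus algebra_simps)
  show "fam_E q b c d (fam_F q a (mon i)) - fam_F q a (fam_E q b c d (mon i)) =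
    scl (1 / (q - inverse q)) (fam_K q (mon i) - fam_K' q (mon i))"
  proof (cases n)
    case 0
    have 1: "- (a * (inverse (q ^ m) - inverse (q ^ m * q\<^sup>2)) * (b * ((q ^ m)\<^sup>2 - 1))) =
        1 / (q - inverse q) * (q ^ m - inverse (q ^ m))"
      using fam_EF_coeff[of "q ^ m" 1 q a b] q ab by (simp add: mult_ac)
    have EF: "fam_E q b c d (fam_F q a (mon (m, 0))) = 0" by (simp only: fam_mon fam_lin)
    have FE: "fam_F q a (fam_E q b c d (mon (m, 0))) =
        scl (b * ((q ^ m)\<^sup>2 - 1) * (a * (inverse (q ^ m) - inverse (q ^ m * q\<^sup>2)))) (mon (m, 0))"
      by (simp add: fam_mon fam_lin)
    show ?thesis
      unfolding i 0 K EF FE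
      using 1 by (simp add: scl_minus_one[symmetric]) (simp add: mult_ac)
  next
    case (Suc k)
    have 1: "a * (inverse (q ^ m) - inverse (q ^ m * (q ^ Suc k)\<^sup>2)) * (b * ((q ^ m * q ^ k)\<^sup>2 - 1)) -
      b * ((q ^ m * q ^ Suc k)\<^sup>2 - 1) * (a * (inverse (q ^ m) - inverse (q ^ m * (q ^ Suc (Suc k))\<^sup>2))) =
      1 / (q - inverse q) * (q ^ m * (q ^ Suc k)\<^sup>2 - inverse (q ^ m * (q ^ Suc k)\<^sup>2))"
    proof -
      have e: "q ^ m * q ^ Suc k * inverse q = q ^ m * q ^ k" "q ^ Suc k * q = q ^ Suc (Suc k)"
        using q by (simp_all add: mult.commute)
      have "q ^ m \<noteq> 0" "q ^ Suc k \<noteq> 0" using q by simp_all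
      from fam_EF_coeff[OF this q ab] show ?thesis unfolding e .
    qed
    have 2: "a * (inverse (q ^ m) - inverse (q ^ m * (q ^ Suc k)\<^sup>2)) * (c * (q ^ m - 1) * (q ^ k)\<^sup>2) =
      c * (q ^ m - 1) * (q ^ Suc k)\<^sup>2 * (a * (inverse (q ^ (m + 2)) - inverse (q ^ (m + 2) * (q ^ Suc k)\<^sup>2)))"
      using q by (simp add: field_simps power_add power2_eq_square)
    define x1 where "x1 = a * (inverse (q ^ m) - inverse (q ^ m * (q ^ Suc k)\<^sup>2)) * (b * ((q ^ m * q ^ k)\<^sup>2 - 1))"
    define y1 where "y1 = b * ((q ^ m * q ^ Suc k)\<^sup>2 - 1) * (a * (inverse (q ^ m) - inverse (q ^ m * (q ^ Suc (Suc k))\<^sup>2)))"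
    define y2 where "y2 = c * (q ^ m - 1) * (q ^ Suc k)\<^sup>2 * (a * (inverse (q ^ (m + 2)) - inverse (q ^ (m + 2) * (q ^ Suc k)\<^sup>2)))"
    have final: "(scl x1 (mon (m, Suc k)) + z) - (scl y1 (mon (m, Suc k)) + z) = scl (x1 - y1) (mon (m, Suc k))" for z
      by (rule poly_mapping_eqI) (simp add: lookup_minus lookup_add algebra_simps)
    show ?thesis
    proof (cases k)
      case 0
      have EF: "fam_E q b c d (fam_F q a (mon (m, Suc k))) = scl x1 (mon (m, Suc k)) + scl y2 (mon (m + 2, k))"
        unfolding x1_def y2_def 2[symmetric] by (simp add: 0 fam_mon fam_lin scl_add_right mult.assoc)
      have FE: "fam_F q a (fam_E q b c d (mon (m, Suc k))) = scl y1 (mon (m, Suc k)) + scl y2 (mon (m + 2, k))"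
        unfolding y1_def y2_def by (simp only: fam_mon fam_lin scl_simps 0 add_0_right)
      show ?thesis
        unfolding i Suc K 1[symmetric] EF FE x1_def[symmetric] y1_def[symmetric] by (rule final)
    next
      case (Suc l)
      define y3 where "y3 = d * ((q ^ Suc k)\<^sup>2 - (q ^ Suc k) ^ 4) * (a * (inverse (q ^ (m + 4)) - inverse (q ^ (m + 4) * (q ^ k)\<^sup>2)))"
      have 3: "a * (inverse (q ^ m) - inverse (q ^ m * (q ^ Suc k)\<^sup>2)) * (d * ((q ^ k)\<^sup>2 - (q ^ k) ^ 4)) = y3"
        unfolding y3_def using q by (simp add: field_simps power_add power2_eq_square power4_eq_xxxx)
      have EF: "fam_E q b c d (fam_F q a (mon (m, Suc k))) =
          scl x1 (mon (m, Suc k)) + (scl y2 (mon (m + 2, k)) + scl y3 (mon (m + 4, l)))"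
        unfolding x1_def y2_def 2[symmetric] 3[symmetric]
        unfolding Suc by (simp only: fam_mon fam_lin scl_add_right scl_simps add.assoc)
      have FE: "fam_F q a (fam_E q b c d (mon (m, Suc k))) =
          scl y1 (mon (m, Suc k)) + (scl y2 (mon (m + 2, k)) + scl y3 (mon (m + 4, l)))"
        unfolding y1_def y2_def y3_def
        unfolding Suc by (simp only: fam_mon fam_lin scl_add_right scl_simps add.assoc)
      show ?thesis
        unfolding i \<open>n = Suc k\<close> K 1[symmetric] EF FE x1_def[symmetric] y1_def[symmetric] by (rule final)
    qed
  qed
qed (intro lin_minus lin_scl lin_comp[OF lin_fam(3)] lin_comp[OF lin_fam(4)] lin_fam)+

lemma family_qstruct:
  assumes q0: "q \<noteq> 0" and q_root: "\<forall>n::nat. 0 < n \<longrightarrow> q ^ n \<noteq> 1" and w: "w \<in> params"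
  shows "\<exists>K K' E F. qstruct q K K' E F \<and> qgiven q K E F w"
proof -
  obtain d0 s t where w: "w = (d0, s, t)" "d0 \<noteq> 0" using w by (auto simp: params_def)
  note qn = q_neq[OF q0 q_root]
  \<comment> \<open>Chosen to produce the prescribed values on x and y.\<close>
  define a b c d where "a = d0 / (1 - inverse (q\<^sup>2))" and "b = - q / (d0 * (q\<^sup>2 - 1))"
    and "c = s / (q - 1)" and "d = t / (q\<^sup>2 - q ^ 4)"
  have n: "q\<^sup>2 - 1 \<noteq> 0" "1 - inverse (q\<^sup>2) \<noteq> 0" "q - 1 \<noteq> 0" "q\<^sup>2 - q ^ 4 \<noteq> 0"
    using qn q0 by (auto simp: power4_eq_xxxx power2_eq_square field_simps)
  have ab: "a * b = - (q ^ 3 / (q\<^sup>2 - 1)\<^sup>2)"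
    unfolding a_def b_def using n w(2) q0
    by (simp add: divide_simps power2_eq_square power3_eq_cube)
  have S: "qstruct q (fam_K q) (fam_K' q) (fam_E q b c d) (fam_F q a)"
    unfolding qstruct_def
    using fam_KK'[OF q0] fam_KE[OF q0] fam_KF[OF q0] fam_EF[OF q0 qn(2) ab] fam_K_mult[of q]
      fam_F_leibniz[OF q0] fam_E_leibniz[OF q0]
    by (simp add: lin_fam) (simp add: fam_mon)
  have "b * (q\<^sup>2 - 1) = - q * inverse d0" using n by (simp add: b_def divide_simps)
  moreover have "c * (q - 1) = s" "d * (q\<^sup>2 - q ^ 4) = t" "a * (1 - inverse (q\<^sup>2)) = d0"
    using n by (simp_all add: a_def c_def d_def)
  ultimately have "qgiven q (fam_K q) (fam_E q b c d) (fam_F q a) w"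
    by (simp add: qgiven_def w fam_mon numeral_2_eq_2 numeral_3_eq_3 eval_nat_numeral del: power_Suc)
  then show ?thesis using S by blast
qed

section \<open>Structures and their parameters\<close>

lemma qelem_gens: "qelem q gen_x = qp_x q" "qelem q gen_y = qp_y q"
  "qelem q (mon (0, 0)) = \<one>\<^bsub>qplane q\<^esub>"
  by (simp_all add: qelem_mon qp_monom_def)

lemma qcoord_pow:
  "qcoord q (qp_x q [^]\<^bsub>qplane q\<^esub> m) = mon (m, 0)" "qcoord q (qp_y q [^]\<^bsub>qplane q\<^esub> m) = mon (0, m)"
  for m :: nat
  using qcoord_monom[of q m 0] qcoord_monom[of q 0 m] by (simp_all add: qp_monom_def)

lemma structure_closed:
  "\<pi> \<in> uq_structures q \<Longrightarrow> u \<in> carrier (uq_algebra q) \<Longrightarrow> a \<in> carrier (qplane q) \<Longrightarrow> \<pi> u a \<in> carrier (qplane q)"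
  by (rule Q.lin_endD(2)[OF structureD(3)])

lemma qcoord_eq_iff:
  "a \<in> carrier (qplane q) \<Longrightarrow> b \<in> carrier (qplane q) \<Longrightarrow> a = b \<longleftrightarrow> qcoord q a = qcoord q b"
  using qcoord_inject by blast

lemma given_by_iff:
  assumes \<pi>: "\<pi> \<in> uq_structures q"
  shows "given_by q \<pi> w \<longleftrightarrow> qgiven q (op_of q \<pi> (uq_k q)) (op_of q \<pi> (uq_e q)) (op_of q \<pi> (uq_f q)) w"
proof -
  obtain d0 s t where w: "w = (d0, s, t)" by (cases w)
  note cl = structure_closed[OF \<pi>]
  have "\<pi> (uq_k q) (qp_x q) = q \<odot>\<^bsub>qplane q\<^esub> qp_x q \<longleftrightarrow>
      op_of q \<pi> (uq_k q) gen_x = scl q gen_x"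
    by (subst qcoord_eq_iff[where q=q]) (simp_all add: cl op_of_def qelem_gens qcoord_simps)
  moreover have "\<pi> (uq_k q) (qp_y q) = q\<^sup>2 \<odot>\<^bsub>qplane q\<^esub> qp_y q \<longleftrightarrow>
      op_of q \<pi> (uq_k q) gen_y = scl (q\<^sup>2) gen_y"
    by (subst qcoord_eq_iff[where q=q]) (simp_all add: cl op_of_def qelem_gens qcoord_simps)
  moreover have "\<pi> (uq_e q) (qp_x q) =
      (- q * inverse d0) \<odot>\<^bsub>qplane q\<^esub> (qp_x q \<otimes>\<^bsub>qplane q\<^esub> qp_y q) \<oplus>\<^bsub>qplane q\<^esub> s \<odot>\<^bsub>qplane q\<^esub> (qp_x q [^]\<^bsub>qplane q\<^esub> (3::nat)) \<longleftrightarrow>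
      op_of q \<pi> (uq_e q) gen_x = scl (- q * inverse d0) (mon (Suc 0, Suc 0)) + scl s (mon (3, 0))"
    by (subst qcoord_eq_iff[where q=q])
      (simp_all add: cl op_of_def qelem_gens qcoord_simps qcoord_pow qm_mon)
  moreover have "\<pi> (uq_e q) (qp_y q) =
      (- q * inverse d0) \<odot>\<^bsub>qplane q\<^esub> (qp_y q [^]\<^bsub>qplane q\<^esub> (2::nat)) \<oplus>\<^bsub>qplane q\<^esub> t \<odot>\<^bsub>qplane q\<^esub> (qp_x q [^]\<^bsub>qplane q\<^esub> (4::nat)) \<longleftrightarrow>
      op_of q \<pi> (uq_e q) gen_y = scl (- q * inverse d0) (mon (0, 2)) + scl t (mon (4, 0))"
    by (subst qcoord_eq_iff[where q=q])
      (simp_all add: cl op_of_def qelem_gens qcoord_simps qcoord_pow)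
  moreover have "\<pi> (uq_f q) (qp_x q) = \<zero>\<^bsub>qplane q\<^esub> \<longleftrightarrow> op_of q \<pi> (uq_f q) gen_x = 0"
    by (subst qcoord_eq_iff[where q=q]) (simp_all add: cl op_of_def qelem_gens qcoord_simps)
  moreover have "\<pi> (uq_f q) (qp_y q) = d0 \<odot>\<^bsub>qplane q\<^esub> \<one>\<^bsub>qplane q\<^esub> \<longleftrightarrow>
      op_of q \<pi> (uq_f q) gen_y = scl d0 (mon (0, 0))"
    by (subst qcoord_eq_iff[where q=q]) (simp_all add: cl op_of_def qelem_gens qcoord_simps)
  ultimately show ?thesis unfolding w given_by_def qgiven_def Let_def by simp
qed

lemma qgiven_param_unique:
  assumes "qgiven q K E F w" "qgiven q K E F w'"
  shows "w = w'"
proof -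
  obtain d s t where w: "w = (d, s, t)" by (cases w)
  obtain d' s' t' where w': "w' = (d', s', t')" by (cases w')
  have "scl d (mon (0, 0)) = scl d' (mon (0, 0))"
    "scl (- q * inverse d) (mon (Suc 0, Suc 0)) + scl s (mon (3, 0)) =
      scl (- q * inverse d') (mon (Suc 0, Suc 0)) + scl s' (mon (3, 0))"
    "scl (- q * inverse d) (mon (0, 2)) + scl t (mon (4, 0)) =
      scl (- q * inverse d') (mon (0, 2)) + scl t' (mon (4, 0))"
    using assms by (auto simp: qgiven_def w w')
  from this(1)[THEN arg_cong, of "\<lambda>p. lookup p (0, 0)"] this(2)[THEN arg_cong, of "\<lambda>p. lookup p (3, 0)"]
    this(3)[THEN arg_cong, of "\<lambda>p. lookup p (4, 0)"]
  show ?thesis by (simp add: w w' lookup_add lookup_mon)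
qed

section \<open>Isomorphisms\<close>

lemma structure_iso_op:
  assumes "isomorphic_structures (Uq q) (qplane q) \<pi>1 \<pi>2"
    and \<pi>1: "\<pi>1 \<in> uq_structures q"
  shows "\<exists>\<Psi>. qend q \<Psi> \<and> bij \<Psi> \<and>
    (\<forall>u\<in>carrier (uq_algebra q). \<forall>p. \<Psi> (op_of q \<pi>1 u p) = op_of q \<pi>2 u (\<Psi> p))"
proof -
  from assms(1) obtain f where f: "f \<in> alg_hom (qplane q) (qplane q)" and
    b: "bij_betw f (carrier (qplane q)) (carrier (qplane q))" and
    r: "\<And>u a. u \<in> carrier (uq_algebra q) \<Longrightarrow> a \<in> carrier (qplane q) \<Longrightarrow>
      f (\<pi>1 u (inv_into (carrier (qplane q)) f a)) = \<pi>2 u a"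
    unfolding isomorphic_structures_def Uq_simps by blast
  note h = alg_homD[OF f]
  define \<Psi> where "\<Psi> = (\<lambda>p. qcoord q (f (qelem q p)))"
  have "qend q \<Psi>"
    unfolding qend_def lin_def \<Psi>_def
    by (simp add: qelem_add qelem_scl qelem_mult h qcoord_simps qelem_gens)
  moreover have "bij \<Psi>"
  proof (rule bijI)
    show "inj \<Psi>"
    proof (rule injI)
      fix p r assume "\<Psi> p = \<Psi> r"
      then have "f (qelem q p) = f (qelem q r)"
        unfolding \<Psi>_def by (intro qcoord_inject[where q=q]) (simp_all add: h)
      then have "qelem q p = qelem q r"
        using inj_onD[OF bij_betw_imp_inj_on[OF b]] by simp
      then have "qcoord q (qelem q p) = qcoord q (qelem q r)" by simp
      then show "p = r" by simp
    qed
    show "surj \<Psi>"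
    proof (rule surjI)
      fix p
      have "f (inv_into (carrier (qplane q)) f (qelem q p)) = qelem q p"
        by (rule bij_betw_inv_into_right[OF b]) simp
      moreover have "inv_into (carrier (qplane q)) f (qelem q p) \<in> carrier (qplane q)"
        using bij_betw_apply[OF bij_betw_inv_into[OF b]] by simp
      ultimately show "\<Psi> (qcoord q (inv_into (carrier (qplane q)) f (qelem q p))) = p"
        by (simp add: \<Psi>_def)
    qed
  qed
  moreover have "\<Psi> (op_of q \<pi>1 u p) = op_of q \<pi>2 u (\<Psi> p)" if u: "u \<in> carrier (uq_algebra q)" for u p
  proof -
    have "inv_into (carrier (qplane q)) f (f (qelem q p)) = qelem q p"
      by (rule bij_betw_inv_into_left[OF b]) simp
    then have "f (\<pi>1 u (qelem q p)) = \<pi>2 u (f (qelem q p))"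
      using r[OF u h(1)[OF qelem_closed], of p] by simp
    then show ?thesis
      using structure_closed[OF \<pi>1 u qelem_closed] h(1)[OF qelem_closed]
      by (simp add: \<Psi>_def op_of_def)
  qed
  ultimately show ?thesis by blast
qed

text \<open>
  The intertwining automorphism is diagonal, and transport of the values on \<open>x\<close> and \<open>y\<close> yields the
  parameters of the second structure.  In particular, a structure isomorphic to a member of the family
  belongs to the family.
\<close>

lemma structure_iso_param:
  assumes q: "q \<noteq> 0" "\<forall>n::nat. 0 < n \<longrightarrow> q ^ n \<noteq> 1"
    and \<pi>1: "\<pi>1 \<in> uq_structures q" and \<pi>2: "\<pi>2 \<in> uq_structures q"
    and iso: "isomorphic_structures (Uq q) (qplane q) \<pi>1 \<pi>2"
    and w: "given_by q \<pi>1 (d0, s, t)" and d0: "d0 \<noteq> 0"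
  shows "\<exists>\<alpha> \<beta>. \<alpha> \<noteq> 0 \<and> \<beta> \<noteq> 0 \<and> given_by q \<pi>2 (d0 / \<beta>, s * \<alpha>\<^sup>2, t * \<alpha> ^ 4 / \<beta>)"
proof -
  obtain \<Psi> where \<Psi>: "qend q \<Psi>" "bij \<Psi>" and
    c: "\<And>u p. u \<in> carrier (uq_algebra q) \<Longrightarrow> \<Psi> (op_of q \<pi>1 u p) = op_of q \<pi>2 u (\<Psi> p)"
    using structure_iso_op[OF iso \<pi>1] by blast
  obtain \<alpha> \<beta> where nz: "\<alpha> \<noteq> 0" "\<beta> \<noteq> 0" and x: "\<Psi> gen_x = scl \<alpha> gen_x"
    and y: "\<Psi> gen_y = scl \<beta> gen_y"
    by (rule aut_diagonal[OF q \<Psi>])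
  note \<Psi>mon = qend_diagonal[OF \<Psi>(1) x y]
  have l: "lin \<Psi>" using \<Psi>(1) by (simp add: qend_def)
  note S2 = structure_qstruct[OF q(1) \<pi>2] note S2D = qstructD[OF S2]
  note g1 = w[unfolded given_by_iff[OF \<pi>1] qgiven_def, simplified]
  have *: "op_of q \<pi>2 u gen_x = scl (inverse \<alpha>) (\<Psi> (op_of q \<pi>1 u gen_x))"
    "op_of q \<pi>2 u gen_y = scl (inverse \<beta>) (\<Psi> (op_of q \<pi>1 u gen_y))"
    if u: "u \<in> carrier (uq_algebra q)" and lu: "lin (op_of q \<pi>2 u)" for u
    using c[OF u] x y nz by (simp_all add: linD[OF lu])
  have "given_by q \<pi>2 (d0 / \<beta>, s * \<alpha>\<^sup>2, t * \<alpha> ^ 4 / \<beta>)"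
    unfolding given_by_iff[OF \<pi>2] qgiven_def
    using nz g1 d0
    by (simp add: * S2D(1-4) linD[OF l] lin_zero[OF l] \<Psi>mon scl_add_right)
      (simp add: field_simps power2_eq_square power3_eq_cube)
  then show ?thesis using nz by blast
qed

lemma qstruct_conjugate:
  assumes S: "qstruct q K K' E F" and \<Psi>: "qend q \<Psi>" and \<Phi>: "qend q \<Phi>"
    and inv: "\<And>p. \<Phi> (\<Psi> p) = p" "\<And>p. \<Psi> (\<Phi> p) = p"
  shows "qstruct q (\<lambda>p. \<Psi> (K (\<Phi> p))) (\<lambda>p. \<Psi> (K' (\<Phi> p))) (\<lambda>p. \<Psi> (E (\<Phi> p))) (\<lambda>p. \<Psi> (F (\<Phi> p)))"
proof -
  have l: "lin \<Psi>" "lin \<Phi>" using \<Psi> \<Phi> by (simp_all add: qend_def)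
  have m: "\<Psi> (qm q p r) = qm q (\<Psi> p) (\<Psi> r)" "\<Phi> (qm q p r) = qm q (\<Phi> p) (\<Phi> r)"
    "\<Psi> (mon (0, 0)) = mon (0, 0)" "\<Phi> (mon (0, 0)) = mon (0, 0)" for p r
    using \<Psi> \<Phi> by (simp_all add: qend_def)
  note S = qstructD[OF S]
  have EF: "\<Psi> (E (F p)) - \<Psi> (F (E p)) = scl (1 / (q - inverse q)) (\<Psi> (K p) - \<Psi> (K' p))" for p
  proof -
    have "\<Psi> (E (F p) - F (E p)) = \<Psi> (scl (1 / (q - inverse q)) (K p - K' p))" by (simp only: S(9))
    then show ?thesis by (simp only: lin_diff[OF l(1)] linD[OF l(1)])
  qed
  have KE: "\<Psi> (K (E p)) = scl (q\<^sup>2) (\<Psi> (E (K p)))" "\<Psi> (K (F p)) = scl (inverse (q\<^sup>2)) (\<Psi> (F (K p)))" for p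
    by (simp_all only: S(7,8) linD[OF l(1)])
  have ll: "lin (\<lambda>p. \<Psi> (K (\<Phi> p)))" "lin (\<lambda>p. \<Psi> (K' (\<Phi> p)))" "lin (\<lambda>p. \<Psi> (E (\<Phi> p)))" "lin (\<lambda>p. \<Psi> (F (\<Phi> p)))"
    by (intro lin_comp[OF l(1)] lin_comp[OF S(1)] lin_comp[OF S(2)] lin_comp[OF S(3)] lin_comp[OF S(4)] l)+
  have KK: "\<Psi> (K' (\<Phi> (\<Psi> (K (\<Phi> p))))) = p" "\<Psi> (K (\<Phi> (\<Psi> (K' (\<Phi> p))))) = p" for p
    by (simp_all add: inv S(5,6))
  have Km: "\<Psi> (K (\<Phi> (qm q p r))) = qm q (\<Psi> (K (\<Phi> p))) (\<Psi> (K (\<Phi> r)))"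
    "\<Psi> (K' (\<Phi> (qm q p r))) = qm q (\<Psi> (K' (\<Phi> p))) (\<Psi> (K' (\<Phi> r)))"
    "\<Psi> (E (\<Phi> (qm q p r))) = qm q p (\<Psi> (E (\<Phi> r))) + qm q (\<Psi> (E (\<Phi> p))) (\<Psi> (K (\<Phi> r)))"
    "\<Psi> (F (\<Phi> (qm q p r))) = qm q (\<Psi> (F (\<Phi> p))) r + qm q (\<Psi> (K' (\<Phi> p))) (\<Psi> (F (\<Phi> r)))" for p r
    by (simp_all only: m S(10-13) linD[OF l(1)] inv)
  show ?thesis
    unfolding qstruct_def
    by (simp add: ll KK[unfolded inv] inv KE EF Km[unfolded m(2)] m S(14-17) lin_zero[OF l(1)])
qed

definition diag :: "complex \<Rightarrow> complex \<Rightarrow> qpoly \<Rightarrow> qpoly" where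
  "diag \<alpha> \<beta> = lext (\<lambda>(m, n). scl (\<alpha> ^ m * \<beta> ^ n) (mon (m, n)))"

lemma diag_mon: "diag \<alpha> \<beta> (mon (m, n)) = scl (\<alpha> ^ m * \<beta> ^ n) (mon (m, n))"
  by (simp add: diag_def)

lemma lin_diag: "lin (diag \<alpha> \<beta>)"
  unfolding diag_def by (rule lin_lext)

lemma qend_diag: "qend q (diag \<alpha> \<beta>)"
proof -
  have "diag \<alpha> \<beta> (qm q p r) = qm q (diag \<alpha> \<beta> p) (diag \<alpha> \<beta> r)" for p r
  proof (rule qm_eqI[of "\<lambda>p r. diag \<alpha> \<beta> (qm q p r)" "\<lambda>p r. qm q (diag \<alpha> \<beta> p) (diag \<alpha> \<beta> r)"])
    fix i j show "diag \<alpha> \<beta> (qm q (mon i) (mon j)) = qm q (diag \<alpha> \<beta> (mon i)) (diag \<alpha> \<beta> (mon j))"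
      by (cases i; cases j) (simp add: diag_mon linD[OF lin_diag] qm_mon qm_simps power_add mult_ac)
  qed (intro lin_comp[OF lin_diag] lin_comp[OF lin_qm(1)] lin_comp[OF lin_qm(2)] lin_qm lin_diag)+
  then show ?thesis by (simp add: qend_def lin_diag diag_mon)
qed

lemma diag_inverse:
  assumes "\<alpha> \<noteq> 0" "\<beta> \<noteq> 0"
  shows "diag \<alpha> \<beta> (diag (inverse \<alpha>) (inverse \<beta>) p) = p" "diag (inverse \<alpha>) (inverse \<beta>) (diag \<alpha> \<beta> p) = p"
proof -
  have c: "\<alpha> ^ m * \<beta> ^ n * (inverse \<alpha> ^ m * inverse \<beta> ^ n) = 1" for m n
    using assms by (simp add: field_simps)
  have "diag \<alpha> \<beta> (diag (inverse \<alpha>) (inverse \<beta>) (mon i)) = mon i \<and>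
      diag (inverse \<alpha>) (inverse \<beta>) (diag \<alpha> \<beta> (mon i)) = mon i" for i
    by (cases i) (simp only: diag_mon linD[OF lin_diag] scl_simps c mult.commute[of "inverse _ ^ _ * _"] simp_thms)
  then show "diag \<alpha> \<beta> (diag (inverse \<alpha>) (inverse \<beta>) p) = p" "diag (inverse \<alpha>) (inverse \<beta>) (diag \<alpha> \<beta> p) = p"
    using lin_eqI[OF lin_comp[OF lin_diag lin_diag] lin_id] by blast+
qed

text \<open>
  The conjugate of the first triple of operators by the diagonal automorphism has the parameters of
  the second one, so they coincide by \<open>qstruct_unique\<close>.  Compatibility with the generators extends to
  the whole algebra.
\<close>

lemma structure_iso_diag:
  assumes q: "q \<noteq> 0"
    and \<pi>1: "\<pi>1 \<in> uq_structures q" and \<pi>2: "\<pi>2 \<in> uq_structures q"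
    and w1: "given_by q \<pi>1 (d0, s, t)" and d0: "d0 \<noteq> 0" and nz: "\<alpha> \<noteq> 0" "\<beta> \<noteq> 0"
    and w2: "given_by q \<pi>2 (d0 / \<beta>, s * \<alpha>\<^sup>2, t * \<alpha> ^ 4 / \<beta>)"
  shows "isomorphic_structures (Uq q) (qplane q) \<pi>1 \<pi>2"
proof -
  define \<Psi> \<Phi> where "\<Psi> = diag \<alpha> \<beta>" and "\<Phi> = diag (inverse \<alpha>) (inverse \<beta>)"
  have l: "lin \<Psi>" "lin \<Phi>" by (simp_all add: \<Psi>_def \<Phi>_def lin_diag)
  have inv: "\<Phi> (\<Psi> p) = p" "\<Psi> (\<Phi> p) = p" for p
    using diag_inverse[OF nz] by (simp_all add: \<Psi>_def \<Phi>_def)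
  note S1 = structure_qstruct[OF q \<pi>1] and S2 = structure_qstruct[OF q \<pi>2]
  note S1D = qstructD[OF S1]
  have "qend q \<Psi>" "qend q \<Phi>" by (simp_all add: \<Psi>_def \<Phi>_def qend_diag)
  note C = qstruct_conjugate[OF S1 this inv]
  note g1 = w1[unfolded given_by_iff[OF \<pi>1] qgiven_def, simplified]
  have "qgiven q (\<lambda>p. \<Psi> (op_of q \<pi>1 (uq_k q) (\<Phi> p))) (\<lambda>p. \<Psi> (op_of q \<pi>1 (uq_e q) (\<Phi> p)))
      (\<lambda>p. \<Psi> (op_of q \<pi>1 (uq_f q) (\<Phi> p))) (d0 / \<beta>, s * \<alpha>\<^sup>2, t * \<alpha> ^ 4 / \<beta>)"
    unfolding qgiven_def \<Psi>_def \<Phi>_def using g1 nz d0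
    by (simp add: diag_mon linD[OF lin_diag] lin_zero[OF lin_diag] linD[OF S1D(1)] linD[OF S1D(3)]
        linD[OF S1D(4)] scl_add_right)
      (simp add: field_simps power2_eq_square power3_eq_cube)
  note eq = qstruct_unique[OF C S2 this w2[unfolded given_by_iff[OF \<pi>2]]]
  define f where "f = (\<lambda>a. qelem q (\<Psi> (qcoord q a)))"
  have f: "f \<in> alg_hom (qplane q) (qplane q)"
    using qend_diag[of q \<alpha> \<beta>]
    by (intro alg_homI) (simp_all add: f_def qend_def \<Psi>_def qcoord_simps linD[OF lin_diag] qelem_mult qelem_add qelem_scl qelem_gens)
  have b: "bij_betw f (carrier (qplane q)) (carrier (qplane q))"
    by (rule bij_betw_byWitness[where f' = "\<lambda>a. qelem q (\<Phi> (qcoord q a))"]) (auto simp: f_def inv)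
  note h1 = alg_homD[OF structureD(1)[OF \<pi>1]] and h2 = alg_homD[OF structureD(1)[OF \<pi>2]]
  note hf = alg_homD[OF f]
  note cl1 = structure_closed[OF \<pi>1] and cl2 = structure_closed[OF \<pi>2]
  have gen: "f (\<pi>1 u a) = \<pi>2 u (f a)"
    if a: "a \<in> carrier (qplane q)" and u: "u \<in> carrier (uq_algebra q)" and
      e: "(\<lambda>p. \<Psi> (op_of q \<pi>1 u (\<Phi> p))) = op_of q \<pi>2 u" for u a
  proof (rule qcoord_inject)
    have "qcoord q (f (\<pi>1 u a)) = \<Psi> (op_of q \<pi>1 u (\<Phi> (\<Psi> (qcoord q a))))"
      using a by (simp add: f_def op_of_def inv)
    also have "\<dots> = op_of q \<pi>2 u (\<Psi> (qcoord q a))" using e by metis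
    also have "\<dots> = qcoord q (\<pi>2 u (f a))" by (simp add: op_of_def f_def)
    finally show "qcoord q (f (\<pi>1 u a)) = qcoord q (\<pi>2 u (f a))" .
  qed (use a u in \<open>simp_all add: hf cl1 cl2\<close>)
  have step: "f (\<pi>1 (g \<otimes>\<^bsub>uq_algebra q\<^esub> u) a) = \<pi>2 (g \<otimes>\<^bsub>uq_algebra q\<^esub> u) (f a)"
    if g: "g \<in> carrier (uq_algebra q)" "(\<lambda>p. \<Psi> (op_of q \<pi>1 g (\<Phi> p))) = op_of q \<pi>2 g"
      and u: "u \<in> carrier (uq_algebra q)" and IH: "\<forall>a\<in>carrier (qplane q). f (\<pi>1 u a) = \<pi>2 u (f a)"
      and a: "a \<in> carrier (qplane q)" for g u a
  proof -
    have "\<pi>1 (g \<otimes>\<^bsub>uq_algebra q\<^esub> u) a = \<pi>1 g (\<pi>1 u a)"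
      using g u a by (simp add: h1 Q.lin_end_apply)
    moreover have "\<pi>2 (g \<otimes>\<^bsub>uq_algebra q\<^esub> u) (f a) = \<pi>2 g (\<pi>2 u (f a))"
      using g u a by (simp add: h2 Q.lin_end_apply hf)
    ultimately show ?thesis using gen[OF cl1[OF u a] g] IH a by simp
  qed
  have all: "\<forall>a\<in>carrier (qplane q). f (\<pi>1 u a) = \<pi>2 u (f a)" if u: "u \<in> carrier (uq_algebra q)" for u
    using u
  proof (induction u rule: uq_induct)
    case one
    then show ?case by (simp add: h1(5) h2(5) Q.lin_end_apply hf)
  next
    case (add u v)
    then show ?case by (simp add: h1(3) h2(3) Q.lin_end_apply hf cl1)
  next
    case (smult c u)
    then show ?case by (simp add: h1(4) h2(4) Q.lin_end_apply hf cl1)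
  qed (simp_all add: step eq)
  show ?thesis
    unfolding isomorphic_structures_def Uq_simps
  proof (intro bexI[OF _ f] conjI b ballI)
    fix u a assume u: "u \<in> carrier (uq_algebra q)" and a: "a \<in> carrier (qplane q)"
    have "inv_into (carrier (qplane q)) f a \<in> carrier (qplane q)"
      using bij_betw_apply[OF bij_betw_inv_into[OF b] a] .
    then show "f (\<pi>1 u (inv_into (carrier (qplane q)) f a)) = \<pi>2 u a"
      using all[OF u] bij_betw_inv_into_right[OF b a] by simp
  qed
qed

section \<open>The parameter subsets\<close>

text \<open>
  The vanishing of \<open>s\<close> and of \<open>t\<close> and, where both are nonzero, the quotient \<open>t / (d s\<^sup>2)\<close> are
  invariants.  Conversely \<open>\<beta>\<close> is determined by \<open>d\<close> and \<open>d'\<close>, and \<open>\<alpha>\<close> is found as a square root of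
  \<open>s'/s\<close> or, if \<open>s\<close> vanishes, as a fourth root.
\<close>

lemma param_orbits:
  assumes "d \<noteq> 0" "d' \<noteq> 0"
  shows "(\<exists>\<alpha> \<beta>. \<alpha> \<noteq> 0 \<and> \<beta> \<noteq> 0 \<and> d' = d / \<beta> \<and> s' = s * \<alpha>\<^sup>2 \<and> t' = t * \<alpha> ^ 4 / \<beta>) \<longleftrightarrow>
    (\<exists>C\<in>phi_subsets \<union> special_subsets. (d, s, t) \<in> C \<and> (d', s', t') \<in> C)" (is "?L \<longleftrightarrow> ?R")
proof -
  have R: "?R \<longleftrightarrow> (s = 0 \<longleftrightarrow> s' = 0) \<and> (t = 0 \<longleftrightarrow> t' = 0) \<and>
      (s \<noteq> 0 \<and> t \<noteq> 0 \<longrightarrow> t' / (d' * s'\<^sup>2) = t / (d * s\<^sup>2))"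
    (is "_ \<longleftrightarrow> ?R'")
  proof
    assume ?R then show ?R' by (auto simp: phi_subsets_def special_subsets_def)
  next
    assume R': ?R'
    show ?R
    proof (cases "s \<noteq> 0 \<and> t \<noteq> 0")
      case True
      then have "t / (d * s\<^sup>2) \<noteq> 0" using assms by simp
      define P where "P = {(d0, s0, t0). d0 \<noteq> 0 \<and> s0 \<noteq> 0 \<and> t0 \<noteq> 0 \<and> t0 / (d0 * s0\<^sup>2) = t / (d * s\<^sup>2)}"
      have "P \<in> phi_subsets" unfolding P_def phi_subsets_def using \<open>t / (d * s\<^sup>2) \<noteq> 0\<close> by blast
      moreover have "(d, s, t) \<in> P" "(d', s', t') \<in> P" using True R' assms by (auto simp: P_def)
      ultimately show ?thesis by blast
    next
      case False
      then show ?thesis using R' assms by (auto simp: special_subsets_def)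
    qed
  qed
  show ?thesis unfolding R
  proof
    assume ?L then show ?R' using assms
      by (auto simp: field_simps power2_eq_square power4_eq_xxxx)
  next
    assume R': ?R'
    define \<beta> where "\<beta> = d / d'"
    have \<beta>: "\<beta> \<noteq> 0" "d' = d / \<beta>" using assms by (simp_all add: \<beta>_def)
    have "\<exists>\<alpha>. \<alpha> \<noteq> 0 \<and> s' = s * \<alpha>\<^sup>2 \<and> t' = t * \<alpha> ^ 4 / \<beta>"
    proof (cases "s = 0")
      case False
      define \<alpha> where "\<alpha> = csqrt (s' / s)"
      have a2: "\<alpha>\<^sup>2 = s' / s" by (simp add: \<alpha>_def)
      then have a: "\<alpha> \<noteq> 0" using False R' by (metis divide_eq_0_iff zero_power2)
      have "\<alpha> ^ 4 = (s' / s)\<^sup>2" using a2 by (simp add: power4_eq_xxxx power2_eq_square mult.assoc)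
      then have "t' = t * \<alpha> ^ 4 / \<beta>"
        using R' False assms by (cases "t = 0") (auto simp: \<beta>_def field_simps power2_eq_square)
      then show ?thesis using a a2 False by auto
    next
      case s: True
      show ?thesis
      proof (cases "t = 0")
        case True
        then show ?thesis using s R' by (intro exI[of _ 1]) simp
      next
        case False
        define \<alpha> where "\<alpha> = csqrt (csqrt (t' * \<beta> / t))"
        have "\<alpha> ^ 4 = (\<alpha>\<^sup>2)\<^sup>2" by (simp add: power4_eq_xxxx power2_eq_square mult.assoc)
        then have a4: "\<alpha> ^ 4 = t' * \<beta> / t" by (simp add: \<alpha>_def)
        then have "\<alpha> \<noteq> 0" using False R' \<beta> by (auto simp: power_0_left)
        then show ?thesis using a4 False R' s \<beta> by (intro exI[of _ \<alpha>]) simp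
      qed
    qed
    then show ?L using \<beta> by blast
  qed
qed

lemma param_subset_facts:
  "C \<in> phi_subsets \<union> special_subsets \<Longrightarrow> C \<subseteq> params"
  "C \<in> phi_subsets \<union> special_subsets \<Longrightarrow> C \<noteq> {}"
  "w \<in> params \<Longrightarrow> \<exists>C\<in>phi_subsets \<union> special_subsets. w \<in> C"
  "C \<in> phi_subsets \<union> special_subsets \<Longrightarrow> D \<in> phi_subsets \<union> special_subsets \<Longrightarrow> w \<in> C \<Longrightarrow> w \<in> D \<Longrightarrow> C = D"
  "C \<in> phi_subsets \<Longrightarrow> C \<in> special_subsets \<Longrightarrow> False"
proof -
  have phi: "\<exists>w. w \<in> C \<and> fst (snd w) \<noteq> 0 \<and> snd (snd w) \<noteq> 0" if "C \<in> phi_subsets" for C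
  proof -
    from that obtain \<phi> where "\<phi> \<noteq> 0"
      "C = {(d0, s, t). d0 \<noteq> 0 \<and> s \<noteq> 0 \<and> t \<noteq> 0 \<and> t / (d0 * s\<^sup>2) = \<phi>}" by (auto simp: phi_subsets_def)
    then have "(1, 1, \<phi>) \<in> C" by simp
    then show ?thesis using \<open>\<phi> \<noteq> 0\<close> by force
  qed
  have spec: "(1::complex, 1::complex, 0) \<in> {(d0, s, t). d0 \<noteq> 0 \<and> s \<noteq> 0 \<and> t = (0::complex)}"
    "(1::complex, 0::complex, 1) \<in> {(d0, s, t). d0 \<noteq> 0 \<and> s = 0 \<and> t \<noteq> (0::complex)}"
    "(1::complex, 0::complex, 0) \<in> {(d0, s, t). d0 \<noteq> 0 \<and> s = 0 \<and> t = (0::complex)}" by auto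
  show "C \<in> phi_subsets \<union> special_subsets \<Longrightarrow> C \<subseteq> params"
    by (auto simp: phi_subsets_def special_subsets_def params_def)
  show "C \<in> phi_subsets \<union> special_subsets \<Longrightarrow> C \<noteq> {}"
    using phi spec unfolding special_subsets_def by blast
  show "w \<in> params \<Longrightarrow> \<exists>C\<in>phi_subsets \<union> special_subsets. w \<in> C"
  proof -
    assume "w \<in> params"
    then obtain d s t where w: "w = (d, s, t)" "d \<noteq> 0" by (auto simp: params_def)
    have "\<exists>\<alpha> \<beta>. \<alpha> \<noteq> 0 \<and> \<beta> \<noteq> 0 \<and> d = d / \<beta> \<and> s = s * \<alpha>\<^sup>2 \<and> t = t * \<alpha> ^ 4 / \<beta>"
      by (rule exI[of _ 1], rule exI[of _ 1]) simp
    then show ?thesis using param_orbits[OF w(2,2)] w(1) by blast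
  qed
  show "C \<in> phi_subsets \<union> special_subsets \<Longrightarrow> D \<in> phi_subsets \<union> special_subsets \<Longrightarrow> w \<in> C \<Longrightarrow> w \<in> D \<Longrightarrow> C = D"
    by (auto simp: phi_subsets_def special_subsets_def)
  show "C \<in> phi_subsets \<Longrightarrow> C \<in> special_subsets \<Longrightarrow> False"
    using phi[of C] by (auto simp: special_subsets_def)
qed

lemma phi_partition: "partition_on {(d0, s, t). d0 \<noteq> 0 \<and> s \<noteq> 0 \<and> t \<noteq> 0} phi_subsets"
proof (rule partition_onI)
  show "\<Union> phi_subsets = {(d0, s, t). d0 \<noteq> 0 \<and> s \<noteq> 0 \<and> t \<noteq> 0}"
  proof (intro equalityI subsetI)
    fix w assume "w \<in> \<Union> phi_subsets"
    then show "w \<in> {(d0, s, t). d0 \<noteq> 0 \<and> s \<noteq> 0 \<and> t \<noteq> 0}" by (auto simp: phi_subsets_def)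
  next
    fix w :: param assume "w \<in> {(d0, s, t). d0 \<noteq> 0 \<and> s \<noteq> 0 \<and> t \<noteq> 0}"
    moreover from this have "w \<in> params" by (auto simp: params_def)
    then obtain C where "C \<in> phi_subsets \<union> special_subsets" "w \<in> C" using param_subset_facts(3) by blast
    ultimately show "w \<in> \<Union> phi_subsets" by (auto simp: special_subsets_def)
  qed
  show "{} \<notin> phi_subsets" using param_subset_facts(2) by blast
  show "disjnt C D" if "C \<in> phi_subsets" "D \<in> phi_subsets" "C \<noteq> D" for C D
    using param_subset_facts(4) that unfolding disjnt_iff by blast
qed

lemma phi_uncountable: "uncountable phi_subsets"
proof
  assume c: "countable phi_subsets"
  define P where "P = (\<lambda>\<phi>. {(d0, s, t). d0 \<noteq> 0 \<and> s \<noteq> 0 \<and> t \<noteq> 0 \<and> t / (d0 * s\<^sup>2) = (\<phi>::complex)})"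
  have "inj_on P (- {0})"
  proof (rule inj_onI)
    fix \<phi> \<psi> assume "\<phi> \<in> - {0}" and eq: "P \<phi> = P \<psi>"
    from this(1) have "(1, 1, \<phi>) \<in> P \<phi>" by (simp add: P_def)
    then have "(1, 1, \<phi>) \<in> P \<psi>" unfolding eq .
    then show "\<phi> = \<psi>" by (simp add: P_def)
  qed
  moreover have "P ` (- {0}) = phi_subsets" by (auto simp: phi_subsets_def P_def)
  ultimately have "countable (- {0} :: complex set)" using c by (metis countable_image_inj_on)
  then have "countable (insert 0 (- {0}) :: complex set)" by simp
  moreover have "insert 0 (- {0}) = (UNIV :: complex set)" by auto
  ultimately show False using uncountable_UNIV_complex by simp
qed

lemma card_special: "card special_subsets = 3"
proof -
  let ?A = "{(d0::complex, s::complex, t::complex). d0 \<noteq> 0 \<and> s \<noteq> 0 \<and> t = 0}"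
  let ?B = "{(d0::complex, s::complex, t::complex). d0 \<noteq> 0 \<and> s = 0 \<and> t \<noteq> 0}"
  let ?C = "{(d0::complex, s::complex, t::complex). d0 \<noteq> 0 \<and> s = 0 \<and> t = 0}"
  have "(1, 1, 0) \<in> ?A" "(1, 1, 0) \<notin> ?B" "(1, 1, 0) \<notin> ?C" "(1, 0, 1) \<in> ?B" "(1, 0, 1) \<notin> ?C" by auto
  then have "?A \<noteq> ?B" "?A \<noteq> ?C" "?B \<noteq> ?C" by metis+
  then show ?thesis unfolding special_subsets_def by simp
qed

section \<open>The series\<close>

context
  fixes q :: complex
  assumes q0: "q \<noteq> 0" and q_root: "\<forall>n::nat. 0 < n \<longrightarrow> q ^ n \<noteq> 1"
begin

lemma structure_exists_unique:
  assumes w: "w \<in> params"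
  shows "\<exists>!\<pi>. \<pi> \<in> uq_structures q \<and> given_by q \<pi> w"
proof -
  obtain K K' E F where S: "qstruct q K K' E F" and g: "qgiven q K E F w"
    using family_qstruct[OF q0 q_root w] by blast
  obtain \<pi> where \<pi>: "\<pi> \<in> uq_structures q" "op_of q \<pi> (uq_k q) = K" "op_of q \<pi> (uq_kinv q) = K'"
    "op_of q \<pi> (uq_e q) = E" "op_of q \<pi> (uq_f q) = F"
    using qstruct_structure[OF q0 S] by blast
  show ?thesis
  proof (rule ex1I[of _ \<pi>])
    show "\<pi> \<in> uq_structures q \<and> given_by q \<pi> w" using \<pi> g by (simp add: given_by_iff)
    fix \<pi>' assume "\<pi>' \<in> uq_structures q \<and> given_by q \<pi>' w"
    then have \<pi>': "\<pi>' \<in> uq_structures q" "given_by q \<pi>' w" by auto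
    note eq = qstruct_unique[OF structure_qstruct[OF q0 \<pi>'(1)] S \<pi>'(2)[unfolded given_by_iff[OF \<pi>'(1)]] g]
    show "\<pi>' = \<pi>" by (rule structure_eqI[OF \<pi>'(1) \<pi>(1)]) (simp_all add: eq \<pi>)
  qed
qed

lemma given_by_param_unique:
  "\<pi> \<in> uq_structures q \<Longrightarrow> given_by q \<pi> w \<Longrightarrow> given_by q \<pi> w' \<Longrightarrow> w = w'"
  using qgiven_param_unique by (simp add: given_by_iff)

lemma given_by_exists:
  assumes \<pi>: "\<pi> \<in> uq_structures q" and f: "qp_proj q 0 (\<pi> (uq_f q) (qp_y q)) \<noteq> \<zero>\<^bsub>qplane q\<^esub>"
  shows "\<exists>w\<in>params. given_by q \<pi> w"
proof -
  have "lookup (op_of q \<pi> (uq_f q) gen_y) (0, 0) \<noteq> 0"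
    using f unfolding qp_proj_zero_iff[OF structure_closed[OF \<pi> uq_gen_closed(4) qp_gen_closed(2)]]
    by (simp add: op_of_def qelem_gens)
  then show ?thesis
    using qstruct_classify[OF q0 q_root structure_qstruct[OF q0 \<pi>]] given_by_iff[OF \<pi>] by blast
qed

lemma series_eq: "series q = structures_of q params"
proof (intro equalityI subsetI)
  fix \<pi> assume "\<pi> \<in> series q"
  then show "\<pi> \<in> structures_of q params"
    using given_by_exists by (simp add: series_def structures_of_def)
next
  fix \<pi> assume "\<pi> \<in> structures_of q params"
  then obtain d0 s t where \<pi>: "\<pi> \<in> uq_structures q" and d0: "d0 \<noteq> 0" and g: "given_by q \<pi> (d0, s, t)"
    by (auto simp: structures_of_def params_def)
  note p = qp_proj_zero_iff[OF structure_closed[OF \<pi>]]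
  have c: "qcoord q (\<pi> u (qp_x q)) = op_of q \<pi> u gen_x"
    "qcoord q (\<pi> u (qp_y q)) = op_of q \<pi> u gen_y" for u
    by (simp_all add: op_of_def qelem_gens)
  show "\<pi> \<in> series q"
    unfolding series_def using \<pi> g[unfolded given_by_iff[OF \<pi>]] d0
    by (auto simp: p c qgiven_def lookup_add lookup_mon)
qed

lemma iso_rel_iff:
  assumes \<pi>1: "\<pi>1 \<in> uq_structures q" and \<pi>2: "\<pi>2 \<in> uq_structures q"
    and p1: "p1 \<in> params" and g1: "given_by q \<pi>1 p1"
  shows "(\<pi>1, \<pi>2) \<in> iso_rel q \<longleftrightarrow>
    (\<exists>p2\<in>params. given_by q \<pi>2 p2 \<and> (\<exists>C\<in>phi_subsets \<union> special_subsets. p1 \<in> C \<and> p2 \<in> C))"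
proof -
  obtain d s t where w1: "p1 = (d, s, t)" and d: "d \<noteq> 0" using p1 by (auto simp: params_def)
  have "(\<pi>1, \<pi>2) \<in> iso_rel q \<longleftrightarrow> isomorphic_structures (Uq q) (qplane q) \<pi>1 \<pi>2"
    using \<pi>1 \<pi>2 by (simp add: iso_rel_def structure_iso_rel_def uq_structures_def)
  also have "\<dots> \<longleftrightarrow> (\<exists>\<alpha> \<beta>. \<alpha> \<noteq> 0 \<and> \<beta> \<noteq> 0 \<and> given_by q \<pi>2 (d / \<beta>, s * \<alpha>\<^sup>2, t * \<alpha> ^ 4 / \<beta>))"
    using structure_iso_param[OF q0 q_root \<pi>1 \<pi>2 _ g1[unfolded w1] d]
      structure_iso_diag[OF q0 \<pi>1 \<pi>2 g1[unfolded w1] d] by blast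
  also have "\<dots> \<longleftrightarrow> (\<exists>d' s' t'. d' \<noteq> 0 \<and> given_by q \<pi>2 (d', s', t') \<and>
      (\<exists>\<alpha> \<beta>. \<alpha> \<noteq> 0 \<and> \<beta> \<noteq> 0 \<and> d' = d / \<beta> \<and> s' = s * \<alpha>\<^sup>2 \<and> t' = t * \<alpha> ^ 4 / \<beta>))"
  proof
    assume "\<exists>\<alpha> \<beta>. \<alpha> \<noteq> 0 \<and> \<beta> \<noteq> 0 \<and> given_by q \<pi>2 (d / \<beta>, s * \<alpha>\<^sup>2, t * \<alpha> ^ 4 / \<beta>)"
    then obtain \<alpha> \<beta> where "\<alpha> \<noteq> 0" "\<beta> \<noteq> 0" "given_by q \<pi>2 (d / \<beta>, s * \<alpha>\<^sup>2, t * \<alpha> ^ 4 / \<beta>)" by blast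
    then show "\<exists>d' s' t'. d' \<noteq> 0 \<and> given_by q \<pi>2 (d', s', t') \<and>
      (\<exists>\<alpha> \<beta>. \<alpha> \<noteq> 0 \<and> \<beta> \<noteq> 0 \<and> d' = d / \<beta> \<and> s' = s * \<alpha>\<^sup>2 \<and> t' = t * \<alpha> ^ 4 / \<beta>)"
      using d by (intro exI[of _ "d / \<beta>"] exI[of _ "s * \<alpha>\<^sup>2"] exI[of _ "t * \<alpha> ^ 4 / \<beta>"]) auto
  qed auto
  also have "\<dots> \<longleftrightarrow> (\<exists>d' s' t'. d' \<noteq> 0 \<and> given_by q \<pi>2 (d', s', t') \<and>
      (\<exists>C\<in>phi_subsets \<union> special_subsets. (d, s, t) \<in> C \<and> (d', s', t') \<in> C))"
    by (intro ex_cong1 conj_cong refl param_orbits[OF d])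
  also have "\<dots> \<longleftrightarrow> (\<exists>p2\<in>params. given_by q \<pi>2 p2 \<and> (\<exists>C\<in>phi_subsets \<union> special_subsets. p1 \<in> C \<and> p2 \<in> C))"
    unfolding w1 params_def by auto
  finally show ?thesis .
qed

text \<open>
  The class is formed among all structures on the plane; it consists of members of the family by
  \<open>structure_iso_param\<close>, which enters through \<open>iso_rel_iff\<close>.
\<close>

lemma iso_class:
  assumes C: "C \<in> phi_subsets \<union> special_subsets" and w: "w \<in> C"
    and \<pi>: "\<pi> \<in> uq_structures q" "given_by q \<pi> w"
  shows "iso_rel q `` {\<pi>} = structures_of q C"
proof -
  have "w \<in> params" using param_subset_facts(1) C w by blast
  note iff = iso_rel_iff[OF \<pi>(1) _ this \<pi>(2)]
  have "(\<pi>, \<pi>') \<in> iso_rel q \<longleftrightarrow> \<pi>' \<in> structures_of q C" for \<pi>'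
  proof (cases "\<pi>' \<in> uq_structures q")
    case True
    have "(\<exists>D\<in>phi_subsets \<union> special_subsets. w \<in> D \<and> w' \<in> D) \<longleftrightarrow> w' \<in> C" for w'
      using param_subset_facts(4) C w by blast
    then show ?thesis
      unfolding iff[OF True] structures_of_def using True param_subset_facts(1)[OF C] by auto
  next
    case False
    then show ?thesis by (simp add: iso_rel_def structure_iso_rel_def uq_structures_def structures_of_def)
  qed
  then show ?thesis by auto
qed

lemma structures_of_nonempty:
  assumes "C \<in> phi_subsets \<union> special_subsets"
  obtains w \<pi> where "w \<in> C" "\<pi> \<in> uq_structures q" "given_by q \<pi> w" "\<pi> \<in> structures_of q C"
proof -
  obtain w where w: "w \<in> C" using param_subset_facts(2) assms by blast
  then have "w \<in> params" using param_subset_facts(1) assms by blast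
  then obtain \<pi> where \<pi>: "\<pi> \<in> uq_structures q" "given_by q \<pi> w" using structure_exists_unique by blast
  then have "\<pi> \<in> structures_of q C" unfolding structures_of_def using w by blast
  then show ?thesis by (rule that[OF w \<pi>])
qed

lemma structures_of_inj: "inj_on (structures_of q) (phi_subsets \<union> special_subsets)"
proof (rule inj_onI)
  fix C D assume C: "C \<in> phi_subsets \<union> special_subsets" and D: "D \<in> phi_subsets \<union> special_subsets"
    and eq: "structures_of q C = structures_of q D"
  obtain w \<pi> where w: "w \<in> C" "\<pi> \<in> uq_structures q" "given_by q \<pi> w" "\<pi> \<in> structures_of q C"
    by (rule structures_of_nonempty[OF C])
  then have "\<pi> \<in> structures_of q D" using eq by simp
  then obtain w' where "w' \<in> D" "given_by q \<pi> w'" unfolding structures_of_def by blast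
  then have "w \<in> D" using given_by_param_unique w by blast
  then show "C = D" using param_subset_facts(4)[OF C D w(1)] by blast
qed

lemma series_quotient: "series q // iso_rel q = structures_of q ` (phi_subsets \<union> special_subsets)"
proof (intro equalityI subsetI)
  fix X assume "X \<in> series q // iso_rel q"
  then obtain \<pi> where \<pi>: "\<pi> \<in> series q" "X = iso_rel q `` {\<pi>}" by (auto simp: quotient_def)
  then obtain w where w: "w \<in> params" "\<pi> \<in> uq_structures q" "given_by q \<pi> w"
    by (auto simp: series_eq structures_of_def)
  obtain C where "C \<in> phi_subsets \<union> special_subsets" "w \<in> C" using param_subset_facts(3) w by blast
  then show "X \<in> structures_of q ` (phi_subsets \<union> special_subsets)"
    using iso_class w \<pi>(2) by blast
next
  fix X assume "X \<in> structures_of q ` (phi_subsets \<union> special_subsets)"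
  then obtain C where C: "C \<in> phi_subsets \<union> special_subsets" "X = structures_of q C" by blast
  obtain w \<pi> where w: "w \<in> C" "\<pi> \<in> uq_structures q" "given_by q \<pi> w" by (rule structures_of_nonempty[OF C(1)])
  have "\<pi> \<in> series q" unfolding series_eq structures_of_def using w param_subset_facts(1) C by blast
  then show "X \<in> series q // iso_rel q"
    using iso_class[OF C(1) w] C(2) by (auto simp: quotient_def)
qed

end

theorem theorem13:
  fixes q :: complex
  assumes "q \<noteq> 0"
    and "\<forall>n::nat. 0 < n \<longrightarrow> q ^ n \<noteq> 1"
  shows "(\<forall>p\<in>params. \<exists>!\<pi>. \<pi> \<in> uq_structures q \<and> given_by q \<pi> p)
    \<and> series q = structures_of q params
    \<and> partition_on {(d0, s, t). d0 \<noteq> 0 \<and> s \<noteq> 0 \<and> t \<noteq> 0} phi_subsets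
    \<and> uncountable phi_subsets
    \<and> (\<forall>\<pi>1\<in>series q. \<forall>\<pi>2\<in>series q. \<forall>p1\<in>params. \<forall>p2\<in>params.
         given_by q \<pi>1 p1 \<longrightarrow> given_by q \<pi>2 p2 \<longrightarrow>
         ((\<pi>1, \<pi>2) \<in> iso_rel q \<longleftrightarrow> (\<exists>C\<in>phi_subsets \<union> special_subsets. p1 \<in> C \<and> p2 \<in> C)))
    \<and> inj_on (structures_of q) phi_subsets
    \<and> structures_of q ` phi_subsets \<subseteq> series q // iso_rel q
    \<and> series q // iso_rel q - structures_of q ` phi_subsets = structures_of q ` special_subsets
    \<and> card (structures_of q ` special_subsets) = 3"
proof (intro conjI ballI impI)
  note inj = structures_of_inj[OF assms] and quot = series_quotient[OF assms]
  show "series q = structures_of q params" by (rule series_eq[OF assms])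
  show "partition_on {(d0, s, t). d0 \<noteq> 0 \<and> s \<noteq> 0 \<and> t \<noteq> 0} phi_subsets" by (rule phi_partition)
  show "uncountable phi_subsets" by (rule phi_uncountable)
  show "\<exists>!\<pi>. \<pi> \<in> uq_structures q \<and> given_by q \<pi> p" if "p \<in> params" for p
    by (rule structure_exists_unique[OF assms that])
  show "inj_on (structures_of q) phi_subsets" using inj by (rule inj_on_subset) simp
  show "structures_of q ` phi_subsets \<subseteq> series q // iso_rel q" unfolding quot by blast
  have "structures_of q ` phi_subsets \<inter> structures_of q ` special_subsets = {}"
  proof -
    have "phi_subsets \<inter> special_subsets = {}" using param_subset_facts(5) by blast
    then show ?thesis
      using inj_on_image_Int[OF inj Un_upper1 Un_upper2] by simp
  qed
  then show "series q // iso_rel q - structures_of q ` phi_subsets = structures_of q ` special_subsets"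
    unfolding quot by blast
  have "inj_on (structures_of q) special_subsets" using inj by (rule inj_on_subset) simp
  then show "card (structures_of q ` special_subsets) = 3" by (simp add: card_image card_special)
next
  fix \<pi>1 \<pi>2 p1 p2
  assume \<pi>: "\<pi>1 \<in> series q" "\<pi>2 \<in> series q" and p: "p1 \<in> params" "p2 \<in> params"
    and g: "given_by q \<pi>1 p1" "given_by q \<pi>2 p2"
  have u: "\<pi>1 \<in> uq_structures q" "\<pi>2 \<in> uq_structures q" using \<pi> by (simp_all add: series_def)
  show "(\<pi>1, \<pi>2) \<in> iso_rel q \<longleftrightarrow> (\<exists>C\<in>phi_subsets \<union> special_subsets. p1 \<in> C \<and> p2 \<in> C)"
    unfolding iso_rel_iff[OF assms u p(1) g(1)]
    using given_by_param_unique[OF assms u(2) g(2)] p(2) g(2) by blast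
qed

end
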